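(* Let $n\ge1$, let $\mathcal{H}\subset\mathbb{R}^{n+1}$ be a Euclidean complete connected hyperbolic centroaffine hypersurface, let $k>1$ and let $h:U=\mathbb{R}^{>0}\cdot\mathcal{H}\to\mathbb{R}$ be the corresponding homogeneous function of degree $k$. Then $$g_L:=-\frac1k\tilde\nabla^2h$$ is a Lorentzian metric on the convex domain $U$. The Lorentzian manifold $(U,g_L)$ is globally hyperbolic if and only if $\mathcal{H}$ is complete with respect to the centroaffine metric $g$.
   Context: Let $\tilde\nabla$ be the canonical flat connection on $\mathbb{R}^{n+1}$ (so $\tilde\nabla^2h$ is the Hessian of $h$) and $\xi$ the position vector field. A smooth embedded hypersurface $\mathcal{H}\subset\mathbb{R}^{n+1}$ is centroaffine if $x\notin T_x\mathcal{H}$ for all $x\in\mathcal{H}$; its centroaffine metric $g$ is determined by $\tilde\nabla_XY=\nabla_XY+g(X,Y)\xi$ for $X,Y$ tangent to $\mathcal{H}$, with $\nabla_XY$ tangent to $\mathcal{H}$. It is hyperbolic if $g$ is positive definite, and Euclidean complete if it is complete for the Riemannian metric induced by the Euclidean scalar product. For such $\mathcal{H}$ the map $\mathbb{R}^{>0}\times\mathcal{H}\to U$, $(\lambda,x)\mapsto\lambda x$, is a diffeomorphism onto an open convex cone; the corresponding homogeneous function of degree $k$ is defined by $h(\lambda x)=\lambda^k$ for $\lambda>0$, $x\in\mathcal{H}$. Lorentzian metrics have signature $(-,+,\dots,+)$. *)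

theory Defs
  imports "HOL-Analysis.Analysis"
begin

text \<open>Classes \<open>C\<^sup>k\<close> and \<open>C\<^sup>\<infinity>\<close> on an open set: all iterated directional derivatives exist
  (as Frechet derivatives) and are continuous.  Both are only used for open \<open>S\<close>.\<close>

fun Ck_on :: "'a::real_normed_vector set \<Rightarrow> ('a \<Rightarrow> 'b::real_normed_vector) \<Rightarrow> nat \<Rightarrow> bool" where
  "Ck_on S f 0 \<longleftrightarrow> continuous_on S f"
| "Ck_on S f (Suc m) \<longleftrightarrow>
     (\<forall>x\<in>S. f differentiable (at x)) \<and>
     (\<forall>v. Ck_on S (\<lambda>x. frechet_derivative f (at x) v) m)"

definition smooth_on :: "'a::real_normed_vector set \<Rightarrow> ('a \<Rightarrow> 'b::real_normed_vector) \<Rightarrow> bool" where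
  "smooth_on S f \<longleftrightarrow> (\<forall>m. Ck_on S f m)"

text \<open>Embedded hypersurfaces are described by slice charts: a diffeomorphism \<open>\<phi>\<close> between open
  sets of the ambient space (with inverse \<open>\<psi>\<close>) flattens \<open>H\<close> to a piece of a linear hyperplane.\<close>

definition smooth_hypersurface :: "'a::euclidean_space set \<Rightarrow> bool" where
  "smooth_hypersurface H \<longleftrightarrow>
     (\<forall>p\<in>H. \<exists>V W \<phi> \<psi> e. open V \<and> p \<in> V \<and> open W \<and>
        homeomorphism V W \<phi> \<psi> \<and> smooth_on V \<phi> \<and> smooth_on W \<psi> \<and>
        e \<noteq> (0::'a) \<and> \<phi> ` (V \<inter> H) = W \<inter> {y. e \<bullet> y = 0})"

definition tangent_space :: "'a::euclidean_space set \<Rightarrow> 'a \<Rightarrow> 'a set" where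
  "tangent_space M p =
     {v. \<exists>\<epsilon>>0. \<exists>\<gamma>. smooth_on {-\<epsilon><..<\<epsilon>} \<gamma> \<and> \<gamma> ` {-\<epsilon><..<\<epsilon>} \<subseteq> M \<and>
           \<gamma> 0 = p \<and> (\<gamma> has_vector_derivative v) (at (0::real))}"

definition centroaffine :: "'a::euclidean_space set \<Rightarrow> bool" where
  "centroaffine H \<longleftrightarrow> (\<forall>x\<in>H. x \<notin> tangent_space H x)"

text \<open>Vector fields tangent to \<open>M\<close>, near a point represented by a smooth extension to an open
  subset \<open>V\<close> of the ambient space; the derivative of one tangent field along another does not
  depend on the extensions chosen.\<close>

definition tangent_field :: "'a::euclidean_space set \<Rightarrow> 'a set \<Rightarrow> ('a \<Rightarrow> 'a) \<Rightarrow> bool" where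
  "tangent_field M V X \<longleftrightarrow> smooth_on V X \<and> (\<forall>q \<in> V \<inter> M. X q \<in> tangent_space M q)"

definition flat_connection :: "('a::euclidean_space \<Rightarrow> 'a) \<Rightarrow> ('a \<Rightarrow> 'a) \<Rightarrow> 'a \<Rightarrow> 'a" where
  "flat_connection X Y p = frechet_derivative Y (at p) (X p)"

text \<open>The coefficient of the position vector in the Gauss formula
  \<open>flat_connection X Y = \<nabla>\<^sub>X Y + g(X,Y) \<xi>\<close>, evaluated at \<open>p\<close>, where \<open>X p = u\<close> and \<open>Y p = v\<close>.
  It is meaningful only for tangent vectors \<open>u\<close>, \<open>v\<close> at a point \<open>p\<close> of a centroaffine
  hypersurface.\<close>

definition centroaffine_metric :: "'a::euclidean_space set \<Rightarrow> 'a \<Rightarrow> 'a \<Rightarrow> 'a \<Rightarrow> real" where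
  "centroaffine_metric H p u v =
     (THE c. \<forall>V X Y. open V \<and> p \<in> V \<and> tangent_field H V X \<and> tangent_field H V Y \<and>
               X p = u \<and> Y p = v \<longrightarrow>
             flat_connection X Y p - c *\<^sub>R p \<in> tangent_space H p)"

definition hyperbolic :: "'a::euclidean_space set \<Rightarrow> bool" where
  "hyperbolic H \<longleftrightarrow>
     (\<forall>p\<in>H. \<forall>v\<in>tangent_space H p. v \<noteq> 0 \<longrightarrow> centroaffine_metric H p v v > 0)"

definition piecewise_smooth_path :: "(real \<Rightarrow> 'a::euclidean_space) \<Rightarrow> bool" where
  "piecewise_smooth_path \<gamma> \<longleftrightarrow>
     (\<exists>(m::nat) (\<tau>::nat \<Rightarrow> real). \<tau> 0 = 0 \<and> \<tau> m = 1 \<and> (\<forall>i<m. \<tau> i < \<tau> (Suc i)) \<and>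
        (\<forall>i<m. \<exists>S \<sigma>. open S \<and> {\<tau> i..\<tau> (Suc i)} \<subseteq> S \<and> smooth_on S \<sigma> \<and>
                   (\<forall>t\<in>{\<tau> i..\<tau> (Suc i)}. \<gamma> t = \<sigma> t)))"

text \<open>The finitely many break points, where \<open>vector_derivative\<close> is arbitrary, do not affect the
  integral.\<close>

definition curve_length ::
    "('a::euclidean_space \<Rightarrow> 'a \<Rightarrow> 'a \<Rightarrow> real) \<Rightarrow> (real \<Rightarrow> 'a) \<Rightarrow> ennreal" where
  "curve_length G \<gamma> =
     (\<integral>\<^sup>+ t\<in>{0..1}. ennreal (sqrt (G (\<gamma> t) (vector_derivative \<gamma> (at t))
                                        (vector_derivative \<gamma> (at t)))) \<partial>lborel)"

definition riemannian_dist ::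
    "'a::euclidean_space set \<Rightarrow> ('a \<Rightarrow> 'a \<Rightarrow> 'a \<Rightarrow> real) \<Rightarrow> 'a \<Rightarrow> 'a \<Rightarrow> ennreal" where
  "riemannian_dist M G p q =
     Inf {curve_length G \<gamma> | \<gamma>. piecewise_smooth_path \<gamma> \<and> path_image \<gamma> \<subseteq> M \<and>
                               pathstart \<gamma> = p \<and> pathfinish \<gamma> = q}"

definition riemannian_complete ::
    "'a::euclidean_space set \<Rightarrow> ('a \<Rightarrow> 'a \<Rightarrow> 'a \<Rightarrow> real) \<Rightarrow> bool" where
  "riemannian_complete M G \<longleftrightarrow>
     (\<forall>\<sigma>::nat \<Rightarrow> 'a. (\<forall>i. \<sigma> i \<in> M) \<and>
          (\<forall>\<epsilon>>0. \<exists>N. \<forall>i\<ge>N. \<forall>j\<ge>N. riemannian_dist M G (\<sigma> i) (\<sigma> j) < ennreal \<epsilon>) \<longrightarrow>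
        (\<exists>p\<in>M. (\<lambda>i. riemannian_dist M G (\<sigma> i) p) \<longlonglongrightarrow> 0))"

definition euclidean_complete :: "'a::euclidean_space set \<Rightarrow> bool" where
  "euclidean_complete M \<longleftrightarrow> riemannian_complete M (\<lambda>p u v. u \<bullet> v)"

definition hessian :: "('a::euclidean_space \<Rightarrow> real) \<Rightarrow> 'a \<Rightarrow> 'a \<Rightarrow> 'a \<Rightarrow> real" where
  "hessian f p u v = frechet_derivative (\<lambda>q. frechet_derivative f (at q) v) (at p) u"

text \<open>The signature is given by an orthonormal frame \<open>b\<close>, indexed by \<open>Basis\<close>, in which exactly
  one vector is timelike; such a frame is automatically a basis.\<close>

definition lorentzian_metric_on ::
    "'a::euclidean_space set \<Rightarrow> ('a \<Rightarrow> 'a \<Rightarrow> 'a \<Rightarrow> real) \<Rightarrow> bool" where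
  "lorentzian_metric_on U G \<longleftrightarrow>
     (\<forall>u v. smooth_on U (\<lambda>p. G p u v)) \<and>
     (\<forall>p\<in>U. bilinear (G p) \<and> (\<forall>u v. G p u v = G p v u) \<and>
        (\<exists>b. \<exists>i\<^sub>0\<in>Basis. \<forall>i\<in>Basis. \<forall>j\<in>Basis.
           G p (b i) (b j) = (if i \<noteq> j then 0 else if i = (i\<^sub>0::'a) then -1 else 1)))"

text \<open>Curves are parametrized by a nonempty open, possibly unbounded, interval with end points
  \<open>a\<close>, \<open>b\<close> in the extended reals.  A curve that contains one of its end points has a limit
  there, hence is extendible, so open intervals suffice.\<close>

definition inextendible_timelike_curve ::
    "'a::euclidean_space set \<Rightarrow> ('a \<Rightarrow> 'a \<Rightarrow> 'a \<Rightarrow> real) \<Rightarrow> ereal \<Rightarrow> ereal \<Rightarrow> (real \<Rightarrow> 'a) \<Rightarrow> bool"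
  where
  "inextendible_timelike_curve U G a b \<gamma> \<longleftrightarrow>
     a < b \<and> smooth_on (einterval a b) \<gamma> \<and> \<gamma> ` einterval a b \<subseteq> U \<and>
     (\<forall>t\<in>einterval a b.
        G (\<gamma> t) (vector_derivative \<gamma> (at t)) (vector_derivative \<gamma> (at t)) < 0) \<and>
     \<not> (\<exists>p\<in>U. ((\<gamma> \<circ> real_of_ereal) \<longlongrightarrow> p) (at_right a)) \<and>
     \<not> (\<exists>p\<in>U. ((\<gamma> \<circ> real_of_ereal) \<longlongrightarrow> p) (at_left b))"

definition cauchy_hypersurface ::
    "'a::euclidean_space set \<Rightarrow> ('a \<Rightarrow> 'a \<Rightarrow> 'a \<Rightarrow> real) \<Rightarrow> 'a set \<Rightarrow> bool" where
  "cauchy_hypersurface U G S \<longleftrightarrow> S \<subseteq> U \<and>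
     (\<forall>a b \<gamma>. inextendible_timelike_curve U G a b \<gamma> \<longrightarrow> (\<exists>!t. t \<in> einterval a b \<and> \<gamma> t \<in> S))"

text \<open>Global hyperbolicity is taken to be the existence of a Cauchy hypersurface, i.e. a subset
  met exactly once by every inextendible timelike curve.\<close>

definition globally_hyperbolic ::
    "'a::euclidean_space set \<Rightarrow> ('a \<Rightarrow> 'a \<Rightarrow> 'a \<Rightarrow> real) \<Rightarrow> bool" where
  "globally_hyperbolic U G \<longleftrightarrow> (\<exists>S. cauchy_hypersurface U G S)"

end

theory Submission
  imports Defs
begin

text \<open>The whole statement is read off from one function: the radial function
  \<open>\<lambda>\<close> on \<open>U\<close>, homogeneous of degree one and equal to \<open>1\<close> on \<open>H\<close>, so that
  \<open>h = \<lambda>\<^sup>k\<close>.  Put \<open>Q = - Hess \<lambda>\<close>.  Homogeneity gives \<open>Q\<^sub>q(q, \<cdot>) = 0\<close> and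
  \<open>d\<lambda>\<^sub>q(q) = \<lambda>(q)\<close>, and on the tangent spaces \<open>ker d\<lambda>\<close> of \<open>H\<close> the form \<open>Q\<close> is the
  centroaffine metric.  Differentiating \<open>\<lambda>\<^sup>k\<close> twice,
  \<open>g\<^sub>L = \<lambda>\<^sup>k\<^sup>-\<^sup>1 Q - (k - 1) \<lambda>\<^sup>k\<^sup>-\<^sup>2 d\<lambda> d\<lambda>\<close>.  As \<open>Q\<close> is positive definite on \<open>ker d\<lambda>\<close>
  and vanishes along the position vector, \<open>g\<^sub>L\<close> is Lorentzian; with
  \<open>t = ln \<lambda>\<close> it is conformal to the product \<open>- (k - 1) dt\<^sup>2 + g\<close> on the product of the line
  with \<open>H\<close>.  In particular a curve \<open>e\<^sup>t x\<close> with \<open>x\<close> in \<open>H\<close> is timelike exactly when the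
  \<open>g\<close>-speed of \<open>x\<close> is less than \<open>sqrt(k - 1) \<bar>t'\<bar>\<close> (lemmas \<open>Q_pr\<close> and
  \<open>power_metric_timelike\<close>).

  That \<open>\<lambda>\<close> is smooth and \<open>U\<close> is open comes from slice charts: transversality of the position
  vector makes the radial equation solvable by the inverse function theorem
  (\<open>hypersurface_radial\<close>).

  Convexity (\<open>convex_U\<close>).  Since \<open>Q\<close> is nonnegative, \<open>\<lambda>\<close> is concave along segments in \<open>U\<close>.
  For fixed \<open>x\<close>, the set of points \<open>y\<close> of \<open>U\<close> that see \<open>x\<close> along a segment inside \<open>U\<close> is open,
  and the point is that it is closed in \<open>U\<close>: along a limit segment concavity keeps \<open>\<lambda>\<close> away
  from \<open>0\<close>, so up to the first exit the radial projection to \<open>H\<close> has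
  finite Euclidean length, and Euclidean completeness provides an end point, which shows that
  the segment had not left \<open>U\<close> after all.

  Complete implies globally hyperbolic (\<open>complete_imp_cauchy\<close>).  The slice \<open>t = 0\<close>, that is \<open>H\<close>, is
  a Cauchy hypersurface.  Along a timelike curve \<open>t\<close> is strictly monotone, and if it
  stayed on one side of \<open>0\<close> it would converge at one end; then the projection to \<open>H\<close> is Cauchy
  there, hence converges, and the curve is extendible.

  Globally hyperbolic implies complete (\<open>cauchy_imp_complete\<close>).  The rays show that a Cauchy
  hypersurface \<open>S\<close> is a graph \<open>t = f\<close> over \<open>H\<close>.  If \<open>H\<close> is incomplete, it contains a smooth
  curve \<open>X\<close> of finite length without limit.  Because no inextendible timelike curve over \<open>X\<close>
  meets \<open>S\<close> twice, \<open>f\<close> changes along \<open>X\<close> by less than a function \<open>A\<close> that grows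
  slightly faster than the rescaled arc length and is still bounded.  Then \<open>A + c\<close>, for
  the infimum \<open>c\<close> of \<open>f - A\<close> along \<open>X\<close>, is the height of an inextendible timelike curve
  that stays strictly below \<open>S\<close>.
  The finite-length curve has to be smooth, although distances are measured with piecewise
  smooth paths; this is why curves that are constant near their ends (\<open>flat_curve\<close>) are used,
  of which even infinitely many can be concatenated smoothly.\<close>

section \<open>Calculus of smooth functions\<close>

lemma linear_basis_expansion:
  fixes f :: "'a::euclidean_space \<Rightarrow> 'b::real_vector"
  assumes "linear f" shows "f v = (\<Sum>b\<in>Basis. (v \<bullet> b) *\<^sub>R f b)"
  using linear_sum[OF assms, of "\<lambda>b. (v \<bullet> b) *\<^sub>R b" Basis]
  by (simp add: linear_scale[OF assms] euclidean_representation)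

lemma bilinear_basis_expansion:
  fixes B :: "'a::euclidean_space \<Rightarrow> 'a \<Rightarrow> real"
  assumes B: "bilinear B"
  shows "B v v = (\<Sum>b\<in>Basis. \<Sum>c\<in>Basis. (v \<bullet> b) * ((v \<bullet> c) * B b c))"
proof -
  have "B v v = B (\<Sum>b\<in>Basis. (v \<bullet> b) *\<^sub>R b) (\<Sum>c\<in>Basis. (v \<bullet> c) *\<^sub>R c)"
    by (simp add: euclidean_representation)
  also have "\<dots> = (\<Sum>(b, c)\<in>Basis \<times> Basis. B ((v \<bullet> b) *\<^sub>R b) ((v \<bullet> c) *\<^sub>R c))"
    by (rule bilinear_sum[OF B])
  also have "\<dots> = (\<Sum>b\<in>Basis. \<Sum>c\<in>Basis. (v \<bullet> b) * ((v \<bullet> c) * B b c))"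
    by (simp add: sum.cartesian_product bilinear_lmul[OF B] bilinear_rmul[OF B] mult.left_commute)
  finally show ?thesis .
qed

text \<open>The derivatives in \<open>Ck_on\<close> are chosen by \<open>frechet_derivative\<close>, which has no meaning where a
  function is not differentiable; on an open set they depend only on the values there.\<close>

lemma Ck_on_cong:
  assumes "open S" "\<And>x. x \<in> S \<Longrightarrow> f x = g x" "Ck_on S f m"
  shows "Ck_on S g m"
  using assms(2,3)
proof (induction m arbitrary: f g)
  case 0
  then show ?case by (auto cong: continuous_on_cong)
next
  case (Suc m)
  have d: "g differentiable (at x)" if "x \<in> S" for x
  proof -
    have "(f has_derivative frechet_derivative f (at x)) (at x)"
      using Suc.prems that by (auto simp: frechet_derivative_works)
    from has_derivative_transform_within_open[OF this assms(1) that, of g] Suc.prems that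
    show ?thesis by (auto simp: differentiable_def)
  qed
  have e: "frechet_derivative f (at x) = frechet_derivative g (at x)" if "x \<in> S" for x
    using Suc.prems that assms(1) by (intro frechet_derivative_transform_within_open[of f x S g]) auto
  have "Ck_on S (\<lambda>x. frechet_derivative g (at x) v) m" for v
    by (rule Suc.IH[of "\<lambda>x. frechet_derivative f (at x) v"]) (use Suc.prems e in auto)
  then show ?case using d by simp
qed

lemma Ck_on_SucI:
  assumes "open S" "\<And>x. x \<in> S \<Longrightarrow> (f has_derivative f' x) (at x)"
    "\<And>v. Ck_on S (\<lambda>x. f' x v) m"
  shows "Ck_on S f (Suc m)"
proof -
  have "f' x v = frechet_derivative f (at x) v" if "x \<in> S" for x v
    using frechet_derivative_at[OF assms(2)[OF that]] by (simp add: fun_eq_iff)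
  then have "Ck_on S (\<lambda>x. frechet_derivative f (at x) v) m" for v
    using Ck_on_cong[OF assms(1), of "\<lambda>x. f' x v" "\<lambda>x. frechet_derivative f (at x) v", OF _ assms(3)]
    by simp
  then show ?thesis using assms(2) by (auto simp: differentiable_def)
qed

lemma Ck_on_SucD:
  assumes "Ck_on S f (Suc m)" "x \<in> S"
  shows "(f has_derivative frechet_derivative f (at x)) (at x)"
  using assms by (auto simp: frechet_derivative_works)

lemma Ck_on_Suc_imp: "Ck_on S f (Suc m) \<Longrightarrow> Ck_on S f m"
proof (induction m arbitrary: f)
  case 0
  then show ?case
    by (auto intro!: continuous_at_imp_continuous_on differentiable_imp_continuous_within)
next
  case (Suc m)
  then show ?case by simp
qed

lemma Ck_on_subset: "Ck_on S f m \<Longrightarrow> T \<subseteq> S \<Longrightarrow> Ck_on T f m"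
  by (induction m arbitrary: f) (auto intro: continuous_on_subset)

lemma Ck_on_local:
  assumes "\<And>x. x \<in> S \<Longrightarrow> \<exists>T. open T \<and> x \<in> T \<and> Ck_on T f m"
  shows "Ck_on S f m"
  using assms
proof (induction m arbitrary: f)
  case 0
  then show ?case
    by (simp add: continuous_at_imp_continuous_on) (meson continuous_at_imp_continuous_on continuous_on_eq_continuous_at)
next
  case (Suc m)
  show ?case unfolding Ck_on.simps
  proof (intro conjI ballI allI)
    fix x assume "x \<in> S"
    from Suc.prems[OF this] show "f differentiable at x" by auto
  next
    fix v show "Ck_on S (\<lambda>x. frechet_derivative f (at x) v) m"
    proof (rule Suc.IH)
      fix x assume "x \<in> S"
      from Suc.prems[OF this] show "\<exists>T. open T \<and> x \<in> T \<and> Ck_on T (\<lambda>x. frechet_derivative f (at x) v) m"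
        by auto
    qed
  qed
qed

lemma Ck_on_const: "open S \<Longrightarrow> Ck_on S (\<lambda>x. c) m"
proof (induction m arbitrary: c)
  case (Suc m)
  show ?case by (rule Ck_on_SucI[where f'="\<lambda>x v. 0"]) (use Suc in auto)
qed simp

lemma Ck_on_bounded_linear:
  assumes "open S" "bounded_linear f" shows "Ck_on S f m"
proof (cases m)
  case 0
  then show ?thesis using assms
    by (simp add: linear_continuous_on)
next
  case (Suc n)
  show ?thesis unfolding Suc
    by (rule Ck_on_SucI[where f'="\<lambda>x. f"])
       (use assms Ck_on_const in \<open>auto intro: bounded_linear_imp_has_derivative\<close>)
qed

lemma Ck_on_add:
  assumes "open S" "Ck_on S f m" "Ck_on S g m" shows "Ck_on S (\<lambda>x. f x + g x) m"
  using assms(2,3)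
proof (induction m arbitrary: f g)
  case 0 then show ?case by (auto intro: continuous_intros)
next
  case (Suc m)
  show ?case
    by (rule Ck_on_SucI[OF assms(1), OF has_derivative_add[OF Ck_on_SucD[OF Suc.prems(1)] Ck_on_SucD[OF Suc.prems(2)]]])
       (use Suc in auto)
qed

lemma Ck_on_bounded_bilinear:
  assumes "bounded_bilinear pr" "open S" "Ck_on S f m" "Ck_on S g m"
  shows "Ck_on S (\<lambda>x. pr (f x) (g x)) m"
  using assms(3,4)
proof (induction m arbitrary: f g)
  case 0 then show ?case by (auto intro: bounded_bilinear.continuous_on[OF assms(1)])
next
  case (Suc m)
  show ?case
  proof (rule Ck_on_SucI[OF assms(2), OF bounded_bilinear.FDERIV[OF assms(1) Ck_on_SucD[OF Suc.prems(1)] Ck_on_SucD[OF Suc.prems(2)]]])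
    show "Ck_on S (\<lambda>x. pr (f x) (frechet_derivative g (at x) v) + pr (frechet_derivative f (at x) v) (g x)) m" for v
      by (rule Ck_on_add[OF assms(2) Suc.IH Suc.IH])
         (use Suc.prems Ck_on_Suc_imp[OF Suc.prems(1)] Ck_on_Suc_imp[OF Suc.prems(2)] in auto)
  qed auto
qed

lemma Ck_on_sum:
  assumes "open S" "\<And>i. i \<in> I \<Longrightarrow> Ck_on S (f i) m"
  shows "Ck_on S (\<lambda>x. \<Sum>i\<in>I. f i x) m"
  using assms(2)
proof (induction I rule: infinite_finite_induct)
  case (insert i I)
  then show ?case using Ck_on_add[OF assms(1), of "f i" m "\<lambda>x. \<Sum>i\<in>I. f i x"] by simp
qed (auto intro: Ck_on_const assms)

text \<open>The chain rule produces \<open>D f(g x)(D g(x) v)\<close>, whose direction varies with \<open>x\<close>.  Expanding it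
  in a basis leaves derivatives of \<open>f\<close> in constant directions composed with \<open>g\<close>, to which the
  induction hypothesis applies.\<close>

lemma Ck_on_compose:
  fixes g :: "'a::real_normed_vector \<Rightarrow> 'b::euclidean_space"
  assumes "open S" "open T" "Ck_on S g m" "Ck_on T f m" "g ` S \<subseteq> T"
  shows "Ck_on S (\<lambda>x. f (g x)) m"
  using assms(3,4,5)
proof (induction m arbitrary: f)
  case 0 then show ?case by (auto intro: continuous_on_compose2)
next
  case (Suc m)
  show ?case
  proof (rule Ck_on_SucI[OF assms(1)])
    fix x assume x: "x \<in> S"
    show "((\<lambda>x. f (g x)) has_derivative (\<lambda>v. frechet_derivative f (at (g x)) (frechet_derivative g (at x) v))) (at x)"
      using has_derivative_compose[OF Ck_on_SucD[OF Suc.prems(1) x] Ck_on_SucD[OF Suc.prems(2), of "g x"]] x Suc.prems(3)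
      by auto
  next
    fix v
    have C: "Ck_on S (\<lambda>x. \<Sum>b\<in>Basis. (frechet_derivative g (at x) v \<bullet> b) *\<^sub>R frechet_derivative f (at (g x)) b) m"
    proof (intro Ck_on_sum assms(1) Ck_on_bounded_bilinear[OF bounded_bilinear_scaleR]
        Ck_on_bounded_bilinear[OF bounded_bilinear_inner] Ck_on_const)
      show "Ck_on S (\<lambda>x. frechet_derivative g (at x) v) m" using Suc.prems by simp
      show "Ck_on S (\<lambda>x. frechet_derivative f (at (g x)) b) m" if "b \<in> Basis" for b
        by (rule Suc.IH[of "\<lambda>y. frechet_derivative f (at y) b"]) (use Suc.prems Ck_on_Suc_imp[OF Suc.prems(1)] in auto)
    qed
    show "Ck_on S (\<lambda>x. frechet_derivative f (at (g x)) (frechet_derivative g (at x) v)) m"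
    proof (rule Ck_on_cong[OF assms(1) _ C])
      fix x assume x: "x \<in> S"
      then have "linear (frechet_derivative f (at (g x)))"
        using Suc.prems by (intro linear_frechet_derivative) auto
      from linear_basis_expansion[OF this, of "frechet_derivative g (at x) v"]
      show "(\<Sum>b\<in>Basis. (frechet_derivative g (at x) v \<bullet> b) *\<^sub>R frechet_derivative f (at (g x)) b)
        = frechet_derivative f (at (g x)) (frechet_derivative g (at x) v)" by (rule sym)
    qed
  qed
qed

lemma smooth_onD: "smooth_on S f \<Longrightarrow> x \<in> S \<Longrightarrow> (f has_derivative frechet_derivative f (at x)) (at x)"
  unfolding smooth_on_def using Ck_on_SucD[of S f 0] by blast

lemma smooth_on_frechet: "smooth_on S f \<Longrightarrow> smooth_on S (\<lambda>x. frechet_derivative f (at x) v)"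
  unfolding smooth_on_def using Ck_on.simps(2) by blast

lemma smooth_onI_deriv:
  assumes "open S" "\<And>x. x \<in> S \<Longrightarrow> (f has_derivative f' x) (at x)"
    "\<And>v. smooth_on S (\<lambda>x. f' x v)"
  shows "smooth_on S f"
  unfolding smooth_on_def
proof
  fix m show "Ck_on S f m"
    using Ck_on_Suc_imp[OF Ck_on_SucI[OF assms(1,2), of m]] assms(3) unfolding smooth_on_def by auto
qed

lemma smooth_on_has_vector_derivative:
  assumes "smooth_on S f" "x \<in> S"
  shows "(f has_vector_derivative vector_derivative f (at x)) (at x)"
  using smooth_onD[OF assms] vector_derivative_works differentiable_def by blast

lemma vector_derivative_frechet:
  assumes "smooth_on S f" "x \<in> S"
  shows "vector_derivative f (at x) = frechet_derivative f (at x) 1"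
  using frechet_derivative_at[OF smooth_on_has_vector_derivative[OF assms, unfolded has_vector_derivative_def]]
  by (simp add: fun_eq_iff) (metis scaleR_one)

lemma smooth_on_vector_derivative:
  assumes "open S" "smooth_on S f" shows "smooth_on S (\<lambda>x. vector_derivative f (at x))"
  unfolding smooth_on_def
  by (intro allI, rule Ck_on_cong[OF assms(1), of "\<lambda>x. frechet_derivative f (at x) 1"])
    (use smooth_on_frechet[OF assms(2), of 1, unfolded smooth_on_def] vector_derivative_frechet[OF assms(2)] in auto)

lemma smooth_onI_vector_derivative:
  fixes f :: "real \<Rightarrow> 'b::real_normed_vector"
  assumes "open S" "\<And>x. x \<in> S \<Longrightarrow> (f has_vector_derivative f' x) (at x)" "smooth_on S f'"
  shows "smooth_on S f"
proof (rule smooth_onI_deriv[OF assms(1)])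
  show "x \<in> S \<Longrightarrow> (f has_derivative (\<lambda>v. v *\<^sub>R f' x)) (at x)" for x
    using assms(2) unfolding has_vector_derivative_def by auto
  show "smooth_on S (\<lambda>x. v *\<^sub>R f' x)" for v
    using assms(3) Ck_on_bounded_bilinear[OF bounded_bilinear_scaleR assms(1) Ck_on_const[OF assms(1)]]
    unfolding smooth_on_def by blast
qed

lemma smooth_on_cong: "open S \<Longrightarrow> (\<And>x. x \<in> S \<Longrightarrow> f x = g x) \<Longrightarrow> smooth_on S f \<Longrightarrow> smooth_on S g"
  unfolding smooth_on_def using Ck_on_cong[of S f g] by auto

lemma smooth_on_subset: "smooth_on S f \<Longrightarrow> T \<subseteq> S \<Longrightarrow> smooth_on T f"
  unfolding smooth_on_def using Ck_on_subset by metis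

lemma smooth_on_local:
  "(\<And>x. x \<in> S \<Longrightarrow> \<exists>T. open T \<and> x \<in> T \<and> smooth_on T f) \<Longrightarrow> smooth_on S f"
  unfolding smooth_on_def by (intro allI Ck_on_local) blast

lemma smooth_on_continuous: "smooth_on S f \<Longrightarrow> continuous_on S f"
  unfolding smooth_on_def using Ck_on.simps(1) by blast

lemma smooth_on_const: "open S \<Longrightarrow> smooth_on S (\<lambda>x. c)"
  unfolding smooth_on_def using Ck_on_const by blast

lemma smooth_on_linear: "open S \<Longrightarrow> bounded_linear f \<Longrightarrow> smooth_on S f"
  unfolding smooth_on_def using Ck_on_bounded_linear by blast

lemma smooth_on_id: "open S \<Longrightarrow> smooth_on S (\<lambda>x. x)"
  using smooth_on_linear bounded_linear_ident by blast

lemma smooth_on_add: "open S \<Longrightarrow> smooth_on S f \<Longrightarrow> smooth_on S g \<Longrightarrow> smooth_on S (\<lambda>x. f x + g x)"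
  unfolding smooth_on_def using Ck_on_add by blast

lemma smooth_on_bilinear:
  "bounded_bilinear pr \<Longrightarrow> open S \<Longrightarrow> smooth_on S f \<Longrightarrow> smooth_on S g \<Longrightarrow> smooth_on S (\<lambda>x. pr (f x) (g x))"
  unfolding smooth_on_def using Ck_on_bounded_bilinear by blast

lemmas smooth_on_scaleR = smooth_on_bilinear[OF bounded_bilinear_scaleR]

lemmas smooth_on_mult = smooth_on_bilinear[OF bounded_bilinear_mult]

lemmas smooth_on_inner = smooth_on_bilinear[OF bounded_bilinear_inner]

lemma smooth_on_minus: "open S \<Longrightarrow> smooth_on S f \<Longrightarrow> smooth_on S (\<lambda>x. - f x)"
  using smooth_on_scaleR[of S "\<lambda>x. -1" f] smooth_on_const[of S "-1"] by simp

lemma smooth_on_diff: "open S \<Longrightarrow> smooth_on S f \<Longrightarrow> smooth_on S g \<Longrightarrow> smooth_on S (\<lambda>x. f x - g x)"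
  using smooth_on_add[of S f "\<lambda>x. - g x"] smooth_on_minus[of S g] by simp

lemma smooth_on_sum: "open S \<Longrightarrow> (\<And>i. i \<in> I \<Longrightarrow> smooth_on S (f i)) \<Longrightarrow> smooth_on S (\<lambda>x. \<Sum>i\<in>I. f i x)"
  unfolding smooth_on_def using Ck_on_sum[of S I f] by auto

lemma smooth_on_compose:
  fixes g :: "'a::real_normed_vector \<Rightarrow> 'b::euclidean_space"
  shows "open S \<Longrightarrow> open T \<Longrightarrow> smooth_on S g \<Longrightarrow> smooth_on T f \<Longrightarrow> g ` S \<subseteq> T \<Longrightarrow> smooth_on S (\<lambda>x. f (g x))"
  unfolding smooth_on_def using Ck_on_compose[of S T g _ f] by auto

lemma Ck_on_inverse: "Ck_on {0<..} (inverse :: real \<Rightarrow> real) m"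
proof (induction m)
  case 0 then show ?case by (auto intro!: continuous_intros)
next
  case (Suc m)
  show ?case
  proof (rule Ck_on_SucI[where f'="\<lambda>x v. - (inverse x * v * inverse x)"])
    show "Ck_on {0<..} (\<lambda>x. - (inverse x * v * inverse x)) m" for v :: real
      using Ck_on_bounded_bilinear[OF bounded_bilinear_mult _ Ck_on_bounded_bilinear[OF bounded_bilinear_mult _ Suc Ck_on_const[of _ "-v"]] Suc]
      by simp
  qed (auto intro!: has_derivative_inverse')
qed

lemma Ck_on_powr: "Ck_on {0<..} (\<lambda>x::real. x powr a) m"
proof (induction m arbitrary: a)
  case 0 then show ?case by (auto intro!: continuous_intros)
next
  case (Suc m)
  show ?case
  proof (rule Ck_on_SucI[where f'="\<lambda>x v. (a * x powr (a - 1)) * v"])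
    show "Ck_on {0<..} (\<lambda>x. (a * x powr (a - 1)) * v) m" for v :: real
      using Ck_on_bounded_bilinear[OF bounded_bilinear_mult _ Ck_on_const[of _ "a * v"] Suc[of "a - 1"]]
      by (simp add: ac_simps)
    show "((\<lambda>x. x powr a) has_derivative (\<lambda>v. (a * x powr (a - 1)) * v)) (at x)" if "x \<in> {0<..}" for x
      using that has_real_derivative_powr[of x a] unfolding has_field_derivative_def by auto
  qed auto
qed

lemma Ck_on_exp: "Ck_on UNIV (exp :: real \<Rightarrow> real) m"
proof (induction m)
  case (Suc m)
  show ?case
  proof (rule Ck_on_SucI[where f'="\<lambda>x v. exp x * v"])
    show "Ck_on UNIV (\<lambda>x. exp x * v) m" for v :: real
      using Ck_on_bounded_bilinear[OF bounded_bilinear_mult _ Suc Ck_on_const[of _ v]] by simp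
    show "(exp has_derivative (\<lambda>v. exp x * v)) (at x)" for x :: real
      using DERIV_exp unfolding has_field_derivative_def by auto
  qed auto
qed (auto intro!: continuous_intros)

lemma smooth_on_inverse:
  assumes "open S" "smooth_on S f" "\<And>x. x \<in> S \<Longrightarrow> f x > (0::real)"
  shows "smooth_on S (\<lambda>x. inverse (f x))"
  by (rule smooth_on_compose[OF assms(1) _ assms(2), of "{0<..}"])
     (use assms(3) Ck_on_inverse in \<open>auto simp: smooth_on_def\<close>)

text \<open>Reduced to the positive case by \<open>1 / f = f / f\<^sup>2\<close>.\<close>

lemma smooth_on_inverse_ne0:
  assumes "open S" "smooth_on S f" "\<And>x. x \<in> S \<Longrightarrow> f x \<noteq> (0::real)"
  shows "smooth_on S (\<lambda>x. inverse (f x))"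
proof (rule smooth_on_cong[OF assms(1)])
  show "smooth_on S (\<lambda>x. f x * inverse (f x * f x))"
    by (intro smooth_on_mult smooth_on_inverse assms(1,2)) (use assms(3) in \<open>metis mult_neg_neg mult_pos_pos neqE\<close>)
  show "f x * inverse (f x * f x) = inverse (f x)" if "x \<in> S" for x
    using assms(3)[OF that] by (simp add: field_simps)
qed

lemma smooth_on_powr:
  assumes "open S" "smooth_on S f" "\<And>x. x \<in> S \<Longrightarrow> f x > (0::real)"
  shows "smooth_on S (\<lambda>x. f x powr a)"
  by (rule smooth_on_compose[OF assms(1) _ assms(2), of "{0<..}"])
     (use assms(3) Ck_on_powr in \<open>auto simp: smooth_on_def\<close>)

lemma smooth_on_sqrt:
  assumes "open S" "smooth_on S f" "\<And>x. x \<in> S \<Longrightarrow> f x > (0::real)"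
  shows "smooth_on S (\<lambda>x. sqrt (f x))"
  by (rule smooth_on_cong[OF assms(1) _ smooth_on_powr[OF assms, of "1/2"]])
     (use assms(3) in \<open>auto simp: powr_half_sqrt less_imp_le\<close>)

lemma smooth_on_exp:
  assumes "open S" "smooth_on S f"
  shows "smooth_on S (\<lambda>x. exp (f x :: real))"
  by (rule smooth_on_compose[OF assms(1) _ assms(2), of UNIV])
     (use Ck_on_exp in \<open>auto simp: smooth_on_def\<close>)

lemma smooth_affine: "smooth_on UNIV (\<lambda>s::real. c + d * s)"
  by (intro smooth_on_add smooth_on_mult smooth_on_const smooth_on_id open_UNIV)

lemma continuous_on_frechet:
  fixes f :: "'a::euclidean_space \<Rightarrow> 'b::real_normed_vector"
  assumes "smooth_on S f"
  shows "continuous_on (S \<times> UNIV) (\<lambda>z. frechet_derivative f (at (fst z)) (snd z))"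
proof -
  have c: "continuous_on (S \<times> UNIV) (\<lambda>z. frechet_derivative f (at (fst z)) b)" for b
    by (rule continuous_on_compose2[OF smooth_on_continuous[OF smooth_on_frechet[OF assms]]])
       (auto intro: continuous_intros)
  have "continuous_on (S \<times> UNIV) (\<lambda>z. \<Sum>b\<in>Basis. (snd z \<bullet> b) *\<^sub>R frechet_derivative f (at (fst z)) b)"
    by (intro continuous_intros c)
  then show ?thesis
  proof (rule continuous_on_cong[THEN iffD1, rotated -1])
    fix z assume "z \<in> S \<times> (UNIV :: 'a set)"
    then have "linear (frechet_derivative f (at (fst z)))"
      using has_derivative_linear[OF smooth_onD[OF assms]] by auto
    from linear_basis_expansion[OF this]
    show "(\<Sum>b\<in>Basis. (snd z \<bullet> b) *\<^sub>R frechet_derivative f (at (fst z)) b) = frechet_derivative f (at (fst z)) (snd z)"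
      by (rule sym)
  qed simp
qed

lemma curve_chain_rule:
  assumes "(f has_derivative f') (at (c s))" "(c has_vector_derivative v) (at (s::real))"
  shows "((\<lambda>s. f (c s)) has_vector_derivative f' v) (at s)"
proof -
  have l: "linear f'" using assms(1) has_derivative_linear by blast
  show ?thesis
    using has_derivative_compose[OF assms(2)[unfolded has_vector_derivative_def] assms(1)]
    by (simp add: has_vector_derivative_def linear_scale[OF l])
qed

lemma line_has_vector_derivative: "((\<lambda>s. p + s *\<^sub>R u) has_vector_derivative u) (at (s::real))"
  by (auto intro!: derivative_eq_intros)

section \<open>Symmetry of the Hessian\<close>

lemma hessian_deriv_line:
  assumes "open S" "smooth_on S f" "p + s *\<^sub>R u \<in> S"
  shows "((\<lambda>s. frechet_derivative f (at (p + s *\<^sub>R u)) v) has_vector_derivative hessian f (p + s *\<^sub>R u) u v) (at s)"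
  unfolding hessian_def
  by (rule curve_chain_rule[OF smooth_onD[OF smooth_on_frechet[OF assms(2)] assms(3)] line_has_vector_derivative])

text \<open>Two applications of the mean value theorem, first in the direction \<open>u\<close> and then in the
  direction \<open>v\<close>.  The left-hand side is symmetric in \<open>u\<close> and \<open>v\<close>, which yields Schwarz's theorem.\<close>

lemma second_difference:
  assumes S: "open S" "smooth_on S f" and t: "t > 0"
    and sq: "\<And>a b. 0 \<le> a \<Longrightarrow> a \<le> t \<Longrightarrow> 0 \<le> b \<Longrightarrow> b \<le> t \<Longrightarrow> p + a *\<^sub>R u + b *\<^sub>R v \<in> S"
  shows "\<exists>a b. 0 < a \<and> a < t \<and> 0 < b \<and> b < t \<and>
    f (p + t *\<^sub>R u + t *\<^sub>R v) - f (p + t *\<^sub>R u) - f (p + t *\<^sub>R v) + f p = t * t * hessian f (p + a *\<^sub>R u + b *\<^sub>R v) v u"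
proof -
  let ?g = "\<lambda>s. f (p + s *\<^sub>R u + t *\<^sub>R v) - f (p + s *\<^sub>R u)"
  let ?g' = "\<lambda>s. frechet_derivative f (at (p + s *\<^sub>R u + t *\<^sub>R v)) u - frechet_derivative f (at (p + s *\<^sub>R u)) u"
  have "(?g has_real_derivative ?g' s) (at s)" if "0 \<le> s" "s \<le> t" for s
  proof -
    have 1: "((\<lambda>s. p + s *\<^sub>R u + t *\<^sub>R v) has_vector_derivative u) (at s)"
      by (auto intro!: derivative_eq_intros)
    have "(?g has_vector_derivative ?g' s) (at s)"
      using sq[OF that, of t] sq[OF that, of 0] t
      by (intro has_vector_derivative_diff curve_chain_rule[OF smooth_onD[OF S(2)] 1] curve_chain_rule[OF smooth_onD[OF S(2)] line_has_vector_derivative]) auto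
    then show ?thesis by (simp add: has_real_derivative_iff_has_vector_derivative)
  qed
  from MVT2[OF t this] obtain a where a: "0 < a" "a < t" "?g t - ?g 0 = t * ?g' a" by auto
  have "((\<lambda>b. frechet_derivative f (at (p + a *\<^sub>R u + b *\<^sub>R v)) u) has_real_derivative
      hessian f (p + a *\<^sub>R u + s *\<^sub>R v) v u) (at s)" if "0 \<le> s" "s \<le> t" for s
    using hessian_deriv_line[OF S, of "p + a *\<^sub>R u" s v u] sq[of a s] a that
    by (simp add: has_real_derivative_iff_has_vector_derivative)
  from MVT2[OF t this] obtain b where b: "0 < b" "b < t" "?g' a = t * hessian f (p + a *\<^sub>R u + b *\<^sub>R v) v u" by auto
  show ?thesis using a b by (intro exI[of _ a] exI[of _ b]) auto
qed

lemma continuous_on_hessian: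
  assumes "smooth_on S f" shows "continuous_on S (\<lambda>p. hessian f p u v)"
  unfolding hessian_def by (intro smooth_on_continuous smooth_on_frechet assms)

text \<open>The two mixed derivatives are limits of the same symmetric second difference quotient.\<close>

lemma hessian_sym:
  assumes S: "open S" "smooth_on S f" and p: "p \<in> S"
  shows "hessian f p u v = hessian f p v u"
proof (rule ccontr)
  assume ne: "hessian f p u v \<noteq> hessian f p v u"
  define e where "e = \<bar>hessian f p u v - hessian f p v u\<bar> / 2"
  have e: "e > 0" using ne by (simp add: e_def)
  have "isCont (\<lambda>p. hessian f p a b) p" for a b
    using continuous_on_hessian[OF S(2)] S(1) p continuous_on_eq_continuous_at by blast
  then have "((\<lambda>p. hessian f p a b) \<longlongrightarrow> hessian f p a b) (nhds p)" for a b
    using iffD1[OF tendsto_at_iff_tendsto_nhds] unfolding isCont_def by blast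
  then have ev: "eventually (\<lambda>q. dist (hessian f q a b) (hessian f p a b) < e) (nhds p)" for a b
    using tendstoD e by blast
  have "eventually (\<lambda>q. q \<in> S \<and> dist (hessian f q u v) (hessian f p u v) < e \<and> dist (hessian f q v u) (hessian f p v u) < e) (nhds p)"
    using ev[of u v] ev[of v u] eventually_nhds_in_open[OF S(1) p] by eventually_elim auto
  then obtain d where d: "d > 0" "\<And>q. dist q p < d \<Longrightarrow> q \<in> S \<and> dist (hessian f q u v) (hessian f p u v) < e \<and> dist (hessian f q v u) (hessian f p v u) < e"
    unfolding eventually_nhds_metric by auto
  \<comment> \<open>The side \<open>t\<close> of the parallelogram is so small that it stays in the ball of radius \<open>d\<close>.\<close>
  define K where "K = norm u + norm v + 1"
  define t where "t = d / (2 * K)"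
  have pos: "K > 0" by (simp add: add_nonneg_pos K_def)
  then have t: "t > 0" using d(1) by (simp add: t_def)
  have near: "dist (p + a *\<^sub>R u + b *\<^sub>R v) p < d" if "0 \<le> a" "a \<le> t" "0 \<le> b" "b \<le> t" for a b
  proof -
    have "dist (p + a *\<^sub>R u + b *\<^sub>R v) p \<le> a * norm u + b * norm v"
      using norm_triangle_ineq[of "a *\<^sub>R u" "b *\<^sub>R v"] that by (simp add: dist_norm add.assoc)
    also have "\<dots> \<le> t * K" unfolding K_def
      using that t mult_right_mono[of a t "norm u"] mult_right_mono[of b t "norm v"] by (simp add: algebra_simps)
    also have "\<dots> = d / 2" using pos by (simp add: t_def)
    finally show ?thesis using d(1) by simp
  qed
  have near': "dist (p + b *\<^sub>R v + a *\<^sub>R u) p < d" if "0 \<le> a" "a \<le> t" "0 \<le> b" "b \<le> t" for a b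
  proof -
    have "p + b *\<^sub>R v + a *\<^sub>R u = p + a *\<^sub>R u + b *\<^sub>R v" by simp
    then show ?thesis using near[OF that] by (simp only:)
  qed
  obtain a b where ab: "0 < a" "a < t" "0 < b" "b < t"
     "f (p + t *\<^sub>R u + t *\<^sub>R v) - f (p + t *\<^sub>R u) - f (p + t *\<^sub>R v) + f p = t * t * hessian f (p + a *\<^sub>R u + b *\<^sub>R v) v u"
    using second_difference[OF S t, of p u v] near d(2) by blast
  obtain a' b' where ab': "0 < a'" "a' < t" "0 < b'" "b' < t"
     "f (p + t *\<^sub>R v + t *\<^sub>R u) - f (p + t *\<^sub>R v) - f (p + t *\<^sub>R u) + f p = t * t * hessian f (p + a' *\<^sub>R v + b' *\<^sub>R u) u v"
    using second_difference[OF S t, of p v u] near' d(2) by blast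
  have sw: "p + t *\<^sub>R v + t *\<^sub>R u = p + t *\<^sub>R u + t *\<^sub>R v" by simp
  have "t * t * hessian f (p + a' *\<^sub>R v + b' *\<^sub>R u) u v = t * t * hessian f (p + a *\<^sub>R u + b *\<^sub>R v) v u"
    using ab(5) ab'(5) unfolding sw by linarith
  then have eq: "hessian f (p + a' *\<^sub>R v + b' *\<^sub>R u) u v = hessian f (p + a *\<^sub>R u + b *\<^sub>R v) v u"
    using t by simp
  have "dist (hessian f (p + a *\<^sub>R u + b *\<^sub>R v) v u) (hessian f p v u) < e" using d(2)[OF near] ab by simp
  moreover have "dist (hessian f (p + a' *\<^sub>R v + b' *\<^sub>R u) u v) (hessian f p u v) < e" using d(2)[OF near'] ab' by simp
  moreover have "\<And>a b c d :: real. \<bar>a - c\<bar> < d / 2 \<Longrightarrow> \<bar>a - b\<bar> < d / 2 \<Longrightarrow> \<bar>b - c\<bar> < d" by linarith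
  ultimately show False unfolding eq dist_real_def e_def by blast
qed

lemma hessian_bilinear:
  assumes S: "open S" "smooth_on S f" and p: "p \<in> S"
  shows "bilinear (hessian f p)"
proof -
  have l: "linear (\<lambda>u. hessian f p u v)" for v
    unfolding hessian_def using has_derivative_linear[OF smooth_onD[OF smooth_on_frechet[OF S(2)] p]] by auto
  then have "linear (hessian f p u)" for u
    using hessian_sym[OF S p, of u] by (metis (no_types, lifting) ext)
  with l show ?thesis unfolding bilinear_def by auto
qed

section \<open>A smooth step function\<close>

text \<open>The extra power of \<open>1 / x\<close> makes the family closed under differentiation, up to linear
  combinations, so that smoothness of all members follows by one induction.\<close>

definition flat_exp :: "nat \<Rightarrow> real \<Rightarrow> real" where
  "flat_exp j x = (if x > 0 then exp (- inverse x) * inverse x ^ j else 0)"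

lemma flat_exp_lim: "(flat_exp j \<longlongrightarrow> 0) (at 0)"
proof -
  have "((\<lambda>x::real. inverse x ^ j / exp (inverse x)) \<longlongrightarrow> 0) (at_right 0)"
    using filterlim_compose[OF tendsto_power_div_exp_0 filterlim_inverse_at_top_right] by simp
  then have "(flat_exp j \<longlongrightarrow> 0) (at_right 0)"
    by (rule Lim_transform_eventually)
       (auto simp: flat_exp_def exp_minus field_simps intro!: eventually_at_rightI[of 0 1])
  moreover have "(flat_exp j \<longlongrightarrow> 0) (at_left 0)"
    by (rule Lim_transform_eventually[OF tendsto_const]) (auto simp: flat_exp_def intro!: eventually_at_leftI[of "-1" 0])
  ultimately show ?thesis using filterlim_split_at_real by blast
qed

lemma flat_exp_deriv:
  "(flat_exp j has_vector_derivative flat_exp (Suc (Suc j)) x - real j * flat_exp (Suc j) x) (at x)"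
proof -
  consider "x > 0" | "x < 0" | "x = 0" by linarith
  then have "(flat_exp j has_real_derivative flat_exp (Suc (Suc j)) x - real j * flat_exp (Suc j) x) (at x)"
  proof cases
    case 1
    have "((\<lambda>x. exp (- inverse x) * inverse x ^ j) has_real_derivative
        exp (- inverse x) * (inverse x * inverse x) * inverse x ^ j - real j * (exp (- inverse x) * inverse x ^ (Suc j))) (at x)"
    proof (cases j)
      case (Suc i)
      have d1: "((\<lambda>x. exp (- inverse x)) has_real_derivative exp (- inverse x) * (inverse x * inverse x)) (at x)"
        using 1 by (auto intro!: derivative_eq_intros simp: power2_eq_square)
      have d2: "(inverse has_real_derivative - (inverse x * inverse x)) (at x)"
        using 1 by (auto intro!: derivative_eq_intros simp: power2_eq_square)
      show ?thesis unfolding Suc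
        using DERIV_mult[OF d1 DERIV_power_Suc[OF d2, of i]] by (simp add: algebra_simps)
    qed (use 1 in \<open>auto intro!: derivative_eq_intros simp: power2_eq_square algebra_simps\<close>)
    then have "(flat_exp j has_real_derivative
        exp (- inverse x) * (inverse x * inverse x) * inverse x ^ j - real j * (exp (- inverse x) * inverse x ^ (Suc j))) (at x)"
      by (rule has_field_derivative_transform_within_open[of _ _ _ "{0<..}"]) (use 1 in \<open>auto simp: flat_exp_def\<close>)
    then show ?thesis using 1 by (simp add: flat_exp_def mult_ac)
  next
    case 2
    have "(flat_exp j has_real_derivative 0) (at x)"
      by (rule has_field_derivative_transform_within_open[of "\<lambda>x. 0" _ _ "{..<0}"]) (use 2 in \<open>auto simp: flat_exp_def\<close>)
    then show ?thesis using 2 by (simp add: flat_exp_def)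
  next
    case 3
    have "((\<lambda>y. flat_exp (Suc j) y) \<longlongrightarrow> 0) (at 0)" by (rule flat_exp_lim)
    then have "((\<lambda>y. (flat_exp j y - flat_exp j 0) / (y - 0)) \<longlongrightarrow> 0) (at 0)"
      by (rule Lim_transform_eventually) (auto simp: flat_exp_def eventually_at_filter field_simps)
    then have "(flat_exp j has_real_derivative 0) (at 0)"
      by (simp add: has_field_derivative_iff)
    then show ?thesis using 3 by (simp add: flat_exp_def)
  qed
  then show ?thesis by (simp add: has_real_derivative_iff_has_vector_derivative)
qed

lemma smooth_flat_exp: "smooth_on UNIV (flat_exp j)"
proof -
  have "Ck_on UNIV (flat_exp j) m" for m
  proof (induction m arbitrary: j)
    case 0
    then show ?case using flat_exp_deriv
      by (auto intro!: continuous_at_imp_continuous_on has_vector_derivative_continuous)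
  next
    case (Suc m)
    show ?case
    proof (rule Ck_on_SucI[where f'="\<lambda>x v. v *\<^sub>R (flat_exp (Suc (Suc j)) x - real j * flat_exp (Suc j) x)"])
      show "(flat_exp j has_derivative (\<lambda>v. v *\<^sub>R (flat_exp (Suc (Suc j)) x - real j * flat_exp (Suc j) x))) (at x)" for x
        using flat_exp_deriv[unfolded has_vector_derivative_def] .
      show "Ck_on UNIV (\<lambda>x. v *\<^sub>R (flat_exp (Suc (Suc j)) x - real j * flat_exp (Suc j) x)) m" for v
        using Ck_on_add[OF open_UNIV
           Ck_on_bounded_bilinear[OF bounded_bilinear_mult open_UNIV Ck_on_const[OF open_UNIV, of v] Suc[of "Suc (Suc j)"]]
           Ck_on_bounded_bilinear[OF bounded_bilinear_mult open_UNIV Ck_on_const[OF open_UNIV, of "- v * real j"] Suc[of "Suc j"]]]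
        by (simp add: algebra_simps)
    qed simp
  qed
  then show ?thesis by (simp add: smooth_on_def)
qed

text \<open>A normalized primitive of a bump supported in \<open>[1/3, 2/3]\<close>.  It is monotone, so
  reparametrizing a curve with it preserves the length, and locally constant near the ends,
  so that reparametrized curves can be joined smoothly.\<close>

lemma smooth_step_exists:
  obtains \<beta> \<beta>' :: "real \<Rightarrow> real" where "smooth_on UNIV \<beta>" "smooth_on UNIV \<beta>'"
    "\<And>s. (\<beta> has_vector_derivative \<beta>' s) (at s)" "\<And>s. \<beta>' s \<ge> 0"
    "\<And>s. s \<le> 1/3 \<Longrightarrow> \<beta> s = 0" "\<And>s. s \<ge> 2/3 \<Longrightarrow> \<beta> s = 1" "\<And>s. 0 \<le> \<beta> s" "\<And>s. \<beta> s \<le> 1"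
proof -
  let ?b = "\<lambda>s. flat_exp 0 (s - 1/3) * flat_exp 0 (2/3 - s)"
  have sb: "smooth_on UNIV ?b"
    by (intro smooth_on_mult smooth_on_compose[OF _ _ _ smooth_flat_exp] smooth_on_diff smooth_on_id smooth_on_const) auto
  have nn: "?b s \<ge> 0" for s by (simp add: flat_exp_def)
  obtain F where F: "\<And>s. (F has_vector_derivative ?b s) (at s)"
    using einterval_antiderivative[of "-\<infinity>" \<infinity> ?b] smooth_on_continuous[OF sb] by (auto simp: continuous_on_eq_continuous_at)
  have Fd: "(F has_real_derivative ?b s) (at s)" for s using F[of s] by (simp add: has_real_derivative_iff_has_vector_derivative)
  have mono: "F a \<le> F b" if "a \<le> b" for a b
    using DERIV_nonneg_imp_nondecreasing[OF that, of F] Fd nn by blast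
  have c1: "F s = F (1/3)" if "s \<le> 1/3" for s
  proof (cases "s = 1/3")
    case False
    then have "s < 1/3" using that by simp
    from MVT2[OF this Fd] obtain z where "s < z" "z < 1/3" "F (1/3) - F s = (1/3 - s) * ?b z" by blast
    then show ?thesis by (simp add: flat_exp_def)
  qed (erule arg_cong)
  have c2: "F s = F (2/3)" if "s \<ge> 2/3" for s
  proof (cases "s = 2/3")
    case False
    then have "2/3 < s" using that by simp
    from MVT2[OF this Fd] obtain z where "2/3 < z" "z < s" "F s - F (2/3) = (s - 2/3) * ?b z" by blast
    then show ?thesis by (simp add: flat_exp_def)
  qed (erule arg_cong)
  obtain z where z: "1/3 < z" "z < 2/3" "F (2/3) - F (1/3) = (2/3 - 1/3) * ?b z"
    using MVT2[of "1/3" "2/3" F ?b] Fd by auto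
  define Z where "Z = F (2/3) - F (1/3)"
  have Z: "Z > 0" proof -
    have "0 < (2/3 - 1/3) * ?b z" using z(1,2) by (simp add: flat_exp_def)
    then show ?thesis using z(3) unfolding Z_def by linarith
  qed
  have sF: "smooth_on UNIV F" by (rule smooth_onI_vector_derivative[OF _ F sb]) simp
  show ?thesis
  proof (rule that[of "\<lambda>s. inverse Z * (F s - F (1/3))" "\<lambda>s. inverse Z * ?b s"])
    show "smooth_on UNIV (\<lambda>s. inverse Z * (F s - F (1/3)))"
      by (intro smooth_on_mult smooth_on_diff smooth_on_const sF open_UNIV)
    show "smooth_on UNIV (\<lambda>s. inverse Z * ?b s)"
      by (intro smooth_on_mult[OF open_UNIV smooth_on_const sb] open_UNIV)
    show "((\<lambda>s. inverse Z * (F s - F (1/3))) has_vector_derivative inverse Z * ?b s) (at s)" for s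
      by (auto intro!: derivative_eq_intros F)
    show "inverse Z * ?b s \<ge> 0" for s using Z by (simp add: flat_exp_def)
    show "inverse Z * (F s - F (1/3)) = 0" if "s \<le> 1/3" for s using c1[OF that] by simp
    show "inverse Z * (F s - F (1/3)) = 1" if "2/3 \<le> s" for s using c2[OF that] Z by (simp add: Z_def)
    show "0 \<le> inverse Z * (F s - F (1/3))" for s
      using mono[of "1/3" s] c1[of s] Z by (cases "s \<le> 1/3") auto
    show "inverse Z * (F s - F (1/3)) \<le> 1" for s
      using mono[of s "2/3"] c2[of s] Z by (cases "s \<ge> 2/3") (auto simp: Z_def field_simps)
  qed
qed

section \<open>Flat curves and their concatenation\<close>

definition flat_curve :: "'a::euclidean_space set \<Rightarrow> 'a \<Rightarrow> 'a \<Rightarrow> (real \<Rightarrow> 'a) \<Rightarrow> bool" where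
  "flat_curve M p q x \<longleftrightarrow> smooth_on UNIV x \<and> range x \<subseteq> M \<and>
     (\<forall>s\<le>1/3. x s = p) \<and> (\<forall>s\<ge>2/3. x s = q)"

lemma flat_curve_ends:
  assumes "flat_curve M p q x" shows "x 0 = p" "x 1 = q" "p \<in> M" "q \<in> M"
proof -
  have "(0::real) \<le> 1/3 \<longrightarrow> x 0 = p" "(1::real) \<ge> 2/3 \<longrightarrow> x 1 = q" using assms unfolding flat_curve_def by blast+
  then show e: "x 0 = p" "x 1 = q" by auto
  have "x 0 \<in> M" "x 1 \<in> M" using assms unfolding flat_curve_def by blast+
  then show "p \<in> M" "q \<in> M" using e by auto
qed

lemma flat_curve_in: "flat_curve M p q x \<Longrightarrow> x s \<in> M"
  unfolding flat_curve_def by blast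

lemma flat_curve_smooth: "flat_curve M p q x \<Longrightarrow> smooth_on UNIV x"
  unfolding flat_curve_def by blast

lemma flat_curve_const: "p \<in> M \<Longrightarrow> flat_curve M p p (\<lambda>s. p)"
  unfolding flat_curve_def by (auto intro: smooth_on_const)

text \<open>The infinite concatenation: the \<open>n\<close>-th curve is run through on \<open>[n, n + 1]\<close>, and the negative
  half-line is mapped to the starting point.\<close>

definition glue :: "(nat \<Rightarrow> real \<Rightarrow> 'a) \<Rightarrow> real \<Rightarrow> 'a" where
  "glue x s = (if s < 0 then x 0 0 else x (nat \<lfloor>s\<rfloor>) (s - of_int \<lfloor>s\<rfloor>))"

text \<open>The formula for the \<open>i\<close>-th piece remains valid slightly before time \<open>i\<close>, because both
  neighbouring pieces are constant there.  These overlapping open intervals cover the line,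
  which is what makes the concatenation smooth.\<close>

lemma glue_eq:
  assumes "\<And>i. flat_curve M (p i) (p (Suc i)) (x i)"
    and "s < real i + 1" "real i - 1/3 < s \<or> i = 0"
  shows "glue x s = x i (s - real i)"
proof -
  have c0: "x j t = p j" if "t \<le> 1/3" for j t using assms(1)[of j] that unfolding flat_curve_def by auto
  have c1: "x j t = p (Suc j)" if "2/3 \<le> t" for j t using assms(1)[of j] that unfolding flat_curve_def by auto
  show ?thesis
  proof (cases "s \<ge> real i")
    case True
    then have "\<lfloor>s\<rfloor> = int i" using assms(2) by (intro floor_unique) auto
    then have "glue x s = (if s < 0 then x 0 0 else x (nat (int i)) (s - of_int (int i)))" unfolding glue_def by (simp only:)
    then show ?thesis using True by simp
  next
    case False
    show ?thesis
    proof (cases i)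
      case 0
      then show ?thesis using False c0[of 0] c0[of s] by (simp add: glue_def)
    next
      case (Suc j)
      then have s: "real j + 2/3 < s" "s < real j + 1" using assms(3) False by auto
      then have "\<lfloor>s\<rfloor> = int j" by (intro floor_unique) auto
      then have "glue x s = (if s < 0 then x 0 0 else x (nat (int j)) (s - of_int (int j)))" unfolding glue_def by (simp only:)
      then have "glue x s = x j (s - real j)" using s by simp
      then show ?thesis using s c0[of "s - real i" i] c1[of "s - real j" j] Suc by simp
    qed
  qed
qed

lemma glue_smooth:
  assumes f: "\<And>i. flat_curve M (p i) (p (Suc i)) (x i)"
  shows "smooth_on UNIV (glue x)" "range (glue x) \<subseteq> M"
    "\<And>s. s \<le> 1/3 \<Longrightarrow> glue x s = p 0" "\<And>i. glue x (real i) = p i"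
proof -
  have ex: "\<exists>i. s < real i + 1 \<and> (real i - 1/3 < s \<or> i = 0)" for s
  proof (cases "s < 0")
    case True then show ?thesis by (intro exI[of _ 0]) auto
  next
    case False
    then have "real (nat \<lfloor>s\<rfloor>) \<le> s" "s < real (nat \<lfloor>s\<rfloor>) + 1" by linarith+
    then have "s < real (nat \<lfloor>s\<rfloor>) + 1 \<and> real (nat \<lfloor>s\<rfloor>) - 1/3 < s" by linarith
    then show ?thesis by blast
  qed
  show "smooth_on UNIV (glue x)"
  proof (rule smooth_on_local)
    fix s obtain i where i: "s < real i + 1" "real i - 1/3 < s \<or> i = 0" using ex by blast
    let ?T = "if i = 0 then {..<1} else {real i - 1/3<..<real i + 1}"
    have o: "open ?T" by auto
    have "smooth_on UNIV (\<lambda>s. x i (s - real i))"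
      using smooth_on_compose[OF open_UNIV open_UNIV smooth_affine[of "- real i" 1], of "x i"] f[of i]
      unfolding flat_curve_def by auto
    then have "smooth_on ?T (\<lambda>s. x i (s - real i))" using smooth_on_subset[OF _ subset_UNIV] by blast
    then have "smooth_on ?T (glue x)"
      by (rule smooth_on_cong[OF o, rotated]) (use glue_eq[of M p x, OF f, of _ i] in \<open>auto split: if_splits\<close>)
    then show "\<exists>T. open T \<and> s \<in> T \<and> smooth_on T (glue x)" using o i by (intro exI[of _ ?T]) auto
  qed
  show "range (glue x) \<subseteq> M"
    using flat_curve_in[OF f] unfolding glue_def by auto
  show "glue x s = p 0" if "s \<le> 1/3" for s
    using glue_eq[of M p x, OF f, of s 0] that f[of 0] unfolding flat_curve_def by auto
  show "glue x (real i) = p i" for i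
    using glue_eq[of M p x, OF f, of "real i" i] f[of i] unfolding flat_curve_def by auto
qed

section \<open>Limits of monotone functions\<close>

text \<open>The statement is for arbitrary linear orders so that it serves both real parameters and
  extended real end points of intervals.\<close>

lemma mono_limit_at_left:
  fixes m :: "'b::linorder_topology \<Rightarrow> real"
  assumes s0: "a < s0" "s0 < b"
    and mono: "\<And>s t. a < s \<Longrightarrow> s \<le> t \<Longrightarrow> t < b \<Longrightarrow> m s \<le> m t"
    and bd: "\<And>s. a < s \<Longrightarrow> s < b \<Longrightarrow> m s \<le> B"
  obtains l where "(m \<longlongrightarrow> l) (at_left b)"
proof -
  have ba: "bdd_above (m ` {a<..<b})" using bd by (intro bdd_aboveI[of _ B]) auto
  have ne: "m ` {a<..<b} \<noteq> {}" using s0 by auto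
  have "(m \<longlongrightarrow> Sup (m ` {a<..<b})) (at_left b)"
  proof (rule order_tendstoI)
    fix y assume "y < Sup (m ` {a<..<b})"
    then obtain s where s: "a < s" "s < b" "y < m s" using less_cSup_iff[OF ne ba] by auto
    have "y < m t" if "s < t" "t < b" for t using mono[OF s(1) less_imp_le[OF that(1)] that(2)] s(3) by simp
    then show "\<forall>\<^sub>F x in at_left b. y < m x" using eventually_at_left[OF s(2)] s(2) by blast
  next
    fix y assume y: "Sup (m ` {a<..<b}) < y"
    have "m t < y" if "a < t" "t < b" for t using cSup_upper[OF _ ba, of "m t"] that y by auto
    then show "\<forall>\<^sub>F x in at_left b. m x < y" using eventually_at_left[of a b] s0 by (meson less_trans)
  qed
  then show ?thesis using that by blast
qed

lemma mono_limit_at_right: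
  fixes m :: "'b::linorder_topology \<Rightarrow> real"
  assumes s0: "a < s0" "s0 < b"
    and mono: "\<And>s t. a < s \<Longrightarrow> s \<le> t \<Longrightarrow> t < b \<Longrightarrow> m s \<le> m t"
    and bd: "\<And>s. a < s \<Longrightarrow> s < b \<Longrightarrow> B \<le> m s"
  obtains l where "(m \<longlongrightarrow> l) (at_right a)"
proof -
  have ba: "bdd_below (m ` {a<..<b})" using bd by (intro bdd_belowI[of _ B]) auto
  have ne: "m ` {a<..<b} \<noteq> {}" using s0 by auto
  have "(m \<longlongrightarrow> Inf (m ` {a<..<b})) (at_right a)"
  proof (rule order_tendstoI)
    fix y assume "Inf (m ` {a<..<b}) < y"
    then obtain s where s: "a < s" "s < b" "m s < y" using cInf_less_iff[OF ne ba] by auto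
    have "m t < y" if "a < t" "t < s" for t using mono[OF that(1) less_imp_le[OF that(2)] s(2)] s(3) by simp
    then show "\<forall>\<^sub>F x in at_right a. m x < y" using eventually_at_right[OF s(1)] s(1) by blast
  next
    fix y assume y: "y < Inf (m ` {a<..<b})"
    have "y < m t" if "a < t" "t < b" for t using cInf_lower[OF _ ba, of "m t"] that y by auto
    then show "\<forall>\<^sub>F x in at_right a. y < m x" using eventually_at_right[of a b] s0 by (meson less_trans)
  qed
  then show ?thesis using that by blast
qed

section \<open>Length distance and completeness\<close>

definition speed :: "('a::euclidean_space \<Rightarrow> 'a \<Rightarrow> 'a \<Rightarrow> real) \<Rightarrow> (real \<Rightarrow> 'a) \<Rightarrow> real \<Rightarrow> real" where
  "speed G c s = sqrt (G (c s) (vector_derivative c (at s)) (vector_derivative c (at s)))"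

text \<open>The part of Riemannian geometry that is used: a nonnegative quadratic form, continuous on
  an open neighbourhood \<open>U\<close> of \<open>M\<close>.  It is applied to the Euclidean metric and to the
  form that restricts to the centroaffine metric.\<close>

locale length_structure =
  fixes U M :: "'a::euclidean_space set" and G :: "'a \<Rightarrow> 'a \<Rightarrow> 'a \<Rightarrow> real"
  assumes openU: "open U" and MU: "M \<subseteq> U"
    and contG: "continuous_on (U \<times> UNIV) (\<lambda>z. G (fst z) (snd z) (snd z))"
    and nonnegG: "\<And>p v. p \<in> U \<Longrightarrow> G p v v \<ge> 0"
    and scaleG: "\<And>p v c. p \<in> U \<Longrightarrow> G p (c *\<^sub>R v) (c *\<^sub>R v) = c\<^sup>2 * G p v v"
begin

lemma continuous_on_speed:
  assumes "open S" "smooth_on S c" "T \<subseteq> S" "c ` T \<subseteq> U"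
  shows "continuous_on T (speed G c)"
proof -
  have c1: "continuous_on T c" using smooth_on_continuous[OF assms(2)] assms(3) continuous_on_subset by blast
  have c2: "continuous_on T (\<lambda>s. vector_derivative c (at s))"
    using smooth_on_continuous[OF smooth_on_vector_derivative[OF assms(1,2)]] assms(3) continuous_on_subset by blast
  have "continuous_on T (\<lambda>s. (c s, vector_derivative c (at s)))" using c1 c2 by (intro continuous_intros)
  from continuous_on_compose2[OF contG this] assms(4)
  have "continuous_on T (\<lambda>s. G (c s) (vector_derivative c (at s)) (vector_derivative c (at s)))" by auto
  then show ?thesis unfolding speed_def by (intro continuous_intros)
qed

lemma speed_nonneg: "c s \<in> U \<Longrightarrow> speed G c s \<ge> 0"
  unfolding speed_def using nonnegG by simp

lemma speed_reparam:
  assumes "(g has_vector_derivative g') (at t)" "g' \<ge> 0" "x (g t) \<in> U"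
    "(x has_vector_derivative vector_derivative x (at (g t))) (at (g t))"
  shows "speed G (\<lambda>t. x (g t)) t = g' * speed G x (g t)"
proof -
  have "((\<lambda>t. x (g t)) has_vector_derivative g' *\<^sub>R vector_derivative x (at (g t))) (at t)"
    using curve_chain_rule[OF assms(4)[unfolded has_vector_derivative_def] assms(1)] .
  then have v: "vector_derivative (\<lambda>t. x (g t)) (at t) = g' *\<^sub>R vector_derivative x (at (g t))"
    by (rule vector_derivative_at)
  have "speed G (\<lambda>t. x (g t)) t
      = sqrt (g'\<^sup>2 * G (x (g t)) (vector_derivative x (at (g t))) (vector_derivative x (at (g t))))"
    unfolding speed_def v scaleG[OF assms(3)] by (rule refl)
  then show ?thesis using assms(2) unfolding speed_def by (simp only: real_sqrt_mult real_sqrt_abs abs_of_nonneg)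
qed

lemma speed_cong:
  assumes "open T" "s \<in> T" "\<And>t. t \<in> T \<Longrightarrow> c t = d t"
  shows "speed G c s = speed G d s"
proof -
  have "(c has_vector_derivative v) (at s) \<longleftrightarrow> (d has_vector_derivative v) (at s)" for v
    using has_vector_derivative_transform_within_open[of c v s T d] has_vector_derivative_transform_within_open[of d v s T c] assms
    by auto
  then have "vector_derivative c (at s) = vector_derivative d (at s)"
    unfolding vector_derivative_def by simp
  then show ?thesis using assms unfolding speed_def by simp
qed

text \<open>The affine reparametrization to \<open>[0, 1]\<close> is a piecewise smooth path with a single piece.\<close>

lemma dist_le_length:
  assumes S: "open S" "smooth_on S x" "{a..b} \<subseteq> S" and ab: "a \<le> b" and M: "x ` {a..b} \<subseteq> M"
  shows "riemannian_dist M G (x a) (x b) \<le> ennreal (integral {a..b} (speed G x))"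
proof -
  define g where "g = (\<lambda>t. a + (b - a) * t)"
  have gd: "(g has_vector_derivative (b - a)) (at t)" for t
    unfolding g_def by (auto intro!: derivative_eq_intros)
  have gin: "g t \<in> {a..b}" if "t \<in> {0..1}" for t
    using that ab mult_left_mono[of t 1 "b - a"] by (auto simp: g_def)
  have sg: "smooth_on UNIV g" unfolding g_def by (rule smooth_affine)
  have og: "open (g -` S)"
    using S(1) smooth_on_continuous[OF sg] continuous_open_preimage[of UNIV g S] by (simp add: vimage_def)
  have pw: "piecewise_smooth_path (\<lambda>t. x (g t))"
    unfolding piecewise_smooth_path_def
  proof (intro exI[of _ "1::nat"] exI[of _ real] conjI allI impI)
    fix i :: nat assume "i < 1"
    have "smooth_on (g -` S) (\<lambda>t. x (g t))"
      by (rule smooth_on_compose[OF og S(1) smooth_on_subset[OF sg] S(2)]) auto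
    moreover have "{0..1} \<subseteq> g -` S" using gin S(3) by blast
    then have "{real i..real (Suc i)} \<subseteq> g -` S" using \<open>i < 1\<close> by simp
    ultimately show "\<exists>Sa \<sigma>. open Sa \<and> {real i..real (Suc i)} \<subseteq> Sa \<and> smooth_on Sa \<sigma> \<and> (\<forall>t\<in>{real i..real (Suc i)}. x (g t) = \<sigma> t)"
      using og by (intro exI[of _ "g -` S"] exI[of _ "\<lambda>t. x (g t)"]) auto
  qed auto
  have sp: "speed G (\<lambda>t. x (g t)) t = (b - a) * speed G x (g t)" if "t \<in> {0..1}" for t
  proof -
    have "x (g t) \<in> U" "g t \<in> S" using gin[OF that] M MU S(3) by blast+
    then show ?thesis using ab by (intro speed_reparam gd smooth_on_has_vector_derivative[OF S(2)]) auto
  qed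
  have "((\<lambda>t. (b - a) *\<^sub>R speed G x (g t)) has_integral integral {g 0..g 1} (speed G x)) {0..1}"
  proof (rule has_integral_substitution)
    show "g ` {0..1} \<subseteq> {a..b}" using gin by auto
    show "continuous_on {a..b} (speed G x)" using continuous_on_speed[OF S] M MU by auto
    show "(g has_real_derivative b - a) (at t within {0..1})" for t
      using gd has_field_derivative_at_within by (auto simp: has_real_derivative_iff_has_vector_derivative intro: has_vector_derivative_at_within)
  qed (use ab in \<open>auto simp: g_def\<close>)
  moreover have "g 0 = a" "g 1 = b" by (auto simp: g_def)
  ultimately have hi0: "((\<lambda>t. (b - a) *\<^sub>R speed G x (g t)) has_integral integral {a..b} (speed G x)) {0..1}"
    by (simp only:)
  have hi: "((\<lambda>t. speed G (\<lambda>t. x (g t)) t) has_integral integral {a..b} (speed G x)) {0..1}"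
    by (rule has_integral_eq[OF _ hi0]) (simp only: sp real_scaleR_def)
  have gU: "x (g t) \<in> U" if "t \<in> {0..1}" for t using gin[OF that] M MU by blast
  have "curve_length G (\<lambda>t. x (g t)) = (\<integral>\<^sup>+u. ennreal (speed G (\<lambda>t. x (g t)) u) * indicator {0..1} u \<partial>lborel)"
    unfolding curve_length_def speed_def by (rule refl)
  also have "\<dots> = ennreal (integral {a..b} (speed G x))"
    by (rule nn_integral_has_integral_lebesgue'[OF _ hi]) (use gU in \<open>auto intro: speed_nonneg\<close>)
  finally have "curve_length G (\<lambda>t. x (g t)) = ennreal (integral {a..b} (speed G x))" .
  moreover have "path_image (\<lambda>t. x (g t)) \<subseteq> M" using gin M by (auto simp: path_image_def)
  ultimately show ?thesis unfolding riemannian_dist_def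
    by (intro Inf_lower) (use pw in \<open>force simp: pathstart_def pathfinish_def g_def\<close>)
qed

lemma flat_reparametrization:
  assumes S: "open S" "smooth_on S x" "{a..b} \<subseteq> S" and ab: "a \<le> b" and M: "x ` {a..b} \<subseteq> M"
  obtains y where "flat_curve M (x a) (x b) y" "integral {0..1} (speed G y) = integral {a..b} (speed G x)"
proof -
  obtain \<beta> \<beta>' :: "real \<Rightarrow> real" where B: "smooth_on UNIV \<beta>" "smooth_on UNIV \<beta>'"
    "\<And>s. (\<beta> has_vector_derivative \<beta>' s) (at s)" "\<And>s. \<beta>' s \<ge> 0"
    "\<And>s. s \<le> 1/3 \<Longrightarrow> \<beta> s = 0" "\<And>s. s \<ge> 2/3 \<Longrightarrow> \<beta> s = 1" "\<And>s. 0 \<le> \<beta> s" "\<And>s. \<beta> s \<le> 1"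
    by (rule smooth_step_exists) (rule that)
  define g where "g = (\<lambda>t. a + (b - a) * \<beta> t)"
  have gd: "(g has_vector_derivative (b - a) * \<beta>' t) (at t)" for t
    unfolding g_def by (auto intro!: derivative_eq_intros B(3))
  have gin: "g t \<in> {a..b}" for t
    using ab B(7,8)[of t] mult_left_mono[of "\<beta> t" 1 "b - a"] by (auto simp: g_def)
  have sg: "smooth_on UNIV g" unfolding g_def
    by (intro smooth_on_add smooth_on_mult smooth_on_const B(1) open_UNIV)
  show ?thesis
  proof (rule that[of "\<lambda>t. x (g t)"])
    have "smooth_on UNIV (\<lambda>t. x (g t))"
      by (rule smooth_on_compose[OF open_UNIV S(1) sg S(2)]) (use gin S(3) in auto)
    then show "flat_curve M (x a) (x b) (\<lambda>t. x (g t))"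
      unfolding flat_curve_def using gin M B(5,6) by (auto simp: g_def)
    have gU: "x (g t) \<in> U" "g t \<in> S" for t using gin M MU S(3) by blast+
    have sp: "speed G (\<lambda>t. x (g t)) t = ((b - a) * \<beta>' t) * speed G x (g t)" for t
      using ab B(4) by (intro speed_reparam gd smooth_on_has_vector_derivative[OF S(2)] gU) auto
    have "((\<lambda>t. ((b - a) * \<beta>' t) *\<^sub>R speed G x (g t)) has_integral integral {g 0..g 1} (speed G x)) {0..1}"
    proof (rule has_integral_substitution)
      show "g ` {0..1} \<subseteq> {a..b}" using gin by auto
      show "continuous_on {a..b} (speed G x)" using continuous_on_speed[OF S] M MU by auto
      show "(g has_real_derivative (b - a) * \<beta>' t) (at t within {0..1})" for t
        using gd by (auto simp: has_real_derivative_iff_has_vector_derivative intro: has_vector_derivative_at_within)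
    qed (use ab B in \<open>auto simp: g_def\<close>)
    moreover have "g 0 = a" "g 1 = b" using B(5,6) by (auto simp: g_def)
    ultimately have hi0: "((\<lambda>t. ((b - a) * \<beta>' t) *\<^sub>R speed G x (g t)) has_integral integral {a..b} (speed G x)) {0..1}"
      by (simp only:)
    have "((\<lambda>t. speed G (\<lambda>t. x (g t)) t) has_integral integral {a..b} (speed G x)) {0..1}"
      by (rule has_integral_eq[OF _ hi0]) (simp only: sp real_scaleR_def)
    then show "integral {0..1} (speed G (\<lambda>t. x (g t))) = integral {a..b} (speed G x)"
      by (rule integral_unique)
  qed
qed

lemma glue_length:
  assumes f: "\<And>i. flat_curve M (p i) (p (Suc i)) (x i)"
  shows "integral {0..real n} (speed G (glue x)) = (\<Sum>i<n. integral {0..1} (speed G (x i)))"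
proof (induction n)
  case (Suc n)
  note gs = glue_smooth[of M p x, OF f]
  have cX: "continuous_on T (speed G (glue x))" for T
    using continuous_on_speed[OF open_UNIV gs(1)] gs(2) MU by blast
  have cx: "continuous_on T (speed G (x n))" for T
    by (rule continuous_on_speed[OF open_UNIV flat_curve_smooth[OF f[of n]]]) (use flat_curve_in[OF f[of n]] MU in auto)
  have xd: "(x n has_vector_derivative vector_derivative (x n) (at t)) (at t)" for t
    using smooth_on_has_vector_derivative[of UNIV "x n"] f[of n] unfolding flat_curve_def by auto
  have "integral {real n..real n + 1} (speed G (glue x)) = integral {real n..real n + 1} ((speed G (x n)) \<circ> (\<lambda>s. s + - real n))"
  proof (rule integral_spike[of "{real n + 1}"])
    fix s assume s: "s \<in> {real n..real n + 1} - {real n + 1}"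
    let ?T = "{real n - 1/3<..<real n + 1}"
    have "speed G (glue x) s = speed G (\<lambda>s. x n (s + - real n)) s"
      by (rule speed_cong[of ?T]) (use s glue_eq[of M p x, OF f, of _ n] in auto)
    also have "\<dots> = 1 * speed G (x n) (s + - real n)"
      using f[of n] MU unfolding flat_curve_def
      by (intro speed_reparam xd) (auto intro!: derivative_eq_intros)
    finally show "(speed G (x n) \<circ> (\<lambda>s. s + - real n)) s = speed G (glue x) s" by simp
  qed simp
  also have "\<dots> = integral {0..1} (speed G (x n))"
    using integral_shift[of "real n" "- real n" "real n + 1" "speed G (x n)"] cx by simp
  finally have "integral {real n..real n + 1} (speed G (glue x)) = integral {0..1} (speed G (x n))" .
  then show ?case
    using Henstock_Kurzweil_Integration.integral_combine[of 0 "real n" "real n + 1" "speed G (glue x)"] Suc.IH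
      integrable_continuous_interval[OF cX] by (simp add: add.commute)
qed simp

text \<open>Each smooth piece is made flat without changing its length, and the flat pieces are glued.
  Only an inequality between the lengths is proved, which avoids any measurability
  question about the original path at its break points.\<close>

lemma flat_curve_of_piecewise:
  assumes pw: "piecewise_smooth_path \<gamma>" and M: "path_image \<gamma> \<subseteq> M"
  obtains x where "flat_curve M (\<gamma> 0) (\<gamma> 1) x" "ennreal (integral {0..1} (speed G x)) \<le> curve_length G \<gamma>"
proof -
  from pw obtain m \<tau> where t: "\<tau> 0 = 0" "\<tau> m = 1" "\<And>i. i < m \<Longrightarrow> \<tau> i < \<tau> (Suc i)"
    and pc: "\<forall>i<m. \<exists>S \<sigma>. open S \<and> {\<tau> i..\<tau> (Suc i)} \<subseteq> S \<and> smooth_on S \<sigma> \<and> (\<forall>t\<in>{\<tau> i..\<tau> (Suc i)}. \<gamma> t = \<sigma> t)"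
    unfolding piecewise_smooth_path_def by auto
  obtain S \<sigma> where s: "\<And>i. i < m \<Longrightarrow> open (S i)" "\<And>i. i < m \<Longrightarrow> {\<tau> i..\<tau> (Suc i)} \<subseteq> S i"
    "\<And>i. i < m \<Longrightarrow> smooth_on (S i) (\<sigma> i)" "\<And>i t. i < m \<Longrightarrow> t \<in> {\<tau> i..\<tau> (Suc i)} \<Longrightarrow> \<gamma> t = \<sigma> i t"
    using pc by metis
  have t0: "0 \<le> \<tau> i" if "i \<le> m" for i
    using that
  proof (induction i)
    case (Suc i) then show ?case using t(3)[of i] by simp
  qed (simp add: t(1))
  have t1: "\<tau> i \<le> 1" if "i \<le> m" for i
    using that
  proof (induction i rule: inc_induct)
    case (step i) then show ?case using t(3)[of i] by simp
  qed (simp add: t(2))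
  have gM: "\<gamma> t \<in> M" if "t \<in> {0..1}" for t using M that by (auto simp: path_image_def)
  have sM: "\<sigma> i ` {\<tau> i..\<tau> (Suc i)} \<subseteq> M" if i: "i < m" for i
  proof
    fix y assume "y \<in> \<sigma> i ` {\<tau> i..\<tau> (Suc i)}"
    then obtain u where u: "u \<in> {\<tau> i..\<tau> (Suc i)}" "y = \<sigma> i u" by blast
    then have "y = \<gamma> u" using s(4)[OF i] by simp
    then show "y \<in> M" using u gM[of u] t0[of i] t1[of "Suc i"] i by auto
  qed
  let ?J = "\<lambda>i. integral {\<tau> i..\<tau> (Suc i)} (speed G (\<sigma> i))"
  have "\<exists>y. flat_curve M (\<gamma> (\<tau> i)) (\<gamma> (\<tau> (Suc i))) y \<and> integral {0..1} (speed G y) = ?J i" if "i < m" for i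
    using flat_reparametrization[OF s(1)[OF that] s(3)[OF that] s(2)[OF that] less_imp_le[OF t(3)[OF that]] sM[OF that]]
      s(4)[OF that, of "\<tau> i"] s(4)[OF that, of "\<tau> (Suc i)"] t(3)[OF that] by auto
  then obtain y where y: "\<And>i. i < m \<Longrightarrow> flat_curve M (\<gamma> (\<tau> i)) (\<gamma> (\<tau> (Suc i))) (y i) \<and> integral {0..1} (speed G (y i)) = ?J i"
    by metis
  \<comment> \<open>Beyond the last piece the sequence is continued by constant curves.\<close>
  define p where "p = (\<lambda>i. if i < m then \<gamma> (\<tau> i) else \<gamma> 1)"
  define z where "z = (\<lambda>i. if i < m then y i else (\<lambda>s. \<gamma> 1))"
  have fz: "flat_curve M (p i) (p (Suc i)) (z i)" for i
  proof (cases "i < m")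
    case True
    have "p (Suc i) = \<gamma> (\<tau> (Suc i))"
    proof (cases "Suc i < m")
      case False
      then have "Suc i = m" using True by simp
      then show ?thesis using t(2) by (simp add: p_def)
    qed (simp add: p_def)
    then show ?thesis using y[OF True] True by (simp add: p_def z_def)
  next
    case False
    then show ?thesis using flat_curve_const[OF gM[of 1]] by (simp add: p_def z_def)
  qed
  note gs = glue_smooth[of M p z, OF fz]
  have m0: "m > 0" using t by (cases m) auto
  obtain x where x: "flat_curve M (glue z 0) (glue z (real m)) x"
    "integral {0..1} (speed G x) = integral {0..real m} (speed G (glue z))"
    by (rule flat_reparametrization[OF open_UNIV gs(1), of 0 "real m"]) (use gs(2) in auto)
  have "glue z 0 = \<gamma> 0" "glue z (real m) = \<gamma> 1" using gs(4)[of 0] gs(4)[of m] m0 t(1) by (auto simp: p_def)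
  with x have x1: "flat_curve M (\<gamma> 0) (\<gamma> 1) x" by simp
  have x2: "integral {0..1} (speed G x) = (\<Sum>i<m. ?J i)"
    using x(2) glue_length[of p z, OF fz, of m] y by (auto simp: z_def intro!: sum.cong)
  \<comment> \<open>Open intervals are disjoint, so the sum of the pieces is dominated by the speed of the whole path at every point.\<close>
  let ?I = "\<lambda>i. {\<tau> i<..<\<tau> (Suc i)}"
  let ?f = "\<lambda>i u. ennreal (speed G (\<sigma> i) u) * indicator (?I i) u"
  have cs: "continuous_on {\<tau> i..\<tau> (Suc i)} (speed G (\<sigma> i))" if "i < m" for i
    using continuous_on_speed[OF s(1)[OF that] s(3)[OF that] s(2)[OF that]] sM[OF that] MU by auto
  have nn: "speed G (\<sigma> i) u \<ge> 0" if "i < m" "u \<in> {\<tau> i..\<tau> (Suc i)}" for i u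
    using sM[OF that(1)] that(2) MU by (intro speed_nonneg) blast
  have If: "(\<integral>\<^sup>+u. ?f i u \<partial>lborel) = ennreal (?J i)" if "i < m" for i
  proof (rule nn_integral_has_integral_lebesgue')
    have "(speed G (\<sigma> i) has_integral ?J i) {\<tau> i..\<tau> (Suc i)}"
      using integrable_integral[OF integrable_continuous_interval[OF cs[OF that]]] .
    then show "(speed G (\<sigma> i) has_integral ?J i) (?I i)"
      using has_integral_open_interval[of "speed G (\<sigma> i)" "?J i" "\<tau> i" "\<tau> (Suc i)"] by simp
  qed (use nn[OF that] in auto)
  have mf: "?f i \<in> borel_measurable lborel" if "i < m" for i
  proof -
    have "(\<lambda>u. indicator (?I i) u *\<^sub>R speed G (\<sigma> i) u) \<in> borel_measurable borel"
      by (rule borel_measurable_continuous_on_indicator) (auto intro: continuous_on_subset[OF cs[OF that]])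
    then have "(\<lambda>u. ennreal (indicator (?I i) u *\<^sub>R speed G (\<sigma> i) u)) \<in> borel_measurable lborel" by simp
    moreover have "ennreal (indicator (?I i) u *\<^sub>R speed G (\<sigma> i) u) = ?f i u" for u
      by (auto simp: indicator_def)
    ultimately show ?thesis by simp
  qed
  have le: "(\<Sum>i<j. ?f i u) \<le> ennreal (speed G \<gamma> u) * indicator {0..<\<tau> j} u" if "j \<le> m" for j u
    using that
  proof (induction j)
    case (Suc j)
    show ?case
    proof (cases "u \<in> ?I j")
      case True
      then have "speed G \<gamma> u = speed G (\<sigma> j) u"
        using s(4)[of j] Suc.prems by (intro speed_cong[of "?I j"]) auto
      then show ?thesis using Suc True t0[of j] by (auto simp: indicator_def)
    next
      case False
      have "(\<Sum>i<Suc j. ?f i u) \<le> ennreal (speed G \<gamma> u) * indicator {0..<\<tau> j} u" using Suc False by simp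
      also have "\<dots> \<le> ennreal (speed G \<gamma> u) * indicator {0..<\<tau> (Suc j)} u"
        using t(3)[of j] Suc.prems by (intro mult_left_mono) (auto simp: indicator_def)
      finally show ?thesis .
    qed
  qed simp
  have "ennreal (integral {0..1} (speed G x)) = (\<Sum>i<m. ennreal (?J i))"
    unfolding x2 using nn integrable_continuous_interval[OF cs]
    by (intro sum_ennreal[symmetric] Henstock_Kurzweil_Integration.integral_nonneg) auto
  also have "\<dots> = (\<Sum>i<m. (\<integral>\<^sup>+u. ?f i u \<partial>lborel))" using If by simp
  also have "\<dots> = (\<integral>\<^sup>+u. (\<Sum>i<m. ?f i u) \<partial>lborel)" using mf by (subst nn_integral_sum) auto
  also have "\<dots> \<le> (\<integral>\<^sup>+u. ennreal (speed G \<gamma> u) * indicator {0..1} u \<partial>lborel)"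
  proof (rule nn_integral_mono)
    fix u
    have "(\<Sum>i<m. ?f i u) \<le> ennreal (speed G \<gamma> u) * indicator {0..<\<tau> m} u" by (rule le) simp
    also have "\<dots> \<le> ennreal (speed G \<gamma> u) * indicator {0..1} u"
      using t(2) by (intro mult_left_mono) (auto simp: indicator_def)
    finally show "(\<Sum>i<m. ?f i u) \<le> ennreal (speed G \<gamma> u) * indicator {0..1} u" .
  qed
  also have "\<dots> = curve_length G \<gamma>" unfolding curve_length_def speed_def by simp
  finally show ?thesis using that x1 by blast
qed

text \<open>Flat smooth curves suffice to compute the distance.  All later arguments use the distance
  through this characterization.\<close>

lemma dist_less_iff:
  "riemannian_dist M G p q < ennreal l \<longleftrightarrow> (\<exists>x. flat_curve M p q x \<and> integral {0..1} (speed G x) < l)"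
proof
  assume "riemannian_dist M G p q < ennreal l"
  then obtain \<gamma> where g: "piecewise_smooth_path \<gamma>" "path_image \<gamma> \<subseteq> M" "\<gamma> 0 = p" "\<gamma> 1 = q"
    "curve_length G \<gamma> < ennreal l"
    unfolding riemannian_dist_def Inf_less_iff pathstart_def pathfinish_def by auto
  obtain x where x: "flat_curve M p q x" "ennreal (integral {0..1} (speed G x)) \<le> curve_length G \<gamma>"
    using flat_curve_of_piecewise[OF g(1,2)] g(3,4) by auto
  then have "ennreal (integral {0..1} (speed G x)) < ennreal l" using g(5) by auto
  then have "integral {0..1} (speed G x) < l" using ennreal_leI[of l "integral {0..1} (speed G x)"] by (meson not_le)
  with x show "\<exists>x. flat_curve M p q x \<and> integral {0..1} (speed G x) < l" by auto
next
  assume "\<exists>x. flat_curve M p q x \<and> integral {0..1} (speed G x) < l"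
  then obtain x where x: "flat_curve M p q x" "integral {0..1} (speed G x) < l" by auto
  have "continuous_on {0..1} (speed G x)"
    using continuous_on_speed[OF open_UNIV, of x "{0..1}"] x(1) MU unfolding flat_curve_def by auto
  then have "integral {0..1} (speed G x) \<ge> 0"
    using x(1) MU unfolding flat_curve_def
    by (intro Henstock_Kurzweil_Integration.integral_nonneg integrable_continuous_interval speed_nonneg) auto
  then have "ennreal (integral {0..1} (speed G x)) < ennreal l" using x(2) by (simp add: ennreal_lessI)
  moreover have "riemannian_dist M G (x 0) (x 1) \<le> ennreal (integral {0..1} (speed G x))"
    by (rule dist_le_length[OF open_UNIV]) (use x(1) in \<open>auto simp: flat_curve_def\<close>)
  ultimately show "riemannian_dist M G p q < ennreal l" using flat_curve_ends[OF x(1)] by simp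
qed

lemma dist_triangle_less:
  assumes "riemannian_dist M G p q < ennreal a" "riemannian_dist M G q r < ennreal b"
  shows "riemannian_dist M G p r < ennreal (a + b)"
proof -
  obtain x y where x: "flat_curve M p q x" "integral {0..1} (speed G x) < a"
    and y: "flat_curve M q r y" "integral {0..1} (speed G y) < b"
    using assms unfolding dist_less_iff by auto
  \<comment> \<open>Two curves followed by constant ones; the concatenation is run through on \<open>[0, 2]\<close>.\<close>
  define P where "P = (\<lambda>i::nat. if i = 0 then p else if i = 1 then q else r)"
  define z where "z = (\<lambda>i::nat. if i = 0 then x else if i = 1 then y else (\<lambda>s. r))"
  have f: "flat_curve M (P i) (P (Suc i)) (z i)" for i
    using x(1) y(1) flat_curve_const[OF flat_curve_ends(4)[OF y(1)]] by (auto simp: P_def z_def)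
  note gs = glue_smooth[of M P z, OF f]
  obtain w where w: "flat_curve M (glue z 0) (glue z 2) w"
    "integral {0..1} (speed G w) = integral {0..2} (speed G (glue z))"
    by (rule flat_reparametrization[OF open_UNIV gs(1), of 0 2]) (use gs(2) in auto)
  have "glue z 0 = p" "glue z 2 = r" using gs(4)[of 0] gs(4)[of 2] by (auto simp: P_def)
  moreover have "integral {0..2} (speed G (glue z)) < a + b"
    using glue_length[of P z, OF f, of 2] x(2) y(2) by (simp add: z_def numeral_2_eq_2)
  ultimately show ?thesis unfolding dist_less_iff using w by auto
qed

lemma dist_commute_less:
  assumes "riemannian_dist M G p q < ennreal a" shows "riemannian_dist M G q p < ennreal a"
proof -
  obtain x where x: "flat_curve M p q x" "integral {0..1} (speed G x) < a"
    using assms unfolding dist_less_iff by auto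
  have xd: "(x has_vector_derivative vector_derivative x (at t)) (at t)" for t
    using smooth_on_has_vector_derivative[of UNIV x] x(1) unfolding flat_curve_def by auto
  have "smooth_on UNIV (\<lambda>s. x (1 + (-1) * s))"
    using smooth_on_compose[OF open_UNIV open_UNIV smooth_affine[of 1 "-1"], of x] x(1) unfolding flat_curve_def by auto
  then have f: "flat_curve M q p (\<lambda>s. x (1 - s))" using x(1) unfolding flat_curve_def by auto
  have rs: "speed G (\<lambda>s. x (1 - s)) s = speed G x (1 - s)" for s
  proof -
    have "((\<lambda>s. 1 - s) has_vector_derivative (-1)) (at s)" for s :: real by (auto intro!: derivative_eq_intros)
    from vector_derivative_at[OF curve_chain_rule[OF xd[unfolded has_vector_derivative_def] this]]
    have "vector_derivative (\<lambda>s. x (1 - s)) (at s) = (-1) *\<^sub>R vector_derivative x (at (1 - s))" .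
    moreover have "x (1 - s) \<in> U" using x(1) MU unfolding flat_curve_def by auto
    ultimately show ?thesis unfolding speed_def
      using scaleG[of "x (1 - s)" "-1"] by (metis (no_types, lifting) mult_1 power2_minus power_one)
  qed
  have "speed G (\<lambda>s. x (1 - s)) = (\<lambda>s. speed G x (1 - s))" by (rule ext) (rule rs)
  then have "integral {0..1} (speed G (\<lambda>s. x (1 - s))) = integral {0..1} (\<lambda>s. speed G x (1 - s))" by simp
  also have "\<dots> = integral {0..1} (speed G x)"
    using Henstock_Kurzweil_Integration.integral_reflect_real[of 0 "-1" "\<lambda>s. speed G x (s + 1)"]
      integral_shift[of "-1" 1 0 "speed G x"] continuous_on_speed[OF open_UNIV, of x "{0..1}"] x(1) MU
    unfolding flat_curve_def by (auto simp: o_def)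
  finally show ?thesis unfolding dist_less_iff using f x(2) by auto
qed

lemma dist_commute: "riemannian_dist M G p q = riemannian_dist M G q p"
proof -
  have "\<not> riemannian_dist M G p q < riemannian_dist M G q p" for p q
  proof
    assume "riemannian_dist M G p q < riemannian_dist M G q p"
    then obtain z where z: "riemannian_dist M G p q < z" "z < riemannian_dist M G q p" using dense by blast
    then have "z \<noteq> top" by auto
    then obtain l where "z = ennreal l" by (cases z) auto
    then have "riemannian_dist M G q p < z" using dist_commute_less z by blast
    then show False using z by auto
  qed
  then show ?thesis by (meson antisym_conv3)
qed

text \<open>The form in which finite length enters later: if the speed is dominated by the derivative of
  \<open>m\<close>, then \<open>m\<close> controls distances along the curve.\<close>

lemma dist_le_majorant:
  assumes S: "open S" "smooth_on S x" "{a..b} \<subseteq> S" and ab: "a \<le> b" and M: "x ` {a..b} \<subseteq> M"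
    and m: "\<And>s. s \<in> {a..b} \<Longrightarrow> (m has_vector_derivative m' s) (at s)"
    and le: "\<And>s. s \<in> {a..b} \<Longrightarrow> speed G x s \<le> m' s"
  shows "riemannian_dist M G (x a) (x b) \<le> ennreal (m b - m a)"
proof -
  have "(m' has_integral (m b - m a)) {a..b}"
    by (rule fundamental_theorem_of_calculus[OF ab]) (use m in \<open>auto intro: has_vector_derivative_at_within\<close>)
  moreover have "speed G x integrable_on {a..b}"
    using continuous_on_speed[OF S] M MU by (intro integrable_continuous_interval) auto
  ultimately have "integral {a..b} (speed G x) \<le> m b - m a"
    using has_integral_le[OF integrable_integral] le by blast
  then show ?thesis using dist_le_length[OF S ab M] ennreal_leI order_trans by blast
qed

text \<open>Near \<open>p\<close> the length structure dominates \<open>c\<close> times the Euclidean one.  The condition is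
  restricted to velocities of curves in \<open>M\<close>, since the quadratic form may be degenerate
  transversally to \<open>M\<close>.\<close>

definition bounded_below_near :: "'a \<Rightarrow> real \<Rightarrow> real \<Rightarrow> bool" where
  "bounded_below_near p r c \<longleftrightarrow> r > 0 \<and> c > 0 \<and>
     (\<forall>x s. smooth_on UNIV x \<longrightarrow> range x \<subseteq> M \<longrightarrow> dist (x s) p \<le> r \<longrightarrow>
        c * norm (vector_derivative x (at s)) \<le> speed G x s)"

text \<open>A curve that starts at \<open>p\<close> and leaves the Euclidean \<open>\<rho>\<close>-ball must first cross it, and up to
  the first time at distance \<open>\<rho>\<close> its length is already at least \<open>c \<rho>\<close>.\<close>

lemma short_flat_curve_stays:
  assumes bb: "bounded_below_near p r c" and x: "flat_curve M p q x"
    and len: "integral {0..1} (speed G x) < c * \<rho>" and \<rho>: "0 < \<rho>" "\<rho> \<le> r"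
  shows "dist q p < \<rho>"
proof (rule ccontr)
  assume "\<not> dist q p < \<rho>"
  then have far: "dist (x 1) p \<ge> \<rho>" using flat_curve_ends[OF x] by simp
  have c: "c > 0" using bb unfolding bounded_below_near_def by auto
  have sx: "smooth_on UNIV x" and rx: "range x \<subseteq> M" using x unfolding flat_curve_def by auto
  have cx: "continuous_on T (\<lambda>s. dist (x s) p)" for T
    using continuous_on_subset[OF smooth_on_continuous[OF sx]] by (intro continuous_intros) auto
  \<comment> \<open>The infimum of \<open>A\<close> is the first time at distance \<open>\<rho>\<close> from \<open>p\<close>.\<close>
  define A where "A = {s \<in> {0..1}. dist (x s) p = \<rho>}"
  have ivt: "\<exists>s. 0 \<le> s \<and> s \<le> b \<and> dist (x s) p = \<rho>" if "0 \<le> b" "dist (x b) p \<ge> \<rho>" for b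
    using IVT'[of "\<lambda>s. dist (x s) p" 0 \<rho> b] that cx \<rho> flat_curve_ends(1)[OF x] by auto
  have ne: "A \<noteq> {}" using ivt[of 1] far unfolding A_def by auto
  have "closed A"
  proof -
    have "closed ({0..1} \<inter> (\<lambda>s. dist (x s) p) -` {\<rho>})"
      by (rule continuous_closed_preimage[OF cx]) auto
    moreover have "{0..1} \<inter> (\<lambda>s. dist (x s) p) -` {\<rho>} = A" unfolding A_def by auto
    ultimately show ?thesis by simp
  qed
  moreover have bA: "bdd_below A" unfolding A_def by (intro bdd_belowI[of _ 0]) auto
  ultimately have IA: "Inf A \<in> A" using closed_contains_Inf ne by blast
  define s0 where "s0 = Inf A"
  have s0: "0 \<le> s0" "s0 \<le> 1" "dist (x s0) p = \<rho>" using IA unfolding A_def s0_def by auto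
  have near: "dist (x s) p \<le> \<rho>" if s: "s \<in> {0..s0}" for s
  proof (rule ccontr)
    assume n: "\<not> dist (x s) p \<le> \<rho>"
    then obtain s' where s': "0 \<le> s'" "s' \<le> s" "dist (x s') p = \<rho>" using ivt[of s] s by auto
    then have "s' \<in> A" using s s0 unfolding A_def by auto
    then have "s0 \<le> s'" using cInf_lower[OF _ bA] s0_def by auto
    then have "s = s'" using s' s by auto
    then show False using s' n by auto
  qed
  let ?v = "\<lambda>s. vector_derivative x (at s)"
  have cv: "continuous_on T ?v" for T
    using smooth_on_continuous[OF smooth_on_vector_derivative[OF open_UNIV sx]] continuous_on_subset by blast
  have cs: "continuous_on T (speed G x)" for T
    by (rule continuous_on_speed[OF open_UNIV sx]) (use rx MU in auto)
  have "(?v has_integral (x s0 - x 0)) {0..s0}"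
    by (rule fundamental_theorem_of_calculus[OF s0(1)])
       (use smooth_on_has_vector_derivative[OF sx] in \<open>auto intro: has_vector_derivative_at_within\<close>)
  then have "norm (x s0 - x 0) = norm (integral {0..s0} ?v)" by (simp add: integral_unique)
  also have "\<dots> \<le> integral {0..s0} (\<lambda>s. inverse c * speed G x s)"
  proof (rule integral_norm_bound_integral)
    show "?v integrable_on {0..s0}" by (rule integrable_continuous_interval[OF cv])
    show "(\<lambda>s. inverse c * speed G x s) integrable_on {0..s0}"
      by (intro integrable_continuous_interval continuous_intros cs)
    show "norm (?v s) \<le> inverse c * speed G x s" if "s \<in> {0..s0}" for s
    proof -
      have "c * norm (?v s) \<le> speed G x s"
        using bb near[OF that] \<rho> sx rx unfolding bounded_below_near_def by force
      then show ?thesis using c by (simp add: field_simps)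
    qed
  qed
  also have "\<dots> = inverse c * integral {0..s0} (speed G x)" by simp
  also have "\<dots> \<le> inverse c * integral {0..1} (speed G x)"
  proof (rule mult_left_mono)
    show "integral {0..s0} (speed G x) \<le> integral {0..1} (speed G x)"
      by (rule integral_subset_le)
         (use s0 rx MU in \<open>auto intro!: integrable_continuous_interval cs speed_nonneg\<close>)
  qed (use c in simp)
  also have "\<dots> < inverse c * (c * \<rho>)" using len c by simp
  also have "\<dots> = \<rho>" using c by simp
  finally show False using s0(3) flat_curve_ends(1)[OF x] by (simp add: dist_norm)
qed

lemma dist_less_imp_near:
  assumes "bounded_below_near p r c" "riemannian_dist M G q p < ennreal (c * \<rho>)" "0 < \<rho>" "\<rho> \<le> r"
  shows "dist q p < \<rho>"
  using dist_commute_less[OF assms(2)] short_flat_curve_stays[OF assms(1) _ _ assms(3,4)]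
  unfolding dist_less_iff by blast

text \<open>A curve \<open>x\<close> that is Lipschitz with respect to a convergent function \<open>m\<close> is Cauchy, hence
  converges.  The filter \<open>F\<close> allows end points at infinity and one-sided limits to be treated
  together.\<close>

lemma complete_imp_limit:
  fixes x :: "'b \<Rightarrow> 'a" and m :: "'b \<Rightarrow> real"
  assumes complete: "riemannian_complete M G"
    and bb: "\<And>p. p \<in> M \<Longrightarrow> \<exists>r c. bounded_below_near p r c"
    and F: "F \<noteq> bot" "eventually (\<lambda>t. t \<in> I) F"
    and xM: "\<And>t. t \<in> I \<Longrightarrow> x t \<in> M"
    and lip: "\<And>s t. s \<in> I \<Longrightarrow> t \<in> I \<Longrightarrow> riemannian_dist M G (x s) (x t) \<le> ennreal (C * \<bar>m s - m t\<bar>)"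
    and C: "C > 0"
    and lim: "(m \<longlongrightarrow> m0) F"
  shows "\<exists>p\<in>M. (x \<longlongrightarrow> p) F"
proof -
  have "\<exists>t. t \<in> I \<and> \<bar>m t - m0\<bar> < inverse (real (Suc i))" for i
  proof -
    have "eventually (\<lambda>t. dist (m t) m0 < inverse (real (Suc i))) F" by (rule tendstoD[OF lim]) simp
    then have "eventually (\<lambda>t. t \<in> I \<and> \<bar>m t - m0\<bar> < inverse (real (Suc i))) F"
      using F(2) by eventually_elim (simp add: dist_real_def)
    then show ?thesis using eventually_happens'[OF F(1)] by blast
  qed
  then obtain t where t: "\<And>i. t i \<in> I" "\<And>i. \<bar>m (t i) - m0\<bar> < inverse (real (Suc i))" by metis
  have small: "\<exists>N. \<forall>i\<ge>N. \<bar>m (t i) - m0\<bar> < e" if e: "e > 0" for e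
  proof -
    obtain N where N: "inverse (real (Suc N)) < e" using reals_Archimedean[OF e] by blast
    have "\<bar>m (t i) - m0\<bar> < e" if "i \<ge> N" for i
    proof -
      have "inverse (real (Suc i)) \<le> inverse (real (Suc N))" using that by (simp add: field_simps)
      then show ?thesis using t(2)[of i] N by linarith
    qed
    then show ?thesis by blast
  qed
  have lt: "riemannian_dist M G (x s) (x u) < ennreal (C * e)" if "s \<in> I" "u \<in> I" "\<bar>m s - m u\<bar> < e" for s u e
  proof -
    have "C * \<bar>m s - m u\<bar> < C * e" "C * e > 0" using that C by auto
    then have "ennreal (C * \<bar>m s - m u\<bar>) < ennreal (C * e)" by (intro ennreal_lessI) auto
    then show ?thesis using lip[OF that(1,2)] by (rule le_less_trans[rotated])
  qed
  have "\<exists>N. \<forall>i\<ge>N. \<forall>j\<ge>N. riemannian_dist M G (x (t i)) (x (t j)) < ennreal e" if "e > 0" for e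
  proof -
    have "e / (2 * C) > 0" using that C by simp
    then obtain N where N: "\<And>i. i \<ge> N \<Longrightarrow> \<bar>m (t i) - m0\<bar> < e / (2 * C)" using small by blast
    have "riemannian_dist M G (x (t i)) (x (t j)) < ennreal (C * (e / C))" if "i \<ge> N" "j \<ge> N" for i j
    proof (rule lt[OF t(1) t(1)])
      have "e / C = e / (2 * C) + e / (2 * C)" using C by (simp add: field_simps)
      then show "\<bar>m (t i) - m (t j)\<bar> < e / C" using N[OF that(1)] N[OF that(2)] by linarith
    qed
    then show ?thesis using C by auto
  qed
  then obtain p where p: "p \<in> M" "(\<lambda>i. riemannian_dist M G (x (t i)) p) \<longlonglongrightarrow> 0"
    using complete[unfolded riemannian_complete_def, rule_format, of "\<lambda>i. x (t i)"] xM t(1) by blast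
  obtain r c where b: "bounded_below_near p r c" using bb[OF p(1)] by blast
  then have rc: "r > 0" "c > 0" unfolding bounded_below_near_def by auto
  have "(x \<longlongrightarrow> p) F"
  proof (rule tendstoI)
    fix \<rho>0 :: real assume "\<rho>0 > 0"
    define \<rho> where "\<rho> = min \<rho>0 r"
    have \<rho>: "0 < \<rho>" "\<rho> \<le> r" "\<rho> \<le> \<rho>0" using \<open>\<rho>0 > 0\<close> rc by (auto simp: \<rho>_def)
    \<comment> \<open>If \<open>m\<close> varies by less than \<open>2 \<delta>\<close>, then \<open>x\<close> moves by less than \<open>c \<rho> / 2\<close>.\<close>
    define \<delta> where "\<delta> = c * \<rho> / (4 * C)"
    have \<delta>: "\<delta> > 0" using \<rho> rc C by (simp add: \<delta>_def)
    have eq: "C * (2 * \<delta>) = c * \<rho> / 2" using C by (simp add: \<delta>_def field_simps)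
    have "eventually (\<lambda>i. riemannian_dist M G (x (t i)) p < ennreal (c * \<rho> / 2)) sequentially"
      using order_tendstoD(2)[OF p(2), of "ennreal (c * \<rho> / 2)"] rc \<rho> by (simp add: ennreal_less_zero_iff)
    then obtain N1 where N1: "\<And>i. i \<ge> N1 \<Longrightarrow> riemannian_dist M G (x (t i)) p < ennreal (c * \<rho> / 2)"
      unfolding eventually_sequentially by blast
    obtain N2 where N2: "\<And>i. i \<ge> N2 \<Longrightarrow> \<bar>m (t i) - m0\<bar> < \<delta>" using small[OF \<delta>] by blast
    define i where "i = max N1 N2"
    have i: "riemannian_dist M G (x (t i)) p < ennreal (c * \<rho> / 2)" "\<bar>m (t i) - m0\<bar> < \<delta>"
      using N1[of i] N2[of i] by (auto simp: i_def)
    show "eventually (\<lambda>u. dist (x u) p < \<rho>0) F"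
      using F(2) tendstoD[OF lim \<delta>]
    proof eventually_elim
      case (elim u)
      have "\<bar>m u - m (t i)\<bar> < 2 * \<delta>" using elim(2) i(2) unfolding dist_real_def by linarith
      from lt[OF elim(1) t(1) this] have "riemannian_dist M G (x u) (x (t i)) < ennreal (c * \<rho> / 2)"
        unfolding eq .
      have "c * \<rho> / 2 + c * \<rho> / 2 = c * \<rho>" by simp
      with dist_triangle_less[OF \<open>riemannian_dist M G (x u) (x (t i)) < ennreal (c * \<rho> / 2)\<close> i(1)]
      have "riemannian_dist M G (x u) p < ennreal (c * \<rho>)" by (simp only:)
      from dist_less_imp_near[OF b this \<rho>(1,2)] show ?case using \<rho>(3) by linarith
    qed
  qed
  then show ?thesis using p(1) by blast
qed

text \<open>A Cauchy sequence without limit is thinned out until consecutive distances are below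
  \<open>2\<^sup>-\<^sup>k\<close>; gluing almost minimizing flat curves gives a smooth curve of finite length.  If it
  had a Euclidean limit in \<open>M\<close>, then by \<open>small\<close> the sequence would converge in the length
  distance.\<close>

lemma incomplete_imp_divergent_curve:
  assumes inc: "\<not> riemannian_complete M G"
    and small: "\<And>p e. p \<in> M \<Longrightarrow> e > 0 \<Longrightarrow> \<exists>d>0. \<forall>q\<in>M. dist q p < d \<longrightarrow> riemannian_dist M G p q < ennreal e"
  obtains X where "smooth_on UNIV X" "range X \<subseteq> M" "\<And>s t. s \<le> 0 \<Longrightarrow> X s = X 0"
    "\<And>n. integral {0..real n} (speed G X) \<le> 2" "\<not> (\<exists>q\<in>M. (X \<longlongrightarrow> q) at_top)"
proof -
  obtain \<sigma> where \<sigma>: "\<And>i. \<sigma> i \<in> M"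
    "\<And>e. e > 0 \<Longrightarrow> \<exists>N. \<forall>i\<ge>N. \<forall>j\<ge>N. riemannian_dist M G (\<sigma> i) (\<sigma> j) < ennreal e"
    "\<not> (\<exists>p\<in>M. (\<lambda>i. riemannian_dist M G (\<sigma> i) p) \<longlonglongrightarrow> 0)"
    using inc unfolding riemannian_complete_def by blast
  have "\<exists>N. \<forall>i\<ge>N. \<forall>j\<ge>N. riemannian_dist M G (\<sigma> i) (\<sigma> j) < ennreal ((1/2) ^ k)" for k :: nat
    by (rule \<sigma>(2)) simp
  then obtain N where N: "\<And>k i j. i \<ge> N k \<Longrightarrow> j \<ge> N k \<Longrightarrow> riemannian_dist M G (\<sigma> i) (\<sigma> j) < ennreal ((1/2) ^ k)"
    by metis
  \<comment> \<open>Summing makes \<open>r\<close> monotone, so that both \<open>r k\<close> and \<open>r (Suc k)\<close> are beyond \<open>N k\<close>.\<close>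
  define r where "r = (\<lambda>k::nat. \<Sum>i\<le>k. N i)"
  have r1: "r k \<ge> N k" for k unfolding r_def by (simp add: member_le_sum)
  have r: "r k \<ge> N k" "r (Suc k) \<ge> N k" for k using r1[of k] by (auto simp: r_def)
  have "\<exists>x. flat_curve M (\<sigma> (r k)) (\<sigma> (r (Suc k))) x \<and> integral {0..1} (speed G x) < (1/2) ^ k" for k
    using N[OF r(1) r(2)] unfolding dist_less_iff .
  then obtain x where x: "\<And>k. flat_curve M (\<sigma> (r k)) (\<sigma> (r (Suc k))) (x k)" "\<And>k. integral {0..1} (speed G (x k)) < (1/2) ^ k"
    by metis
  note gs = glue_smooth[of M "\<lambda>k. \<sigma> (r k)" x, OF x(1)]
  show ?thesis
  proof (rule that[of "glue x"])
    show "smooth_on UNIV (glue x)" "range (glue x) \<subseteq> M" by (rule gs)+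
    show "glue x s = glue x 0" if "s \<le> 0" for s using gs(3)[of s] gs(3)[of 0] that by simp
    show "integral {0..real n} (speed G (glue x)) \<le> 2" for n
    proof -
      have "integral {0..real n} (speed G (glue x)) = (\<Sum>i<n. integral {0..1} (speed G (x i)))"
        by (rule glue_length[of "\<lambda>k. \<sigma> (r k)" x, OF x(1)])
      also have "\<dots> \<le> (\<Sum>i<n. (1/2) ^ i)" using x(2) by (intro sum_mono) (simp add: less_imp_le)
      also have "\<dots> = 2 - 2 * (1/2) ^ n" by (induction n) auto
      also have "\<dots> \<le> 2" by simp
      finally show ?thesis .
    qed
    show "\<not> (\<exists>q\<in>M. (glue x \<longlongrightarrow> q) at_top)"
    proof
      assume "\<exists>q\<in>M. (glue x \<longlongrightarrow> q) at_top"
      then obtain q where q: "q \<in> M" "(glue x \<longlongrightarrow> q) at_top" by blast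
      have "(\<lambda>i. glue x (real i)) \<longlonglongrightarrow> q"
        using filterlim_compose[OF q(2) filterlim_real_sequentially] .
      then have lim: "(\<lambda>i. \<sigma> (r i)) \<longlonglongrightarrow> q" unfolding gs(4) .
      have "(\<lambda>i. riemannian_dist M G (\<sigma> i) q) \<longlonglongrightarrow> 0"
      proof (rule order_tendstoI)
        fix y :: ennreal assume "0 < y"
        then obtain z where z: "0 < z" "z < y" using dense by blast
        then obtain e where e: "z = ennreal e" "e > 0" by (cases z) (auto simp: ennreal_less_zero_iff)
        obtain d where d: "d > 0" "\<And>p. p \<in> M \<Longrightarrow> dist p q < d \<Longrightarrow> riemannian_dist M G q p < ennreal (e / 2)"
          using small[OF q(1), of "e / 2"] e(2) by auto
        have "eventually (\<lambda>i. dist (\<sigma> (r i)) q < d) sequentially" by (rule tendstoD[OF lim d(1)])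
        moreover have L: "(\<lambda>k. (1/2::real) ^ k) \<longlonglongrightarrow> 0" by (rule LIMSEQ_power_zero) simp
        have "eventually (\<lambda>k. (1/2::real) ^ k < e / 2) sequentially"
          by (rule order_tendstoD(2)[OF L]) (use e(2) in simp)
        ultimately have "eventually (\<lambda>k. dist (\<sigma> (r k)) q < d \<and> (1/2::real) ^ k < e / 2) sequentially"
          by (rule eventually_conj)
        then obtain k where k: "dist (\<sigma> (r k)) q < d" "(1/2::real) ^ k < e / 2"
          unfolding eventually_sequentially by blast
        have 1: "riemannian_dist M G (\<sigma> (r k)) q < ennreal (e / 2)"
          using d(2)[OF \<sigma>(1) k(1)] dist_commute by metis
        have "riemannian_dist M G (\<sigma> i) q < y" if "i \<ge> N k" for i
        proof -
          have "riemannian_dist M G (\<sigma> i) (\<sigma> (r k)) < ennreal ((1/2) ^ k)" by (rule N[OF that r(1)])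
          also have "\<dots> < ennreal (e / 2)" using k(2) e(2) by (intro ennreal_lessI) auto
          finally have "riemannian_dist M G (\<sigma> i) q < ennreal (e / 2 + e / 2)" using dist_triangle_less 1 by blast
          then show ?thesis using z(2) e(1) by simp
        qed
        then show "\<forall>\<^sub>F i in sequentially. riemannian_dist M G (\<sigma> i) q < y"
          unfolding eventually_sequentially by blast
      qed simp
      then show False using \<sigma>(3) q(1) by blast
    qed
  qed
qed

end

section \<open>Homogeneous functions of degree one\<close>

text \<open>\<open>lam\<close> is the function with \<open>lam (l *\<^sub>R x) = l\<close> for \<open>x\<close> in \<open>H\<close>; the context isolates what
  follows from homogeneity alone.\<close>

locale radial =
  fixes H U :: "'a::euclidean_space set" and lam :: "'a \<Rightarrow> real"
  assumes openU: "open U" and smooth_lam: "smooth_on U lam"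
    and lam_pos: "\<And>q. q \<in> U \<Longrightarrow> lam q > 0"
    and cone: "\<And>l q. l > 0 \<Longrightarrow> q \<in> U \<Longrightarrow> l *\<^sub>R q \<in> U"
    and hom: "\<And>l q. l > 0 \<Longrightarrow> q \<in> U \<Longrightarrow> lam (l *\<^sub>R q) = l * lam q"
    and H_eq: "H = {q \<in> U. lam q = 1}"
begin

abbreviation dlam :: "'a \<Rightarrow> 'a \<Rightarrow> real" where "dlam q \<equiv> frechet_derivative lam (at q)"

text \<open>The centroaffine metric on the tangent spaces of \<open>H\<close> (lemma \<open>centroaffine_metric_Q\<close>), extended
  to a form on the whole ambient space whose radical contains the position vector.\<close>

definition Q :: "'a \<Rightarrow> 'a \<Rightarrow> 'a \<Rightarrow> real" where "Q q u v = - hessian lam q u v"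

text \<open>The radial projection to \<open>H\<close>.\<close>

definition pr :: "'a \<Rightarrow> 'a" where "pr q = inverse (lam q) *\<^sub>R q"

lemma H_subset: "H \<subseteq> U" using H_eq by auto

lemma lam_H: "p \<in> H \<Longrightarrow> lam p = 1" using H_eq by auto

lemma dlam: "q \<in> U \<Longrightarrow> (lam has_derivative dlam q) (at q)"
  using smooth_onD[OF smooth_lam] .

lemma dlam_linear: "q \<in> U \<Longrightarrow> linear (dlam q)"
  using has_derivative_linear[OF dlam] .

lemma pr_in: "q \<in> U \<Longrightarrow> pr q \<in> H"
  unfolding H_eq pr_def using cone[of "inverse (lam q)" q] hom[of "inverse (lam q)" q] lam_pos[of q] by auto

lemma pr_H: "p \<in> H \<Longrightarrow> pr p = p" unfolding pr_def H_eq by simp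

lemma lam_pr: "q \<in> U \<Longrightarrow> lam q *\<^sub>R pr q = q"
  using lam_pos[of q] by (simp add: pr_def)

lemma pr_cone: "l > 0 \<Longrightarrow> q \<in> U \<Longrightarrow> pr (l *\<^sub>R q) = pr q"
  by (simp add: pr_def hom)

lemma smooth_pr: "smooth_on U pr"
  unfolding pr_def
  by (intro smooth_on_scaleR smooth_on_inverse openU smooth_lam smooth_on_id lam_pos)

lemma dlam_cone:
  assumes "l > 0" "q \<in> U" shows "dlam (l *\<^sub>R q) v = dlam q v"
proof -
  have "((\<lambda>q. lam (l *\<^sub>R q)) has_derivative (\<lambda>v. dlam (l *\<^sub>R q) (l *\<^sub>R v))) (at q)"
    by (rule has_derivative_compose[OF has_derivative_scaleR_right[OF has_derivative_ident] dlam[OF cone[OF assms]]])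
  moreover have "((\<lambda>q. lam (l *\<^sub>R q)) has_derivative (\<lambda>v. l * dlam q v)) (at q)"
    by (rule has_derivative_transform_within_open[of "\<lambda>q. l * lam q" _ _ _ U])
       (use assms openU hom dlam in \<open>auto intro!: derivative_eq_intros\<close>)
  ultimately have "dlam (l *\<^sub>R q) (l *\<^sub>R v) = l * dlam q v"
    using has_derivative_unique by metis
  then show ?thesis using assms linear_scale[OF dlam_linear[OF cone[OF assms]], of l v] by simp
qed

text \<open>Euler's identity for degree one.\<close>

lemma dlam_self: assumes "q \<in> U" shows "dlam q q = lam q"
proof -
  have "((\<lambda>s. lam (q + s *\<^sub>R q)) has_vector_derivative dlam q q) (at 0)"
    using curve_chain_rule[OF _ line_has_vector_derivative[of q q 0], of lam "dlam q"] dlam[OF assms] by simp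
  moreover have "((\<lambda>s. lam (q + s *\<^sub>R q)) has_vector_derivative lam q) (at 0)"
  proof (rule has_vector_derivative_transform_within_open[of "\<lambda>s. (1 + s) * lam q" _ _ "{-1<..}"])
    show "(1 + s) * lam q = lam (q + s *\<^sub>R q)" if "s \<in> {-1<..}" for s
      using hom[of "1 + s" q] assms that by (simp add: scaleR_add_left)
  qed (auto intro!: derivative_eq_intros)
  ultimately show ?thesis using vector_derivative_at by metis
qed

lemma Q_sym: "q \<in> U \<Longrightarrow> Q q u v = Q q v u"
  unfolding Q_def using hessian_sym[OF openU smooth_lam] by simp

lemma Q_bilinear: assumes "q \<in> U" shows "bilinear (Q q)"
proof -
  have "bilinear (hessian lam q)" by (rule hessian_bilinear[OF openU smooth_lam assms])
  then show ?thesis unfolding bilinear_def Q_def using linear_compose_neg by blast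
qed

text \<open>The second derivatives of a function of degree one have degree \<open>- 1\<close>.\<close>

lemma Q_cone:
  assumes "l > 0" "q \<in> U" shows "l * Q (l *\<^sub>R q) u v = Q q u v"
proof -
  have d: "((\<lambda>q. dlam q v) has_derivative (\<lambda>u. hessian lam q u v)) (at q)" if "q \<in> U" for q
    unfolding hessian_def using smooth_onD[OF smooth_on_frechet[OF smooth_lam] that] .
  have "((\<lambda>q. dlam (l *\<^sub>R q) v) has_derivative (\<lambda>u. hessian lam (l *\<^sub>R q) (l *\<^sub>R u) v)) (at q)"
    by (rule has_derivative_compose[OF has_derivative_scaleR_right[OF has_derivative_ident] d[OF cone[OF assms]]])
  moreover have "((\<lambda>q. dlam (l *\<^sub>R q) v) has_derivative (\<lambda>u. hessian lam q u v)) (at q)"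
    by (rule has_derivative_transform_within_open[OF d[OF assms(2)] openU assms(2)])
       (use dlam_cone[OF assms(1)] in auto)
  ultimately have "hessian lam (l *\<^sub>R q) (l *\<^sub>R u) v = hessian lam q u v"
    using has_derivative_unique by metis
  then show ?thesis using bilinear_lmul[OF hessian_bilinear[OF openU smooth_lam cone[OF assms]], of l u v]
    by (simp add: Q_def)
qed

text \<open>Euler's identity for the derivatives of \<open>lam\<close>, which are homogeneous of degree zero.\<close>

lemma Q_radial: assumes "q \<in> U" shows "Q q q v = 0"
proof -
  have "((\<lambda>s. dlam (q + s *\<^sub>R q) v) has_vector_derivative hessian lam q q v) (at 0)"
    using hessian_deriv_line[OF openU smooth_lam, of q 0 q v] assms by simp
  moreover have "((\<lambda>s. dlam (q + s *\<^sub>R q) v) has_vector_derivative 0) (at 0)"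
  proof (rule has_vector_derivative_transform_within_open[of "\<lambda>s. dlam q v" _ _ "{-1<..}"])
    show "dlam q v = dlam (q + s *\<^sub>R q) v" if "s \<in> {-1<..}" for s
      using dlam_cone[of "1 + s" q v] assms that by (simp add: scaleR_add_left)
  qed auto
  ultimately show ?thesis unfolding Q_def using vector_derivative_at by (metis neg_0_equal_iff_equal)
qed

lemma Q_shift:
  assumes "q \<in> U" shows "Q q (w + a *\<^sub>R q) (w + a *\<^sub>R q) = Q q w w"
  using Q_bilinear[OF assms] Q_radial[OF assms] Q_sym[OF assms, of _ q]
  by (simp add: bilinear_ladd bilinear_radd bilinear_lmul bilinear_rmul)

lemma Q_scale: "q \<in> U \<Longrightarrow> Q q (c *\<^sub>R v) (c *\<^sub>R v) = c\<^sup>2 * Q q v v"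
  using Q_bilinear[of q] by (simp add: bilinear_lmul bilinear_rmul power2_eq_square)

lemma pr_deriv:
  assumes "(c has_vector_derivative c') (at s)" "c s \<in> U"
  shows "((\<lambda>s. pr (c s)) has_vector_derivative
    inverse (lam (c s)) *\<^sub>R c' + (- (inverse (lam (c s)) * dlam (c s) c' * inverse (lam (c s)))) *\<^sub>R c s) (at s)"
proof -
  have "((\<lambda>s. lam (c s)) has_vector_derivative dlam (c s) c') (at s)"
    by (rule curve_chain_rule[OF dlam[OF assms(2)] assms(1)])
  then have "((\<lambda>s. lam (c s)) has_real_derivative dlam (c s) c') (at s)"
    by (simp add: has_real_derivative_iff_has_vector_derivative)
  from DERIV_inverse'[OF this] lam_pos[OF assms(2)]
  have "((\<lambda>s. inverse (lam (c s))) has_real_derivative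
      - (inverse (lam (c s)) * dlam (c s) c' * inverse (lam (c s)))) (at s)" by auto
  from has_vector_derivative_scaleR[OF this assms(1)] show ?thesis unfolding pr_def .
qed

text \<open>The velocity of the projected curve is a multiple of \<open>c'\<close> plus a radial term, and \<open>Q\<close>
  does not see the radial term.  Hence \<open>Q\<close> computes speeds in \<open>H\<close> directly from curves in \<open>U\<close>.\<close>

lemma Q_pr:
  assumes "(c has_vector_derivative c') (at s)" "c s \<in> U"
  shows "Q (pr (c s)) (vector_derivative (\<lambda>s. pr (c s)) (at s)) (vector_derivative (\<lambda>s. pr (c s)) (at s))
    = inverse (lam (c s)) * Q (c s) c' c'"
proof -
  let ?q = "c s" and ?w = "vector_derivative (\<lambda>s. pr (c s)) (at s)"
  let ?l = "inverse (lam ?q)"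
  have l: "?l > 0" using lam_pos[OF assms(2)] by simp
  have w: "?w = ?l *\<^sub>R c' + (- (?l * dlam ?q c' * ?l)) *\<^sub>R ?q"
    using vector_derivative_at[OF pr_deriv[OF assms]] .
  have "Q ?q ?w ?w = ?l\<^sup>2 * Q ?q c' c'"
    unfolding w Q_shift[OF assms(2)] Q_scale[OF assms(2)] by (rule refl)
  moreover have "?l * Q (pr ?q) ?w ?w = Q ?q ?w ?w"
    unfolding pr_def[of ?q] by (rule Q_cone[OF l assms(2)])
  ultimately show ?thesis using l by (simp add: power2_eq_square)
qed

text \<open>Differentiating \<open>lam = 1\<close> along curves gives one inclusion.  For the other, the projection of a
  straight line with direction \<open>v\<close> in the kernel is a curve in \<open>H\<close> with velocity \<open>v\<close>.\<close>

lemma tangent_H: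
  assumes p: "p \<in> H" shows "tangent_space H p = {v. dlam p v = 0}"
proof safe
  fix v assume "v \<in> tangent_space H p"
  then obtain e \<gamma> where g: "e > 0" "\<gamma> ` {-e<..<e} \<subseteq> H" "\<gamma> 0 = p" "(\<gamma> has_vector_derivative v) (at (0::real))"
    unfolding tangent_space_def by auto
  have "((\<lambda>s. lam (\<gamma> s)) has_vector_derivative dlam p v) (at 0)"
    using curve_chain_rule[OF _ g(4), of lam "dlam p"] dlam[of p] p H_subset g(3) by auto
  moreover have "((\<lambda>s. lam (\<gamma> s)) has_vector_derivative 0) (at 0)"
    by (rule has_vector_derivative_transform_within_open[of "\<lambda>s. 1" _ _ "{-e<..<e}"])
       (use g lam_H in \<open>auto simp: image_subset_iff\<close>)
  ultimately show "dlam p v = 0" using vector_derivative_at by metis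
next
  fix v assume v: "dlam p v = 0"
  have pU: "p \<in> U" using p H_subset by auto
  obtain r where r: "r > 0" "ball p r \<subseteq> U" using openU pU open_contains_ball by blast
  \<comment> \<open>The summand \<open>1\<close> covers the case \<open>v = 0\<close>.\<close>
  define e where "e = r / (norm v + 1)"
  have nv: "norm v + 1 > 0" by (simp add: add_nonneg_pos)
  have e: "e > 0" using r nv by (simp add: e_def)
  have inU: "p + s *\<^sub>R v \<in> U" if "s \<in> {-e<..<e}" for s
  proof -
    have "\<bar>s\<bar> * norm v \<le> \<bar>s\<bar> * (norm v + 1)" by (simp add: mult_left_mono)
    also have "\<dots> < e * (norm v + 1)" using that nv by (intro mult_strict_right_mono) auto
    also have "\<dots> = r" using nv by (simp add: e_def)
    finally show ?thesis using r(2) by (auto simp: dist_norm subset_iff)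
  qed
  have sl: "smooth_on {-e<..<e} (\<lambda>s. p + s *\<^sub>R v)"
    by (intro smooth_on_add smooth_on_scaleR smooth_on_const smooth_on_id) auto
  have "smooth_on {-e<..<e} (\<lambda>s. pr (p + s *\<^sub>R v))"
    by (rule smooth_on_compose[OF _ openU sl smooth_pr]) (use inU in auto)
  moreover have "(\<lambda>s. pr (p + s *\<^sub>R v)) ` {-e<..<e} \<subseteq> H" using inU pr_in by auto
  moreover have "((\<lambda>s. pr (p + s *\<^sub>R v)) has_vector_derivative v) (at 0)"
    using pr_deriv[OF line_has_vector_derivative[of p v 0]] pU v lam_H[OF p] by simp
  ultimately show "v \<in> tangent_space H p" unfolding tangent_space_def using e pr_H[OF p]
    by (intro CollectI exI[of _ e] conjI exI[of _ "\<lambda>s. pr (p + s *\<^sub>R v)"]) auto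
qed

lemma curve_in_H_tangent:
  assumes "open S" "smooth_on S x" "x ` S \<subseteq> H" "s \<in> S"
  shows "dlam (x s) (vector_derivative x (at s)) = 0"
proof -
  have "((\<lambda>s. lam (x s)) has_vector_derivative dlam (x s) (vector_derivative x (at s))) (at s)"
    by (rule curve_chain_rule[OF dlam smooth_on_has_vector_derivative[OF assms(2,4)]]) (use assms H_subset in auto)
  moreover have "((\<lambda>s. lam (x s)) has_vector_derivative 0) (at s)"
    by (rule has_vector_derivative_transform_within_open[of "\<lambda>s. 1" _ _ S])
       (use assms lam_H in \<open>auto simp: image_subset_iff\<close>)
  ultimately show ?thesis by (rule vector_derivative_unique_at)
qed

text \<open>Differentiate \<open>dlam (Y) = 0\<close> along a curve in \<open>H\<close> with velocity \<open>X p\<close>; as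
  \<open>dlam\<close> vanishes on tangent vectors and equals \<open>1\<close> on the position vector, it extracts the
  radial coefficient in the Gauss formula.\<close>

lemma flat_connection_dlam:
  assumes V: "open V" "p \<in> V" and p: "p \<in> H" and X: "tangent_field H V X" and Y: "tangent_field H V Y"
  shows "dlam p (flat_connection X Y p) = Q p (X p) (Y p)"
proof -
  have pU: "p \<in> U" using p H_subset by auto
  have sY: "smooth_on V Y" using Y unfolding tangent_field_def by auto
  have "X p \<in> tangent_space H p" using X p V unfolding tangent_field_def by auto
  then obtain e \<gamma> where g: "e > 0" "\<gamma> ` {-e<..<e} \<subseteq> H" "\<gamma> 0 = p" "(\<gamma> has_vector_derivative X p) (at (0::real))"
    "smooth_on {-e<..<e} \<gamma>"
    unfolding tangent_space_def by auto
  have dD: "((\<lambda>s. dlam (\<gamma> s) b) has_vector_derivative hessian lam p (X p) b) (at 0)" for b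
    unfolding hessian_def
    using curve_chain_rule[OF _ g(4), of "\<lambda>q. dlam q b" "frechet_derivative (\<lambda>q. dlam q b) (at p)"]
      smooth_onD[OF smooth_on_frechet[OF smooth_lam] pU, of b] g(3) by simp
  have dY: "((\<lambda>s. Y (\<gamma> s)) has_vector_derivative flat_connection X Y p) (at 0)"
    unfolding flat_connection_def
    using curve_chain_rule[OF _ g(4), of Y "frechet_derivative Y (at p)"] smooth_onD[OF sY V(2)] g(3) by simp
  have exp: "dlam q w = (\<Sum>b\<in>Basis. (w \<bullet> b) * dlam q b)" if "q \<in> U" for q w
    using linear_basis_expansion[OF dlam_linear[OF that], of w] by simp
  have "linear (hessian lam p (X p))"
    using hessian_bilinear[OF openU smooth_lam pU] unfolding bilinear_def by blast
  then have hl: "hessian lam p (X p) w = (\<Sum>b\<in>Basis. (w \<bullet> b) * hessian lam p (X p) b)" for w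
    using linear_basis_expansion[of "hessian lam p (X p)" w] by simp
  have "((\<lambda>s. (Y (\<gamma> s) \<bullet> b) * dlam (\<gamma> s) b) has_vector_derivative
      (Y p \<bullet> b) * hessian lam p (X p) b + (flat_connection X Y p \<bullet> b) * dlam p b) (at 0)" for b
  proof -
    have "((\<lambda>s. Y (\<gamma> s) \<bullet> b) has_vector_derivative flat_connection X Y p \<bullet> b) (at 0)"
      using bounded_linear.has_vector_derivative[OF bounded_linear_inner_left dY] .
    from has_vector_derivative_mult[OF this dD[of b]] show ?thesis using g(3) by simp
  qed
  then have A: "((\<lambda>s. \<Sum>b\<in>Basis. (Y (\<gamma> s) \<bullet> b) * dlam (\<gamma> s) b) has_vector_derivative
      (\<Sum>b\<in>Basis. (Y p \<bullet> b) * hessian lam p (X p) b + (flat_connection X Y p \<bullet> b) * dlam p b)) (at 0)"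
    by (intro has_vector_derivative_sum)
  have B: "(\<Sum>b\<in>Basis. (Y p \<bullet> b) * hessian lam p (X p) b + (flat_connection X Y p \<bullet> b) * dlam p b)
     = hessian lam p (X p) (Y p) + dlam p (flat_connection X Y p)"
    unfolding sum.distrib hl[of "Y p"] exp[OF pU, of "flat_connection X Y p"] by (rule refl)
  have C: "((\<lambda>s. \<Sum>b\<in>Basis. (Y (\<gamma> s) \<bullet> b) * dlam (\<gamma> s) b) has_vector_derivative 0) (at 0)"
  proof -
    have "open ({-e<..<e} \<inter> \<gamma> -` V)"
      by (rule continuous_open_preimage[OF smooth_on_continuous[OF g(5)] _ V(1)]) simp
    then show ?thesis
    proof (rule has_vector_derivative_transform_within_open[rotated])
      show "0 \<in> {-e<..<e} \<inter> \<gamma> -` V" using g V by auto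
      fix s assume "s \<in> {-e<..<e} \<inter> \<gamma> -` V"
      then have s: "\<gamma> s \<in> H" "\<gamma> s \<in> V" using g(2) by auto
      then have "0 = dlam (\<gamma> s) (Y (\<gamma> s))" using Y tangent_H[OF s(1)] unfolding tangent_field_def by auto
      also have "\<dots> = (\<Sum>b\<in>Basis. (Y (\<gamma> s) \<bullet> b) * dlam (\<gamma> s) b)" using exp s(1) H_subset by blast
      finally show "0 = (\<Sum>b\<in>Basis. (Y (\<gamma> s) \<bullet> b) * dlam (\<gamma> s) b)" .
    qed auto
  qed
  have "hessian lam p (X p) (Y p) + dlam p (flat_connection X Y p) = 0"
    using vector_derivative_unique_at[OF A C] unfolding B .
  then show ?thesis unfolding Q_def by simp
qed

text \<open>Subtracting the radial component of a constant field makes it tangent to all level sets.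
  The existence of such extensions is needed for the uniqueness of the coefficient in
  \<open>centroaffine_metric\<close>.\<close>

lemma tangent_field_extend:
  assumes p: "p \<in> H" and u: "dlam p u = 0"
  shows "tangent_field H U (\<lambda>q. u - (dlam q u * inverse (lam q)) *\<^sub>R q)"
    "u - (dlam p u * inverse (lam p)) *\<^sub>R p = u"
proof -
  show "tangent_field H U (\<lambda>q. u - (dlam q u * inverse (lam q)) *\<^sub>R q)"
    unfolding tangent_field_def
  proof safe
    show "smooth_on U (\<lambda>q. u - (dlam q u * inverse (lam q)) *\<^sub>R q)"
      by (intro smooth_on_diff smooth_on_scaleR smooth_on_mult smooth_on_const smooth_on_id smooth_on_inverse
          smooth_on_frechet openU smooth_lam lam_pos)
    fix q assume "q \<in> U" "q \<in> H"
    then show "u - (dlam q u * inverse (lam q)) *\<^sub>R q \<in> tangent_space H q"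
      using dlam_self[of q] lam_H[of q]
      by (simp add: tangent_H linear_diff[OF dlam_linear] linear_scale[OF dlam_linear])
  qed
qed (use u in simp)

lemma centroaffine_metric_Q:
  assumes p: "p \<in> H" and u: "u \<in> tangent_space H p" and v: "v \<in> tangent_space H p"
  shows "centroaffine_metric H p u v = Q p u v"
proof -
  have pU: "p \<in> U" using p H_subset by auto
  note l = dlam_linear[OF pU]
  have k: "w - c *\<^sub>R p \<in> tangent_space H p \<longleftrightarrow> dlam p w = c" for w c
    unfolding tangent_H[OF p] using dlam_self[OF pU] lam_H[OF p] by (simp add: linear_diff[OF l] linear_scale[OF l])
  show ?thesis unfolding centroaffine_metric_def
  proof (rule the_equality)
    show "\<forall>V X Y. open V \<and> p \<in> V \<and> tangent_field H V X \<and> tangent_field H V Y \<and> X p = u \<and> Y p = v \<longrightarrow>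
            flat_connection X Y p - Q p u v *\<^sub>R p \<in> tangent_space H p"
      using flat_connection_dlam p k by blast
  next
    fix c assume c: "\<forall>V X Y. open V \<and> p \<in> V \<and> tangent_field H V X \<and> tangent_field H V Y \<and> X p = u \<and> Y p = v \<longrightarrow>
            flat_connection X Y p - c *\<^sub>R p \<in> tangent_space H p"
    let ?E = "\<lambda>u. \<lambda>q. u - (dlam q u * inverse (lam q)) *\<^sub>R q"
    have u': "dlam p u = 0" and v': "dlam p v = 0" using u v tangent_H[OF p] by auto
    note tu = tangent_field_extend[OF p u'] and tv = tangent_field_extend[OF p v']
    have "flat_connection (?E u) (?E v) p - c *\<^sub>R p \<in> tangent_space H p"
      using c openU pU tu tv by blast
    then have "dlam p (flat_connection (?E u) (?E v) p) = c" unfolding k .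
    then show "c = Q p u v" using flat_connection_dlam[OF openU pU p tu(1) tv(1)] tu(2) tv(2) by simp
  qed
qed

text \<open>Away from the finitely many break points, where the velocity need not be tangent, the two
  forms agree on velocities.\<close>

lemma curve_length_centroaffine:
  assumes pw: "piecewise_smooth_path \<gamma>" and M: "path_image \<gamma> \<subseteq> H"
  shows "curve_length (centroaffine_metric H) \<gamma> = curve_length Q \<gamma>"
proof -
  from pw obtain m \<tau> where t: "\<tau> 0 = 0" "\<tau> m = 1" "\<And>i. i < m \<Longrightarrow> \<tau> i < \<tau> (Suc i)"
    and pc: "\<And>i. i < m \<Longrightarrow> \<exists>S \<sigma>. open S \<and> {\<tau> i..\<tau> (Suc i)} \<subseteq> S \<and> smooth_on S \<sigma> \<and> (\<forall>t\<in>{\<tau> i..\<tau> (Suc i)}. \<gamma> t = \<sigma> t)"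
    unfolding piecewise_smooth_path_def by auto
  have cover: "\<exists>i<j. \<tau> i < s \<and> s < \<tau> (Suc i)" if "0 < s" "s < \<tau> j" "s \<notin> \<tau> ` {..m}" "j \<le> m" for j s
    using that(2,4)
  proof (induction j)
    case 0 then show ?case using that(1) t(1) by simp
  next
    case (Suc j)
    show ?case
    proof (cases "s < \<tau> j")
      case True then show ?thesis using Suc by (meson Suc_leD less_SucI)
    next
      case False
      have "s \<noteq> \<tau> j" using that(3) Suc.prems by auto
      then show ?thesis using False Suc.prems by (intro exI[of _ j]) auto
    qed
  qed
  have gH: "\<gamma> s \<in> H" if "0 \<le> s" "s \<le> 1" for s using M that by (auto simp: path_image_def)
  have eq: "centroaffine_metric H (\<gamma> s) (vector_derivative \<gamma> (at s)) (vector_derivative \<gamma> (at s))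
      = Q (\<gamma> s) (vector_derivative \<gamma> (at s)) (vector_derivative \<gamma> (at s))"
    if s: "s \<in> {0..1}" "s \<notin> \<tau> ` {..m}" for s
  proof -
    have s0: "s \<noteq> \<tau> 0" "s \<noteq> \<tau> m" using s(2) by auto
    have s01: "0 < s" "s < \<tau> m" using s(1) s0 t(1,2) by auto
    then obtain i where i: "i < m" "\<tau> i < s" "s < \<tau> (Suc i)" using cover[OF s01 s(2)] by auto
    have t0: "0 \<le> \<tau> j" if "j \<le> m" for j
      using that
    proof (induction j)
      case (Suc i) then show ?case using t(3)[of i] by simp
    qed (simp add: t(1))
    have t1: "\<tau> j \<le> 1" if "j \<le> m" for j
      using that
    proof (induction j rule: inc_induct)
      case (step i) then show ?case using t(3)[of i] by simp
    qed (simp add: t(2))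
    obtain S \<sigma> where c: "open S" "{\<tau> i..\<tau> (Suc i)} \<subseteq> S" "smooth_on S \<sigma>" "\<And>t. t \<in> {\<tau> i..\<tau> (Suc i)} \<Longrightarrow> \<gamma> t = \<sigma> t"
      using pc[OF i(1)] by blast
    let ?T = "{\<tau> i<..<\<tau> (Suc i)}"
    have "?T \<subseteq> S" using c(2) by force
    then have sg: "smooth_on ?T \<gamma>"
      by (intro smooth_on_cong[OF _ _ smooth_on_subset[OF c(3)]]) (use c(4) in auto)
    have "\<gamma> ` ?T \<subseteq> H" using gH t0[of i] t1[of "Suc i"] i(1) by auto
    then have "dlam (\<gamma> s) (vector_derivative \<gamma> (at s)) = 0"
      using curve_in_H_tangent[OF _ sg] i by auto
    moreover have "\<gamma> s \<in> H" using gH s(1) by auto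
    ultimately show ?thesis using centroaffine_metric_Q tangent_H by auto
  qed
  have "AE s in lborel. s \<notin> \<tau> ` {..m}"
    by (rule AE_not_in) (simp add: finite_imp_null_set_lborel)
  then show ?thesis unfolding curve_length_def
    by (intro nn_integral_cong_AE) (auto elim!: eventually_mono simp: eq indicator_def)
qed

lemma complete_centroaffine: "riemannian_complete H (centroaffine_metric H) \<longleftrightarrow> riemannian_complete H Q"
proof -
  have "riemannian_dist H (centroaffine_metric H) = riemannian_dist H Q"
  proof (intro ext)
    fix p q
    have "{curve_length (centroaffine_metric H) \<gamma> | \<gamma>. piecewise_smooth_path \<gamma> \<and> path_image \<gamma> \<subseteq> H \<and> pathstart \<gamma> = p \<and> pathfinish \<gamma> = q}
      = {curve_length Q \<gamma> | \<gamma>. piecewise_smooth_path \<gamma> \<and> path_image \<gamma> \<subseteq> H \<and> pathstart \<gamma> = p \<and> pathfinish \<gamma> = q}"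
      using curve_length_centroaffine by (metis (no_types, lifting))
    then show "riemannian_dist H (centroaffine_metric H) p q = riemannian_dist H Q p q"
      unfolding riemannian_dist_def by simp
  qed
  then show ?thesis unfolding riemannian_complete_def by simp
qed

end

section \<open>The hyperbolic case: distances on the level hypersurface\<close>

locale hyperbolic_radial = radial +
  assumes Q_pos: "\<And>p v. p \<in> H \<Longrightarrow> dlam p v = 0 \<Longrightarrow> v \<noteq> 0 \<Longrightarrow> Q p v v > 0"
begin

lemma Q_pos_U:
  assumes q: "q \<in> U" and v: "dlam q v = 0" "v \<noteq> 0" shows "Q q v v > 0"
proof -
  have l: "inverse (lam q) > 0" using lam_pos[OF q] by simp
  have "dlam (pr q) v = 0" using dlam_cone[OF l q] v by (simp add: pr_def)
  then have "Q (pr q) v v > 0" using Q_pos[OF pr_in[OF q]] v by simp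
  moreover have "inverse (lam q) * Q (pr q) v v = Q q v v" unfolding pr_def using Q_cone[OF l q] .
  ultimately show ?thesis using l by (metis mult_pos_pos)
qed

text \<open>Splitting off the radial component reduces the claim to vectors in the kernel of \<open>dlam\<close>.\<close>

lemma Q_nonneg: assumes q: "q \<in> U" shows "Q q v v \<ge> 0"
proof -
  \<comment> \<open>\<open>a q\<close> is the radial component of \<open>v\<close>.\<close>
  define a where "a = dlam q v * inverse (lam q)"
  define w where "w = v - a *\<^sub>R q"
  have "dlam q w = 0" unfolding w_def a_def
    using dlam_self[OF q] lam_pos[OF q] by (simp add: linear_diff[OF dlam_linear[OF q]] linear_scale[OF dlam_linear[OF q]])
  then have "Q q w w \<ge> 0"
    using Q_pos_U[OF q, of w] Q_scale[OF q, of 0 q] by (cases "w = 0") auto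
  moreover have "Q q (w + a *\<^sub>R q) (w + a *\<^sub>R q) = Q q w w" by (rule Q_shift[OF q])
  ultimately show ?thesis by (simp add: w_def)
qed

lemma continuous_Q: "continuous_on (U \<times> UNIV) (\<lambda>z. Q (fst z) (snd z) (snd z))"
proof -
  have cQ: "continuous_on (U \<times> UNIV) (\<lambda>z. Q (fst z) b c)" for b c
    unfolding Q_def
    by (intro continuous_intros continuous_on_compose2[OF continuous_on_hessian[OF smooth_lam]]) auto
  have "continuous_on (U \<times> UNIV) (\<lambda>z. \<Sum>b\<in>Basis. \<Sum>c\<in>Basis. (snd z \<bullet> b) * ((snd z \<bullet> c) * Q (fst z) b c))"
    by (intro continuous_intros cQ)
  then show ?thesis
  proof (rule continuous_on_cong[THEN iffD1, rotated -1])
    fix z assume "z \<in> U \<times> (UNIV :: 'a set)"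
    then have b: "bilinear (Q (fst z))" using Q_bilinear by auto
    from bilinear_basis_expansion[OF b]
    show "(\<Sum>b\<in>Basis. \<Sum>c\<in>Basis. (snd z \<bullet> b) * ((snd z \<bullet> c) * Q (fst z) b c)) = Q (fst z) (snd z) (snd z)"
      by (rule sym)
  qed simp
qed

lemma continuous_dlam: "continuous_on (U \<times> UNIV) (\<lambda>z. dlam (fst z) (snd z))"
  by (rule continuous_on_frechet[OF smooth_lam])

sublocale gQ: length_structure U H Q
  by unfold_locales (use openU H_subset continuous_Q Q_nonneg Q_scale in auto)

sublocale gE: length_structure U H "\<lambda>p u v. u \<bullet> v"
  by unfold_locales (use openU H_subset in \<open>auto intro!: continuous_intros simp: power2_eq_square\<close>)

lemma bounded_below_E: "\<exists>r c. gE.bounded_below_near p r c"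
  unfolding gE.bounded_below_near_def speed_def
  by (intro exI[of _ 1]) (simp add: norm_eq_sqrt_inner)

lemma compact_nbhd:
  assumes "p \<in> U" obtains r where "r > 0" "cball p r \<subseteq> U" "compact (cball p r \<times> sphere (0::'a) 1)"
    "cball p r \<times> sphere 0 1 \<subseteq> U \<times> UNIV"
proof -
  obtain r where r: "r > 0" "cball p r \<subseteq> U" using openU assms open_contains_cball by blast
  then show ?thesis using that[OF r compact_Times[OF compact_cball compact_sphere]] by blast
qed

text \<open>\<open>Q\<close> is degenerate in the radial direction, but \<open>Q + dlam\<^sup>2\<close> is positive definite and agrees
  with \<open>Q\<close> on velocities in \<open>H\<close>.  Its minimum over unit vectors at points of a compact ball
  provides the constant.\<close>

lemma bounded_below_Q:
  assumes p: "p \<in> H" shows "\<exists>r c. gQ.bounded_below_near p r c"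
proof -
  have pU: "p \<in> U" using p H_subset by auto
  obtain r where r: "r > 0" "cball p r \<subseteq> U" "compact (cball p r \<times> sphere (0::'a) 1)" "cball p r \<times> sphere 0 1 \<subseteq> U \<times> (UNIV :: 'a set)"
    using compact_nbhd[OF pU] by blast
  let ?F = "\<lambda>z. Q (fst z) (snd z) (snd z) + (dlam (fst z) (snd z))\<^sup>2"
  have cF: "continuous_on (cball p r \<times> sphere 0 1) ?F"
    by (intro continuous_intros continuous_on_subset[OF continuous_Q r(4)] continuous_on_subset[OF continuous_dlam r(4)])
  have "cball p r \<times> sphere (0::'a) 1 \<noteq> {}" using r(1) by simp
  from continuous_attains_inf[OF r(3) this cF]
  obtain z where z: "z \<in> cball p r \<times> sphere 0 1" "\<And>y. y \<in> cball p r \<times> sphere 0 1 \<Longrightarrow> ?F z \<le> ?F y" by blast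
  have zU: "fst z \<in> U" using z(1) r(2) by auto
  have zn: "snd z \<noteq> 0" using z(1) by auto
  have Fz: "?F z > 0"
    using Q_nonneg[OF zU, of "snd z"] Q_pos_U[OF zU _ zn] by (cases "dlam (fst z) (snd z) = 0") (auto intro: add_nonneg_pos)
  define c where "c = sqrt (?F z)"
  have c: "c > 0" "c\<^sup>2 = ?F z" using Fz by (auto simp: c_def)
  have "gQ.bounded_below_near p r c"
    unfolding gQ.bounded_below_near_def
  proof (intro conjI allI impI)
    fix x :: "real \<Rightarrow> 'a" and s assume x: "smooth_on UNIV x" "range x \<subseteq> H" "dist (x s) p \<le> r"
    let ?v = "vector_derivative x (at s)"
    have xU: "x s \<in> U" using x(2) H_subset by auto
    have d: "dlam (x s) ?v = 0" by (rule curve_in_H_tangent[OF open_UNIV x(1,2)]) simp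
    show "c * norm ?v \<le> speed Q x s"
    proof (cases "?v = 0")
      case False
      let ?w = "inverse (norm ?v) *\<^sub>R ?v"
      have "(x s, ?w) \<in> cball p r \<times> sphere 0 1" using x(3) False by (auto simp: dist_commute)
      then have "c\<^sup>2 \<le> ?F (x s, ?w)" unfolding c(2) by (rule z(2))
      moreover have "dlam (x s) ?w = 0" using d by (simp add: linear_scale[OF dlam_linear[OF xU]])
      ultimately have "c\<^sup>2 \<le> Q (x s) ?w ?w" by simp
      then have "c\<^sup>2 \<le> (inverse (norm ?v))\<^sup>2 * Q (x s) ?v ?v" using Q_scale[OF xU, of "inverse (norm ?v)" ?v] by simp
      then have "c\<^sup>2 * (norm ?v)\<^sup>2 \<le> Q (x s) ?v ?v" using False by (simp add: field_simps)
      then have "(c * norm ?v)\<^sup>2 \<le> Q (x s) ?v ?v" by (simp add: power_mult_distrib)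
      then show ?thesis unfolding speed_def by (rule real_le_rsqrt)
    qed (use gQ.speed_nonneg[of x s] xU in simp)
  qed (use r c in auto)
  then show ?thesis by blast
qed

text \<open>The projection of the straight segment from \<open>p\<close> to \<open>q\<close> has length at most a constant times
  \<open>norm (q - p)\<close>, by compactness.\<close>

lemma Q_dist_small:
  assumes p: "p \<in> H" and e: "e > 0"
  shows "\<exists>d>0. \<forall>q\<in>H. dist q p < d \<longrightarrow> riemannian_dist H Q p q < ennreal e"
proof -
  have pU: "p \<in> U" using p H_subset by auto
  obtain r where r: "r > 0" "cball p r \<subseteq> U" "compact (cball p r \<times> sphere (0::'a) 1)" "cball p r \<times> sphere 0 1 \<subseteq> U \<times> (UNIV :: 'a set)"
    using compact_nbhd[OF pU] by blast
  let ?F = "\<lambda>z. inverse (lam (fst z)) * Q (fst z) (snd z) (snd z)"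
  have cl: "continuous_on (cball p r \<times> sphere (0::'a) 1) (\<lambda>z. lam (fst z))"
    by (rule continuous_on_compose2[OF smooth_on_continuous[OF smooth_lam]]) (use r in \<open>auto intro: continuous_intros\<close>)
  have cF: "continuous_on (cball p r \<times> sphere 0 1) ?F"
    using r(2) lam_pos by (intro continuous_intros cl continuous_on_subset[OF continuous_Q r(4)]) force
  have "bounded (?F ` (cball p r \<times> sphere 0 1))"
    using compact_continuous_image[OF cF r(3)] compact_imp_bounded by blast
  then obtain B where B: "B > 0" "\<And>z. z \<in> cball p r \<times> sphere 0 1 \<Longrightarrow> \<bar>?F z\<bar> \<le> B"
    unfolding bounded_pos by (auto simp: image_iff)
  define d where "d = min r (e / sqrt B)"
  have "riemannian_dist H Q p q < ennreal e" if q: "q \<in> H" "dist q p < d" for q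
  proof -
    let ?c = "\<lambda>s::real. p + s *\<^sub>R (q - p)"
    have cin: "?c s \<in> cball p r" if "s \<in> {0..1}" for s
    proof -
      have "norm (s *\<^sub>R (q - p)) \<le> norm (q - p)" using that by (simp add: mult_left_le_one_le)
      also have "\<dots> \<le> r" using q(2) by (simp add: d_def dist_norm)
      finally show ?thesis by (simp add: dist_norm)
    qed
    have sc: "smooth_on UNIV ?c" by (intro smooth_on_add smooth_on_scaleR smooth_on_const smooth_on_id open_UNIV)
    have oS: "open (?c -` U)" using openU smooth_on_continuous[OF sc] by (rule open_vimage)
    have sp: "smooth_on (?c -` U) (\<lambda>s. pr (?c s))"
      by (rule smooth_on_compose[OF oS openU smooth_on_subset[OF sc] smooth_pr]) auto
    have "riemannian_dist H Q (pr (?c 0)) (pr (?c 1)) \<le> ennreal (sqrt B * norm (q - p) * 1 - sqrt B * norm (q - p) * 0)"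
    proof (rule gQ.dist_le_majorant[OF oS sp, where m = "\<lambda>s. sqrt B * norm (q - p) * s" and m' = "\<lambda>s. sqrt B * norm (q - p)"])
      show "{0..1} \<subseteq> ?c -` U" using cin r(2) by blast
      show "(\<lambda>s. pr (?c s)) ` {0..1} \<subseteq> H" using cin r(2) pr_in by blast
      show "((\<lambda>s. sqrt B * norm (q - p) * s) has_vector_derivative sqrt B * norm (q - p)) (at s)" for s
        by (auto intro!: derivative_eq_intros)
      fix s :: real assume s: "s \<in> {0..1}"
      have cU: "?c s \<in> U" using cin[OF s] r(2) by blast
      have "inverse (lam (?c s)) * Q (?c s) (q - p) (q - p) \<le> B * (norm (q - p))\<^sup>2"
      proof (cases "q = p")
        case False
        let ?w = "inverse (norm (q - p)) *\<^sub>R (q - p)"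
        have "(?c s, ?w) \<in> cball p r \<times> sphere 0 1" using cin[OF s] False by auto
        from B(2)[OF this] have "inverse (lam (?c s)) * Q (?c s) ?w ?w \<le> B" by simp
        then have "inverse (lam (?c s)) * ((inverse (norm (q - p)))\<^sup>2 * Q (?c s) (q - p) (q - p)) \<le> B"
          by (simp only: Q_scale[OF cU])
        moreover have "A * X \<le> B * m\<^sup>2" if "A * ((inverse m)\<^sup>2 * X) \<le> B" "m > 0" for A X m :: real
          using that by (simp add: field_simps)
        ultimately show ?thesis using False by simp
      qed (use Q_scale[OF cU, of 0 0] in simp)
      then have "sqrt (inverse (lam (?c s)) * Q (?c s) (q - p) (q - p)) \<le> sqrt (B * (norm (q - p))\<^sup>2)"
        by (rule real_sqrt_le_mono)
      also have "\<dots> = sqrt B * norm (q - p)" by (simp add: real_sqrt_mult)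
      finally show "speed Q (\<lambda>s. pr (?c s)) s \<le> sqrt B * norm (q - p)"
        unfolding speed_def using Q_pr[OF line_has_vector_derivative cU] by simp
    qed simp
    then have "riemannian_dist H Q p q \<le> ennreal (sqrt B * norm (q - p))" using p q by (simp add: pr_H)
    also have "\<dots> < ennreal e"
    proof (rule ennreal_lessI[OF e])
      have "norm (q - p) < e / sqrt B" using q(2) by (simp add: d_def dist_norm)
      then show "sqrt B * norm (q - p) < e" using B(1) by (simp add: field_simps)
    qed
    finally show ?thesis .
  qed
  moreover have "d > 0" using r e B by (simp add: d_def)
  ultimately show ?thesis by blast
qed

section \<open>Convexity of the cone\<close>

lemma lam_line_deriv:
  assumes "x + s *\<^sub>R w \<in> U"
  shows "((\<lambda>s. lam (x + s *\<^sub>R w)) has_vector_derivative dlam (x + s *\<^sub>R w) w) (at s)"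
    "((\<lambda>s. dlam (x + s *\<^sub>R w) w) has_vector_derivative - Q (x + s *\<^sub>R w) w w) (at s)"
proof -
  show "((\<lambda>s. lam (x + s *\<^sub>R w)) has_vector_derivative dlam (x + s *\<^sub>R w) w) (at s)"
    by (rule curve_chain_rule[OF dlam[OF assms] line_has_vector_derivative])
  show "((\<lambda>s. dlam (x + s *\<^sub>R w) w) has_vector_derivative - Q (x + s *\<^sub>R w) w w) (at s)"
    using hessian_deriv_line[OF openU smooth_lam assms] by (simp add: Q_def)
qed

lemma lam_concave:
  assumes "\<And>s. s \<in> {0..1} \<Longrightarrow> x + s *\<^sub>R w \<in> U"
  shows "concave_on {0..1} (\<lambda>s. lam (x + s *\<^sub>R w))"
proof (rule f''_le0_imp_concave)
  fix s :: real assume "s \<in> {0..1}"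
  then have u: "x + s *\<^sub>R w \<in> U" by (rule assms)
  show "((\<lambda>s. lam (x + s *\<^sub>R w)) has_real_derivative dlam (x + s *\<^sub>R w) w) (at s)"
    "((\<lambda>s. dlam (x + s *\<^sub>R w) w) has_real_derivative - Q (x + s *\<^sub>R w) w w) (at s)"
    using lam_line_deriv[OF u] by (simp_all add: has_real_derivative_iff_has_vector_derivative)
  show "- Q (x + s *\<^sub>R w) w w \<le> 0" using Q_nonneg[OF u] by simp
qed simp

definition seg_in :: "'a \<Rightarrow> 'a \<Rightarrow> bool" where
  "seg_in x y \<longleftrightarrow> (\<forall>s\<in>{0..1}. x + s *\<^sub>R (y - x) \<in> U)"

text \<open>Suppose the segment from \<open>x\<close> to \<open>y\<close> leaves \<open>U\<close>, and let \<open>R\<close> be the first exit time.  Concavity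
  of \<open>lam\<close> on the nearby segments passes to the limit and bounds \<open>lam\<close> from below by \<open>c > 0\<close>
  before \<open>R\<close>.  The projected curve then has finite Euclidean length: its speed is bounded in terms of
  the derivative of the concave function \<open>lam\<close>, whose integral is finite because \<open>lam\<close> is bounded.
  Completeness yields a limit in \<open>H\<close>, and rescaling it gives the exit point, which would
  therefore lie in \<open>U\<close>.\<close>

lemma seg_in_limit:
  assumes ec: "euclidean_complete H" and x: "x \<in> U" and y: "y \<in> U"
    and yn: "\<And>n. seg_in x (z n)" "z \<longlonglongrightarrow> y"
  shows "seg_in x y"
proof (rule ccontr)
  assume "\<not> seg_in x y"
  define w where "w = y - x"
  define P where "P = (\<lambda>r::real. x + r *\<^sub>R w)"
  \<comment> \<open>The times outside \<open>U\<close>; the infimum \<open>R\<close> belongs to this closed set.\<close>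
  define B where "B = {r \<in> {0..1}. P r \<notin> U}"
  have contP: "continuous_on T P" for T unfolding P_def by (intro continuous_intros)
  have sP: "smooth_on UNIV P" unfolding P_def
    by (intro smooth_on_add smooth_on_scaleR smooth_on_const smooth_on_id open_UNIV)
  have oP: "open (P -` U)" using openU contP by (rule open_vimage)
  have ne: "B \<noteq> {}" using \<open>\<not> seg_in x y\<close> unfolding seg_in_def B_def P_def w_def by auto
  have "closed B"
  proof -
    have "B = {0..1} - P -` U" unfolding B_def by auto
    then show ?thesis using oP by (simp add: closed_Diff)
  qed
  moreover have bB: "bdd_below B" unfolding B_def by (intro bdd_belowI[of _ 0]) auto
  ultimately have IB: "Inf B \<in> B" using closed_contains_Inf ne by blast
  define R where "R = Inf B"
  have R: "0 \<le> R" "R \<le> 1" "P R \<notin> U" using IB unfolding R_def B_def by auto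
  have "P 0 = x" by (simp add: P_def)
  then have R0: "R > 0" using R x by (cases "R = 0") auto
  have PU: "P r \<in> U" if "0 \<le> r" "r < R" for r
  proof (rule ccontr)
    assume "P r \<notin> U"
    then have "r \<in> B" using that R unfolding B_def by auto
    then show False using cInf_lower[OF _ bB] that R_def by force
  qed
  define g where "g = (\<lambda>r. lam (P r))"
  define g' where "g' = (\<lambda>r. dlam (P r) w)"
  have gd: "(g has_vector_derivative g' r) (at r)" "(g' has_vector_derivative - Q (P r) w w) (at r)"
    if "0 \<le> r" "r < R" for r
    using lam_line_deriv[of x r w] PU[OF that] unfolding g_def g'_def P_def by auto
  \<comment> \<open>Eventually \<open>lam (z n) > lam y / 2\<close>, and a concave function is at least the minimum of its end values.\<close>
  define c where "c = min (lam x) (lam y / 2)"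
  have c: "c > 0" using lam_pos x y by (simp add: c_def)
  have gc: "c \<le> g r" if r: "0 \<le> r" "r < R" for r
  proof -
    have pU: "P r \<in> U" using PU[OF r] .
    have cl: "isCont lam p" if "p \<in> U" for p
      using smooth_on_continuous[OF smooth_lam] openU that continuous_on_eq_continuous_at by blast
    have "(\<lambda>n. x + r *\<^sub>R (z n - x)) \<longlonglongrightarrow> P r" unfolding P_def w_def
      by (intro tendsto_intros yn)
    from isCont_tendsto_compose[OF cl[OF pU] this]
    have 1: "(\<lambda>n. lam (x + r *\<^sub>R (z n - x))) \<longlonglongrightarrow> g r" by (simp add: g_def)
    have "(\<lambda>n. lam (z n)) \<longlonglongrightarrow> lam y" using isCont_tendsto_compose[OF cl[OF y] yn(2)] .
    then have "eventually (\<lambda>n. lam y / 2 < lam (z n)) sequentially"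
      using order_tendstoD(1) lam_pos[OF y] by (metis field_sum_of_halves less_add_same_cancel1 half_gt_zero)
    then have "eventually (\<lambda>n. c \<le> lam (x + r *\<^sub>R (z n - x))) sequentially"
    proof eventually_elim
      case (elim n)
      have s: "\<And>s. s \<in> {0..1} \<Longrightarrow> x + s *\<^sub>R (z n - x) \<in> U" using yn(1)[of n] unfolding seg_in_def by auto
      have "(1 - r) * lam (x + 0 *\<^sub>R (z n - x)) + r * lam (x + 1 *\<^sub>R (z n - x))
          \<le> lam (x + ((1 - r) *\<^sub>R 0 + r *\<^sub>R 1) *\<^sub>R (z n - x))"
        using concave_onD[OF lam_concave[OF s], of r 0 1] r R by auto
      then have "(1 - r) * lam x + r * lam (z n) \<le> lam (x + r *\<^sub>R (z n - x))" by simp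
      moreover have "(1 - r) * c \<le> (1 - r) * lam x" "r * c \<le> r * lam (z n)"
        using r R elim by (auto intro!: mult_left_mono simp: c_def)
      ultimately show ?case by (simp add: algebra_simps)
    qed
    then show ?thesis using tendsto_lowerbound[OF 1] by auto
  qed
  \<comment> \<open>As \<open>g'\<close> decreases, its absolute value is bounded by an affine function of \<open>g'\<close>, which integrates to a bounded function.\<close>
  define a0 where "a0 = g' 0"
  have ga: "\<bar>g' r\<bar> \<le> 2 * \<bar>a0\<bar> - g' r" if "0 \<le> r" "r < R" for r
  proof -
    have "g' r \<le> g' 0"
    proof (rule DERIV_nonpos_imp_nonincreasing[OF that(1)])
      fix s assume "0 \<le> s" "s \<le> r"
      then have s: "0 \<le> s" "s < R" using that by auto
      show "\<exists>y. (g' has_real_derivative y) (at s) \<and> y \<le> 0"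
        using gd(2)[OF s] Q_nonneg[OF PU[OF s], of w]
        by (intro exI[of _ "- Q (P s) w w"]) (simp add: has_real_derivative_iff_has_vector_derivative)
    qed
    then show ?thesis unfolding a0_def by linarith
  qed
  define K where "K = norm w / c + (norm x + norm w) / c\<^sup>2 + 1"
  have K: "K > 0" using c by (simp add: K_def add_nonneg_pos)
  \<comment> \<open>\<open>m'\<close> dominates the speed of the projected curve; \<open>m\<close> is bounded because \<open>g\<close> is positive.\<close>
  define m where "m = (\<lambda>r. K * ((1 + 2 * \<bar>a0\<bar>) * r - g r))"
  define m' where "m' = (\<lambda>r. K * ((1 + 2 * \<bar>a0\<bar>) - g' r))"
  have md: "(m has_vector_derivative m' r) (at r)" if "0 \<le> r" "r < R" for r
    unfolding m_def m'_def using gd(1)[OF that] by (auto intro!: derivative_eq_intros)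
  have m'0: "m' r \<ge> 0" if "0 \<le> r" "r < R" for r
    unfolding m'_def using ga[OF that] K by (intro mult_nonneg_nonneg) auto
  have sx: "smooth_on (P -` U) (\<lambda>r. pr (P r))"
    by (rule smooth_on_compose[OF oP openU smooth_on_subset[OF sP] smooth_pr]) auto
  have sp: "speed (\<lambda>p u v. u \<bullet> v) (\<lambda>r. pr (P r)) r \<le> m' r" if r: "0 \<le> r" "r < R" for r
  proof -
    have pU: "P r \<in> U" using PU[OF r] .
    have "(P has_vector_derivative w) (at r)" unfolding P_def by (rule line_has_vector_derivative)
    from vector_derivative_at[OF pr_deriv[OF this pU]]
    have v: "vector_derivative (\<lambda>r. pr (P r)) (at r) = inverse (g r) *\<^sub>R w + (- (inverse (g r) * g' r * inverse (g r))) *\<^sub>R P r"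
      unfolding g_def g'_def .
    have gr: "g r > 0" "c \<le> g r" using gc[OF r] c by auto
    have nP: "norm (P r) \<le> norm x + norm w"
    proof -
      have "norm (P r) \<le> norm x + norm (r *\<^sub>R w)" unfolding P_def by (rule norm_triangle_ineq)
      also have "norm (r *\<^sub>R w) \<le> norm w" using r R by (simp add: mult_left_le_one_le)
      finally show ?thesis by simp
    qed
    have i: "inverse (g r) \<le> inverse c" "0 \<le> inverse (g r)" using gr c by (auto intro: le_imp_inverse_le)
    have "norm (vector_derivative (\<lambda>r. pr (P r)) (at r)) \<le> norm (inverse (g r) *\<^sub>R w) + norm ((- (inverse (g r) * g' r * inverse (g r))) *\<^sub>R P r)"
      unfolding v by (rule norm_triangle_ineq)
    also have "\<dots> = inverse (g r) * norm w + (inverse (g r) * inverse (g r)) * (\<bar>g' r\<bar> * norm (P r))"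
      using gr by (simp add: abs_mult)
    also have "\<dots> \<le> inverse c * norm w + (inverse c * inverse c) * (\<bar>g' r\<bar> * (norm x + norm w))"
      using i nP c by (intro add_mono mult_mono mult_nonneg_nonneg) auto
    also have "\<dots> = (norm w / c) * 1 + (norm x + norm w) / c\<^sup>2 * \<bar>g' r\<bar>"
      by (simp add: field_simps power2_eq_square)
    also have "\<dots> \<le> K * 1 + K * \<bar>g' r\<bar>"
      unfolding K_def using c by (intro add_mono mult_right_mono) auto
    also have "\<dots> = K * (1 + \<bar>g' r\<bar>)" by (simp add: algebra_simps)
    also have "\<dots> \<le> m' r" unfolding m'_def using ga[OF r] K by (intro mult_left_mono) auto
    finally show ?thesis unfolding speed_def by (simp add: norm_eq_sqrt_inner)
  qed
  have lip1: "riemannian_dist H (\<lambda>p u v. u \<bullet> v) (pr (P s)) (pr (P t)) \<le> ennreal (m t - m s)" if "0 \<le> s" "s \<le> t" "t < R" for s t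
  proof (rule gE.dist_le_majorant[OF oP sx _ that(2), where m' = m'])
    show "{s..t} \<subseteq> P -` U" using PU that by auto
    show "(\<lambda>r. pr (P r)) ` {s..t} \<subseteq> H" using PU that pr_in by auto
  qed (use md sp that in auto)
  have mm: "m s \<le> m t" if "0 \<le> s" "s \<le> t" "t < R" for s t
  proof (rule DERIV_nonneg_imp_nondecreasing[OF that(2)])
    fix r assume "s \<le> r" "r \<le> t"
    then have r: "0 \<le> r" "r < R" using that by auto
    show "\<exists>y. (m has_real_derivative y) (at r) \<and> 0 \<le> y"
      using md[OF r] m'0[OF r] by (intro exI[of _ "m' r"]) (simp add: has_real_derivative_iff_has_vector_derivative)
  qed
  have lip: "riemannian_dist H (\<lambda>p u v. u \<bullet> v) (pr (P s)) (pr (P t)) \<le> ennreal (1 * \<bar>m s - m t\<bar>)" if "s \<in> {0<..<R}" "t \<in> {0<..<R}" for s t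
  proof (cases "s \<le> t")
    case True
    then have "\<bar>m s - m t\<bar> = m t - m s" using mm[of s t] that by simp
    then show ?thesis using lip1[of s t] True that by simp
  next
    case False
    then have "\<bar>m s - m t\<bar> = m s - m t" using mm[of t s] that by simp
    then show ?thesis using lip1[of t s] False that gE.dist_commute[of "pr (P s)"] by simp
  qed
  have mb: "m s \<le> K * (1 + 2 * \<bar>a0\<bar>)" if "0 < s" "s < R" for s
  proof -
    have "(1 + 2 * \<bar>a0\<bar>) * s \<le> (1 + 2 * \<bar>a0\<bar>) * 1" using that R by (intro mult_left_mono) auto
    then show ?thesis unfolding m_def using K gc[of s] c that by (intro mult_left_mono) auto
  qed
  obtain l where l: "(m \<longlongrightarrow> l) (at_left R)"
    by (rule mono_limit_at_left[of 0 "R / 2" R m "K * (1 + 2 * \<bar>a0\<bar>)"]) (use R0 mm mb in auto)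
  have evI: "eventually (\<lambda>t. t \<in> {0<..<R}) (at_left R)"
    using eventually_at_left[of 0 R] R0 by auto
  obtain p where p: "p \<in> H" "((\<lambda>r. pr (P r)) \<longlongrightarrow> p) (at_left R)"
    using gE.complete_imp_limit[OF ec[unfolded euclidean_complete_def] bounded_below_E _ evI _ lip _ l] PU pr_in by auto
  \<comment> \<open>The limit of \<open>m\<close> gives back the limit of \<open>lam\<close> along the segment.\<close>
  have gl: "(g \<longlongrightarrow> (1 + 2 * \<bar>a0\<bar>) * R - l / K) (at_left R)"
  proof -
    have "((\<lambda>r. (1 + 2 * \<bar>a0\<bar>) * r - m r / K) \<longlongrightarrow> (1 + 2 * \<bar>a0\<bar>) * R - l / K) (at_left R)"
      using K by (intro tendsto_intros l) auto
    moreover have "(\<lambda>r. (1 + 2 * \<bar>a0\<bar>) * r - m r / K) = g" using K by (simp add: m_def)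
    ultimately show ?thesis by simp
  qed
  define g0 where "g0 = (1 + 2 * \<bar>a0\<bar>) * R - l / K"
  have "eventually (\<lambda>r. c \<le> g r) (at_left R)" using evI by eventually_elim (use gc in auto)
  then have "c \<le> g0" using tendsto_lowerbound[OF gl] unfolding g0_def by auto
  then have g0: "g0 > 0" using c by simp
  have "((\<lambda>r. g r *\<^sub>R pr (P r)) \<longlongrightarrow> g0 *\<^sub>R p) (at_left R)"
    using gl p(2) unfolding g0_def by (intro tendsto_intros)
  moreover have "eventually (\<lambda>r. g r *\<^sub>R pr (P r) = P r) (at_left R)"
    using evI by eventually_elim (use lam_pr PU in \<open>auto simp: g_def\<close>)
  ultimately have "(P \<longlongrightarrow> g0 *\<^sub>R p) (at_left R)" by (rule Lim_transform_eventually)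
  moreover have "(P \<longlongrightarrow> P R) (at_left R)" unfolding P_def by (intro tendsto_intros)
  ultimately have "P R = g0 *\<^sub>R p" using tendsto_unique trivial_limit_at_left_real by blast
  then show False using R(3) cone[OF g0, of p] p(1) H_subset by auto
qed

lemma convex_U:
  assumes ec: "euclidean_complete H" and conn: "connected U"
  shows "convex U"
proof -
  have "seg_in x y" if x: "x \<in> U" and y: "y \<in> U" for x y
  proof -
    define A where "A = {y \<in> U. seg_in x y}"
    have op: "open {y. seg_in x y}"
      unfolding open_contains_ball
    proof
      fix y assume "y \<in> {y. seg_in x y}"
      then have y: "seg_in x y" by simp
      let ?S = "(\<lambda>s::real. x + s *\<^sub>R (y - x)) ` {0..1}"
      have "compact ?S" by (intro compact_continuous_image continuous_intros) auto
      moreover have "?S \<inter> - U = {}" using y unfolding seg_in_def by auto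
      ultimately obtain d where d: "d > 0" "\<And>u v. u \<in> ?S \<Longrightarrow> v \<in> - U \<Longrightarrow> d \<le> dist u v"
        using separate_compact_closed[of ?S "- U"] openU by (auto simp: closed_def)
      have "seg_in x z" if "z \<in> ball y d" for z
        unfolding seg_in_def
      proof (rule ballI, rule ccontr)
        fix s :: real assume s: "s \<in> {0..1}" "x + s *\<^sub>R (z - x) \<notin> U"
        have "d \<le> dist (x + s *\<^sub>R (y - x)) (x + s *\<^sub>R (z - x))"
          by (rule d(2)[OF imageI]) (use s in auto)
        also have "\<dots> = norm (s *\<^sub>R (y - z))" by (simp add: dist_norm algebra_simps)
        also have "\<dots> \<le> norm (y - z)" using s by (simp add: mult_left_le_one_le)
        finally show False using that by (simp add: dist_norm)
      qed
      then show "\<exists>e>0. ball y e \<subseteq> {y. seg_in x y}" using d(1) by blast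
    qed
    have "A = U \<inter> {y. seg_in x y}" unfolding A_def by auto
    then have o: "openin (top_of_set U) A" using op by (auto simp: openin_open)
    have "A = U \<inter> closure A"
    proof
      show "U \<inter> closure A \<subseteq> A"
      proof
        fix y assume y: "y \<in> U \<inter> closure A"
        then obtain z where z: "\<forall>n. z n \<in> A" "z \<longlonglongrightarrow> y" using closure_sequential[of y A] by blast
        then have "seg_in x y" using seg_in_limit[OF ec x, of y z] y unfolding A_def by auto
        then show "y \<in> A" using y unfolding A_def by auto
      qed
    qed (auto simp: A_def closure_subset[THEN subsetD])
    then have "closedin (top_of_set U) A" unfolding closedin_closed by blast
    moreover have "x \<in> A" using x unfolding A_def seg_in_def by auto
    ultimately have "A = U" using conn o unfolding connected_clopen by blast
    then show ?thesis using y unfolding A_def by auto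
  qed
  then have "(1 - s) *\<^sub>R x + s *\<^sub>R y \<in> U" if "x \<in> U" "y \<in> U" "0 \<le> s" "s \<le> 1" for x y s
    using that unfolding seg_in_def by (force simp: algebra_simps)
  then show ?thesis unfolding convex_alt by auto
qed

end

section \<open>Completeness makes the level hypersurface a Cauchy hypersurface\<close>

lemma constant_sign:
  fixes d :: "real \<Rightarrow> real"
  assumes "connected I" "continuous_on I d" "\<And>t. t \<in> I \<Longrightarrow> d t \<noteq> 0"
  obtains \<sigma> where "\<sigma> = 1 \<or> \<sigma> = -1" "\<And>t. t \<in> I \<Longrightarrow> \<sigma> * d t > 0"
proof (cases "\<exists>t\<in>I. d t < 0")
  case True
  then obtain t0 where t0: "t0 \<in> I" "d t0 < 0" by auto
  have c: "connected (d ` I)" using assms(1,2) connected_continuous_image by blast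
  have "d t < 0" if "t \<in> I" for t
  proof (rule ccontr)
    assume "\<not> d t < 0"
    then have "0 \<in> d ` I" using connectedD_interval[OF c, of "d t0" "d t" 0] t0 that by auto
    then show False using assms(3) by auto
  qed
  then show ?thesis using that[of "-1"] by auto
next
  case False
  then have "d t > 0" if "t \<in> I" for t using assms(3)[OF that] that by force
  then show ?thesis using that[of 1] by auto
qed

lemma ereal_between:
  assumes "a < e" "e < (b::ereal)" shows "e = ereal (real_of_ereal e)" "real_of_ereal e \<in> einterval a b"
proof -
  show 1: "e = ereal (real_of_ereal e)" using assms by (cases e) auto
  then show "real_of_ereal e \<in> einterval a b" using assms unfolding einterval_def by (simp flip: 1)
qed

lemma at_right_ereal_nontrivial: assumes "a < (b::ereal)" shows "at_right a \<noteq> bot"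
proof
  assume "at_right a = bot"
  then have "eventually (\<lambda>x. False) (at_right a)" by simp
  then obtain c where "c > a" "\<forall>y>a. y < c \<longrightarrow> False" using eventually_at_right[OF assms] by auto
  then show False using dense by blast
qed

lemma at_left_ereal_nontrivial: assumes "a < (b::ereal)" shows "at_left b \<noteq> bot"
proof
  assume "at_left b = bot"
  then have "eventually (\<lambda>x. False) (at_left b)" by simp
  then obtain c where "c < b" "\<forall>y>c. y < b \<longrightarrow> False" using eventually_at_left[OF assms] by auto
  then show False using dense by blast
qed

context hyperbolic_radial
begin

text \<open>With \<open>t = ln lam\<close>, a timelike curve moves in \<open>H\<close> with speed less than
  \<open>sqrt K\<close> times the rate of change of \<open>t\<close>.  So \<open>t\<close> is strictly monotone, which gives uniqueness
  of the intersection with \<open>H\<close>, and wherever \<open>t\<close> has a finite limit the curve converges in \<open>U\<close>,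
  which gives existence.  Only the sign of \<open>G\<close> on vectors matters.\<close>

lemma complete_imp_cauchy:
  assumes comp: "riemannian_complete H Q" and K: "K > 0"
    and tl: "\<And>q v. q \<in> U \<Longrightarrow> G q v v < 0 \<longleftrightarrow> lam q * Q q v v < K * (dlam q v)\<^sup>2"
  shows "cauchy_hypersurface U G H"
  unfolding cauchy_hypersurface_def
proof (intro conjI allI impI)
  show "H \<subseteq> U" by (rule H_subset)
  fix a b \<gamma> assume it: "inextendible_timelike_curve U G a b \<gamma>"
  define I where "I = einterval a b"
  have gU: "\<gamma> t \<in> U" if "t \<in> I" for t
    using it that unfolding inextendible_timelike_curve_def I_def by auto
  have ab: "a < b" and sg: "smooth_on I \<gamma>" and gI: "\<gamma> ` I \<subseteq> U"
    using it unfolding inextendible_timelike_curve_def I_def by auto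
  have tim: "G (\<gamma> t) (vector_derivative \<gamma> (at t)) (vector_derivative \<gamma> (at t)) < 0" if "t \<in> I" for t
    using it that unfolding inextendible_timelike_curve_def I_def by auto
  have noa: "\<not> (\<exists>p\<in>U. ((\<gamma> \<circ> real_of_ereal) \<longlongrightarrow> p) (at_right a))"
    and nob: "\<not> (\<exists>p\<in>U. ((\<gamma> \<circ> real_of_ereal) \<longlongrightarrow> p) (at_left b))"
    using it unfolding inextendible_timelike_curve_def by auto
  have oI: "open I" unfolding I_def by (rule open_einterval)
  have sub: "{s..t} \<subseteq> I" if "s \<in> I" "t \<in> I" for s t
    using that unfolding I_def einterval_def
    by (auto intro: less_le_trans le_less_trans) (meson ereal_less_eq(3) le_less_trans less_le_trans)+
  have cI: "connected I"
    unfolding is_interval_connected_1[symmetric] is_interval_1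
    using sub by (meson atLeastAtMost_iff subsetD)
  define l where "l = (\<lambda>t. lam (\<gamma> t))"
  define d where "d = (\<lambda>t. vector_derivative l (at t))"
  have sl: "smooth_on I l" unfolding l_def by (rule smooth_on_compose[OF oI openU sg smooth_lam gI])
  have lpos: "l t > 0" if "t \<in> I" for t unfolding l_def by (rule lam_pos[OF gU[OF that]])
  have ld: "(l has_vector_derivative d t) (at t)" if "t \<in> I" for t unfolding d_def by (rule smooth_on_has_vector_derivative[OF sl that])
  have d_eq: "d t = dlam (\<gamma> t) (vector_derivative \<gamma> (at t))" if "t \<in> I" for t
    by (rule vector_derivative_unique_at[OF ld[OF that]])
       (unfold l_def, rule curve_chain_rule[OF dlam[OF gU[OF that]] smooth_on_has_vector_derivative[OF sg that]])
  let ?q = "\<lambda>t. Q (\<gamma> t) (vector_derivative \<gamma> (at t)) (vector_derivative \<gamma> (at t))"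
  have tq: "l t * ?q t < K * (d t)\<^sup>2" if "t \<in> I" for t
    using tim[OF that] tl[OF gU[OF that]] d_eq[OF that] by (simp add: l_def)
  have dne: "d t \<noteq> 0" if "t \<in> I" for t
  proof
    assume "d t = 0"
    then have "l t * ?q t < 0" using tq[OF that] by simp
    moreover have "l t * ?q t \<ge> 0" using lpos[OF that] Q_nonneg[OF gU[OF that]] by simp
    ultimately show False by simp
  qed
  have cd: "continuous_on I d" unfolding d_def
    by (rule smooth_on_continuous[OF smooth_on_vector_derivative[OF oI sl]])
  \<comment> \<open>The sign \<open>\<sigma>\<close> makes \<open>M\<close> increasing for future and past directed curves alike.\<close>
  obtain \<sigma> where \<sigma>: "\<sigma> = 1 \<or> \<sigma> = -1" "\<And>t. t \<in> I \<Longrightarrow> \<sigma> * d t > 0"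
    using constant_sign[OF cI cd dne] by blast
  define M where "M = (\<lambda>t. \<sigma> * ln (l t))"
  define M' where "M' = (\<lambda>t. \<sigma> * d t / l t)"
  have Md: "(M has_real_derivative M' t) (at t)" if "t \<in> I" for t
    unfolding M_def M'_def using ld[OF that] lpos[OF that]
    by (auto intro!: derivative_eq_intros simp: has_real_derivative_iff_has_vector_derivative[symmetric] field_simps)
  have M'pos: "M' t > 0" if "t \<in> I" for t unfolding M'_def using \<sigma>(2)[OF that] lpos[OF that] by simp
  have Mless: "M s < M t" if "s \<in> I" "t \<in> I" "s < t" for s t
  proof (rule DERIV_pos_imp_increasing[OF that(3)])
    fix x assume "s \<le> x" "x \<le> t"
    then have "x \<in> I" using sub[OF that(1,2)] by auto
    then show "\<exists>y. (M has_real_derivative y) (at x) \<and> 0 < y" using Md M'pos by blast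
  qed
  have Mle: "M s \<le> M t" if "s \<in> I" "t \<in> I" "s \<le> t" for s t
    using Mless[OF that(1,2)] that(3) by (cases "s = t") auto
  have inH: "\<gamma> t \<in> H \<longleftrightarrow> M t = 0" if "t \<in> I" for t
    unfolding H_eq M_def using gU[OF that] lpos[OF that] \<sigma>(1) by (auto simp: l_def)
  have sx: "smooth_on I (\<lambda>t. pr (\<gamma> t))" by (rule smooth_on_compose[OF oI openU sg smooth_pr gI])
  have sp: "speed Q (\<lambda>t. pr (\<gamma> t)) t \<le> sqrt K * M' t" if "t \<in> I" for t
  proof -
    have lt: "l t > 0" using lpos[OF that] .
    have "inverse (l t) * ?q t \<le> K * (d t)\<^sup>2 / (l t)\<^sup>2"
      using tq[OF that] lt by (simp add: field_simps power2_eq_square)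
    also have "\<dots> = (sqrt K * M' t)\<^sup>2"
      using K \<sigma>(1) by (auto simp: M'_def power_mult_distrib power_divide)
    finally have "sqrt (inverse (l t) * ?q t) \<le> sqrt K * M' t"
      using K M'pos[OF that] by (intro real_le_lsqrt) auto
    then show ?thesis unfolding speed_def Q_pr[OF smooth_on_has_vector_derivative[OF sg that] gU[OF that]] by (simp add: l_def)
  qed
  have lip1: "riemannian_dist H Q (pr (\<gamma> s)) (pr (\<gamma> t)) \<le> ennreal (sqrt K * M t - sqrt K * M s)"
    if "s \<in> I" "t \<in> I" "s \<le> t" for s t
  proof (rule gQ.dist_le_majorant[OF oI sx sub[OF that(1,2)] that(3), where m' = "\<lambda>t. sqrt K * M' t"])
    show "(\<lambda>t. pr (\<gamma> t)) ` {s..t} \<subseteq> H" using sub[OF that(1,2)] gU pr_in by auto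
    fix x assume "x \<in> {s..t}"
    then have x: "x \<in> I" using sub[OF that(1,2)] by auto
    show "((\<lambda>t. sqrt K * M t) has_vector_derivative sqrt K * M' x) (at x)"
      using DERIV_cmult[OF Md[OF x]] by (simp add: has_real_derivative_iff_has_vector_derivative)
    show "speed Q (\<lambda>t. pr (\<gamma> t)) x \<le> sqrt K * M' x" by (rule sp[OF x])
  qed
  have lip: "riemannian_dist H Q (pr (\<gamma> s)) (pr (\<gamma> t)) \<le> ennreal (sqrt K * \<bar>M s - M t\<bar>)"
    if "s \<in> I" "t \<in> I" for s t
  proof (cases "s \<le> t")
    case True
    then have "\<bar>M s - M t\<bar> = M t - M s" using Mle[OF that] by simp
    then show ?thesis using lip1[OF that True] by (simp add: right_diff_distrib)
  next
    case False
    then have "\<bar>M s - M t\<bar> = M s - M t" using Mle[OF that(2,1)] by simp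
    then show ?thesis using lip1[OF that(2,1)] False gQ.dist_commute[of "pr (\<gamma> s)"] by (simp add: right_diff_distrib)
  qed
  \<comment> \<open>An end at which \<open>M\<close> has a finite limit is not an inextendible end.\<close>
  have limU: "\<exists>p\<in>U. ((\<gamma> \<circ> real_of_ereal) \<longlongrightarrow> p) F"
    if F: "F \<noteq> bot" "eventually (\<lambda>e. e \<in> {a<..<b}) F" and m: "((\<lambda>e. M (real_of_ereal e)) \<longlongrightarrow> m0) F" for F m0
  proof -
    have inI: "real_of_ereal e \<in> I" if "e \<in> {a<..<b}" for e
      using ereal_between(2)[of a e b] that unfolding I_def by auto
    obtain p where p: "p \<in> H" "((\<lambda>e. pr (\<gamma> (real_of_ereal e))) \<longlongrightarrow> p) F"
      using gQ.complete_imp_limit[OF comp bounded_below_Q F, where x = "\<lambda>e. pr (\<gamma> (real_of_ereal e))"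
          and m = "\<lambda>e. M (real_of_ereal e)" and C = "sqrt K" and ?m0.0 = m0]
        lip inI K m gU pr_in by auto
    have "((\<lambda>e. exp (\<sigma> * M (real_of_ereal e)) *\<^sub>R pr (\<gamma> (real_of_ereal e))) \<longlongrightarrow> exp (\<sigma> * m0) *\<^sub>R p) F"
      by (intro tendsto_intros m p)
    moreover have "eventually (\<lambda>e. exp (\<sigma> * M (real_of_ereal e)) *\<^sub>R pr (\<gamma> (real_of_ereal e)) = (\<gamma> \<circ> real_of_ereal) e) F"
      using F(2)
    proof eventually_elim
      case (elim e)
      then have e: "real_of_ereal e \<in> I" by (rule inI)
      have "exp (\<sigma> * M (real_of_ereal e)) = l (real_of_ereal e)" using \<sigma>(1) lpos[OF e] by (auto simp: M_def)
      then show ?case using lam_pr[OF gU[OF e]] by (simp add: l_def)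
    qed
    ultimately have "((\<gamma> \<circ> real_of_ereal) \<longlongrightarrow> exp (\<sigma> * m0) *\<^sub>R p) F" by (rule Lim_transform_eventually)
    moreover have "exp (\<sigma> * m0) *\<^sub>R p \<in> U" using cone p(1) H_subset by auto
    ultimately show ?thesis by blast
  qed
  obtain t0 where t0: "t0 \<in> I" using einterval_nonempty[OF ab] unfolding I_def einterval_def by auto
  then have t0': "a < ereal t0" "ereal t0 < b" unfolding I_def einterval_def by auto
  have mono_e: "M (real_of_ereal s) \<le> M (real_of_ereal t)" if "a < s" "s \<le> t" "t < b" for s t
  proof (rule Mle)
    have s: "a < s" "s < b" and t: "a < t" "t < b" using that by auto
    show "real_of_ereal s \<in> I" "real_of_ereal t \<in> I"
      using ereal_between(2)[OF s] ereal_between(2)[OF t] unfolding I_def by auto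
    show "real_of_ereal s \<le> real_of_ereal t"
      using that(2) ereal_between(1)[OF s] ereal_between(1)[OF t] by (metis ereal_less_eq(3))
  qed
  \<comment> \<open>Without a zero, \<open>M\<close> has constant sign, hence is bounded at one of the two ends.\<close>
  have ex: "\<exists>t\<in>I. M t = 0"
  proof (rule ccontr)
    assume "\<not> (\<exists>t\<in>I. M t = 0)"
    then have ne: "\<And>t. t \<in> I \<Longrightarrow> M t \<noteq> 0" by auto
    have cM: "continuous_on I M" using Md by (intro DERIV_continuous_on) (auto intro: has_field_derivative_at_within)
    obtain \<tau> where \<tau>: "\<tau> = 1 \<or> \<tau> = -1" "\<And>t. t \<in> I \<Longrightarrow> \<tau> * M t > 0"
      using constant_sign[OF cI cM ne] by blast
    show False
    proof (cases "\<tau> = 1")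
      case True
      obtain m0 where "((\<lambda>e. M (real_of_ereal e)) \<longlongrightarrow> m0) (at_right a)"
      proof (rule mono_limit_at_right[OF t0' mono_e])
        show "0 \<le> M (real_of_ereal s)" if "a < s" "s < b" for s
          using \<tau>(2)[of "real_of_ereal s"] True ereal_between(2)[OF that] unfolding I_def by auto
      qed
      moreover have "eventually (\<lambda>e. e \<in> {a<..<b}) (at_right a)"
        using eventually_at_right[OF ab] ab by auto
      ultimately show False using limU[OF at_right_ereal_nontrivial[OF ab]] noa by blast
    next
      case False
      obtain m0 where "((\<lambda>e. M (real_of_ereal e)) \<longlongrightarrow> m0) (at_left b)"
      proof (rule mono_limit_at_left[OF t0' mono_e])
        show "M (real_of_ereal s) \<le> 0" if "a < s" "s < b" for s
          using \<tau>(2)[of "real_of_ereal s"] \<tau>(1) False ereal_between(2)[OF that] unfolding I_def by auto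
      qed
      moreover have "eventually (\<lambda>e. e \<in> {a<..<b}) (at_left b)"
        using eventually_at_left[OF ab] ab by auto
      ultimately show False using limU[OF at_left_ereal_nontrivial[OF ab]] nob by blast
    qed
  qed
  show "\<exists>!t. t \<in> einterval a b \<and> \<gamma> t \<in> H"
  proof -
    obtain t where t: "t \<in> I" "M t = 0" using ex by blast
    show ?thesis
    proof (rule ex1I[of _ t])
      show "t \<in> einterval a b \<and> \<gamma> t \<in> H" using t inH unfolding I_def by auto
      fix s assume "s \<in> einterval a b \<and> \<gamma> s \<in> H"
      then have s: "s \<in> I" "M s = 0" using inH unfolding I_def by auto
      show "s = t" using Mless[OF s(1) t(1)] Mless[OF t(1) s(1)] s(2) t(2) by (cases s t rule: linorder_cases) auto
    qed
  qed
qed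

section \<open>A Cauchy hypersurface forces completeness\<close>

lemma smooth_Q_curve:
  assumes "open S" "smooth_on S c" "c ` S \<subseteq> U"
  shows "smooth_on S (\<lambda>s. Q (c s) (vector_derivative c (at s)) (vector_derivative c (at s)))"
proof -
  let ?v = "\<lambda>s. vector_derivative c (at s)"
  have sQ: "smooth_on S (\<lambda>s. Q (c s) a b)" for a b
    unfolding Q_def hessian_def
    by (intro smooth_on_minus assms(1) smooth_on_compose[OF assms(1) openU assms(2) _ assms(3), of "\<lambda>q. frechet_derivative (\<lambda>q. dlam q b) (at q) a"]
        smooth_on_frechet smooth_lam)
  have "smooth_on S (\<lambda>s. \<Sum>b\<in>Basis. \<Sum>a\<in>Basis. (?v s \<bullet> b) * ((?v s \<bullet> a) * Q (c s) b a))"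
    by (intro smooth_on_sum smooth_on_mult smooth_on_inner smooth_on_const smooth_on_vector_derivative sQ assms(1,2))
  then show ?thesis
  proof (rule smooth_on_cong[OF assms(1), rotated])
    fix s assume "s \<in> S"
    then have b: "bilinear (Q (c s))" using Q_bilinear assms(3) by auto
    from bilinear_basis_expansion[OF b]
    show "(\<Sum>b\<in>Basis. \<Sum>a\<in>Basis. (?v s \<bullet> b) * ((?v s \<bullet> a) * Q (c s) b a)) = Q (c s) (?v s) (?v s)"
      by (rule sym)
  qed
qed

text \<open>The curve over \<open>X\<close> with height \<open>T\<close> is timelike as soon as \<open>T\<close> changes fast enough compared
  with the speed of \<open>X\<close>.  It has no end point in \<open>U\<close> where \<open>T\<close> is unbounded, and neither at
  an end where \<open>X\<close> has no limit, even if \<open>T\<close> stays bounded there.\<close>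

lemma warped_curve_inextendible:
  assumes K: "K > 0"
    and tl: "\<And>q v. q \<in> U \<Longrightarrow> G q v v < 0 \<longleftrightarrow> lam q * Q q v v < K * (dlam q v)\<^sup>2"
    and X: "smooth_on UNIV X" "range X \<subseteq> H"
    and T: "smooth_on UNIV T" "\<And>s. (T has_real_derivative T' s) (at s)"
    and fast: "\<And>s. Q (X s) (vector_derivative X (at s)) (vector_derivative X (at s)) < K * (T' s)\<^sup>2"
    and bot: "filterlim T at_infinity at_bot"
    and top: "filterlim T at_infinity at_top \<or> \<not> (\<exists>q\<in>H. (X \<longlongrightarrow> q) at_top)"
  shows "inextendible_timelike_curve U G (-\<infinity>) \<infinity> (\<lambda>s. exp (T s) *\<^sub>R X s)"
proof -
  define c where "c = (\<lambda>s. exp (T s) *\<^sub>R X s)"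
  have XH: "X s \<in> H" for s using X(2) by auto
  then have XU: "X s \<in> U" for s using H_subset by auto
  have cU: "c s \<in> U" for s unfolding c_def using cone[OF _ XU] by simp
  have lc: "lam (c s) = exp (T s)" for s unfolding c_def using hom[OF _ XU] lam_H[OF XH] by simp
  have pc: "pr (c s) = X s" for s unfolding c_def using pr_cone[OF _ XU] pr_H[OF XH] by simp
  have sc: "smooth_on UNIV c" unfolding c_def by (intro smooth_on_scaleR smooth_on_exp open_UNIV T(1) X(1))
  let ?c' = "\<lambda>s. vector_derivative c (at s)"
  have cd: "(c has_vector_derivative ?c' s) (at s)" for s by (rule smooth_on_has_vector_derivative[OF sc]) simp
  have dl: "dlam (c s) (?c' s) = exp (T s) * T' s" for s
  proof (rule vector_derivative_unique_at)
    show "((\<lambda>s. lam (c s)) has_vector_derivative dlam (c s) (?c' s)) (at s)"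
      by (rule curve_chain_rule[OF dlam[OF cU] cd])
    show "((\<lambda>s. lam (c s)) has_vector_derivative exp (T s) * T' s) (at s)"
      unfolding lc has_real_derivative_iff_has_vector_derivative[symmetric]
      using DERIV_chain2[OF DERIV_exp T(2)] .
  qed
  have Qc: "Q (c s) (?c' s) (?c' s) = exp (T s) * Q (X s) (vector_derivative X (at s)) (vector_derivative X (at s))" for s
  proof -
    have "Q (X s) (vector_derivative X (at s)) (vector_derivative X (at s)) = inverse (exp (T s)) * Q (c s) (?c' s) (?c' s)"
      using Q_pr[OF cd cU] unfolding pc lc .
    then show ?thesis by simp
  qed
  have tim: "G (c s) (?c' s) (?c' s) < 0" for s
  proof -
    have "(exp (T s) * exp (T s)) * Q (X s) (vector_derivative X (at s)) (vector_derivative X (at s)) < (exp (T s) * exp (T s)) * (K * (T' s)\<^sup>2)"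
      using fast[of s] by (intro mult_strict_left_mono) auto
    then show ?thesis unfolding tl[OF cU] lc dl Qc by (simp add: power_mult_distrib power2_eq_square mult_ac)
  qed
  have nolim: False if "filterlim T at_infinity F" "(c \<longlongrightarrow> p) F" "p \<in> U" "F \<noteq> bot" for F p
  proof -
    have "isCont lam p" using smooth_on_continuous[OF smooth_lam] openU that(3) continuous_on_eq_continuous_at by blast
    from isCont_tendsto_compose[OF this that(2)] have "((\<lambda>s. exp (T s)) \<longlongrightarrow> lam p) F" unfolding lc .
    then have "((\<lambda>s. ln (exp (T s))) \<longlongrightarrow> ln (lam p)) F" using lam_pos[OF that(3)] by (intro tendsto_ln) auto
    then show False using not_tendsto_and_filterlim_at_infinity[OF that(4) _ that(1)] by auto
  qed
  have ntop: False if "(c \<longlongrightarrow> p) at_top" "p \<in> U" for p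
  proof (cases "filterlim T at_infinity at_top")
    case True
    then show False using nolim[OF True that] by simp
  next
    case False
    have "isCont pr p" using smooth_on_continuous[OF smooth_pr] openU that(2) continuous_on_eq_continuous_at by blast
    from isCont_tendsto_compose[OF this that(1)] have "(X \<longlongrightarrow> pr p) at_top" unfolding pc .
    then show False using top False pr_in[OF that(2)] by blast
  qed
  have UNIV: "einterval (-\<infinity>) \<infinity> = UNIV" unfolding einterval_def by auto
  have "inextendible_timelike_curve U G (-\<infinity>) \<infinity> c"
    unfolding inextendible_timelike_curve_def UNIV ereal_tendsto_simps1
    using sc cU tim ntop nolim[OF bot] by auto
  then show ?thesis unfolding c_def .
qed

text \<open>\<open>X\<close> is a curve of finite length without limit, \<open>f s\<close> the height of \<open>S\<close> over \<open>X s\<close>, and \<open>A\<close>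
  a bounded-above height function that makes the curve over \<open>X\<close> timelike.  Comparing \<open>f\<close> with timelike
  curves over \<open>X\<close> through two points of \<open>S\<close> shows that \<open>f - A\<close> decreases strictly and
  that \<open>f + A\<close> increases strictly.  Thus \<open>f - A\<close> is bounded below and its infimum is not attained,
  so the curve of height \<open>A\<close> plus this infimum misses \<open>S\<close>.\<close>

lemma cauchy_imp_complete:
  assumes K: "K > 0"
    and tl: "\<And>q v. q \<in> U \<Longrightarrow> G q v v < 0 \<longleftrightarrow> lam q * Q q v v < K * (dlam q v)\<^sup>2"
    and S: "cauchy_hypersurface U G S"
  shows "riemannian_complete H Q"
proof (rule ccontr)
  assume inc: "\<not> riemannian_complete H Q"
  obtain X where X: "smooth_on UNIV X" "range X \<subseteq> H" "\<And>s t. s \<le> 0 \<Longrightarrow> X s = X 0"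
    "\<And>n. integral {0..real n} (speed Q X) \<le> 2" "\<not> (\<exists>q\<in>H. (X \<longlongrightarrow> q) at_top)"
    using gQ.incomplete_imp_divergent_curve[OF inc Q_dist_small] by blast
  have XH: "X s \<in> H" for s using X(2) by auto
  then have XU: "X s \<in> U" for s using H_subset by auto
  have hit: "\<exists>!t. c t \<in> S" if "inextendible_timelike_curve U G (-\<infinity>) \<infinity> c" for c
    using S that unfolding cauchy_hypersurface_def by (force simp: einterval_def)
  have inf1: "filterlim T at_infinity F" if "filterlim T at_top F" for T :: "real \<Rightarrow> real" and F
    using that by (rule filterlim_at_top_imp_at_infinity)
  have inf2: "filterlim T at_infinity F" if "filterlim T at_bot F" for T :: "real \<Rightarrow> real" and F
    using that filterlim_mono[OF _ at_bot_le_at_infinity order_refl] by blast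
  \<comment> \<open>Rays are inextendible timelike curves, so \<open>S\<close> is a graph over \<open>H\<close>.\<close>
  have "\<exists>!t. exp t *\<^sub>R x \<in> S" if x: "x \<in> H" for x
  proof (rule hit, rule warped_curve_inextendible[where G = G and K = K, OF K tl, where T' = "\<lambda>s. 1"])
    show "filterlim (\<lambda>s::real. s) at_infinity at_bot" by (rule inf2) (rule filterlim_ident)
    show "filterlim (\<lambda>s::real. s) at_infinity at_top \<or> \<not> (\<exists>q\<in>H. ((\<lambda>s. x) \<longlongrightarrow> q) at_top)"
      by (rule disjI1, rule inf1, rule filterlim_ident)
    show "Q x (vector_derivative (\<lambda>s. x) (at s)) (vector_derivative (\<lambda>s. x) (at s)) < K * 1\<^sup>2" for s :: real
      using K Q_scale[of x 0 0] x H_subset by (auto simp: vector_derivative_const_at)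
  qed (use x in \<open>auto intro: smooth_on_const smooth_on_id derivative_eq_intros\<close>)
  then have "\<exists>f. \<forall>s. exp (f s) *\<^sub>R X s \<in> S \<and> (\<forall>t. exp t *\<^sub>R X s \<in> S \<longrightarrow> t = f s)"
    using XH by (intro choice) blast
  then obtain f where f: "\<And>s. exp (f s) *\<^sub>R X s \<in> S" "\<And>s t. exp t *\<^sub>R X s \<in> S \<Longrightarrow> t = f s" by blast
  let ?q = "\<lambda>s. Q (X s) (vector_derivative X (at s)) (vector_derivative X (at s))"
  \<comment> \<open>The term \<open>exp (- 2 s)\<close> keeps the root smooth where \<open>X\<close> stops, is integrable at \<open>+\<infinity>\<close>, and is so large at \<open>-\<infinity>\<close> that heights with derivative at least \<open>W\<close> are unbounded there.\<close>
  define W where "W = (\<lambda>s. sqrt (?q s * inverse K + exp (- s) * exp (- s)))"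
  have q0: "?q s \<ge> 0" for s by (rule Q_nonneg[OF XU])
  have inside: "?q s * inverse K + exp (- s) * exp (- s) > 0" for s
    using q0[of s] K by (intro add_nonneg_pos mult_nonneg_nonneg) auto
  have sW: "smooth_on UNIV W" unfolding W_def
  proof (intro smooth_on_sqrt inside open_UNIV smooth_on_add smooth_on_mult smooth_on_const smooth_on_exp smooth_on_minus smooth_on_id)
    show "smooth_on UNIV ?q" by (rule smooth_Q_curve[OF open_UNIV X(1)]) (use XU in auto)
  qed
  have Wpos: "W s > 0" for s unfolding W_def using inside by simp
  have Wq: "?q s < K * (W s)\<^sup>2" for s
  proof -
    have "(W s)\<^sup>2 = ?q s * inverse K + exp (- s) * exp (- s)" unfolding W_def using inside[of s] by simp
    then have "K * (W s)\<^sup>2 = ?q s + K * (exp (- s) * exp (- s))" using K by (simp add: distrib_left)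
    then show ?thesis using K by simp
  qed
  have We: "exp (- s) \<le> W s" for s
    unfolding W_def using q0[of s] K by (intro real_le_rsqrt) (simp add: power2_eq_square)
  have Wle: "W s \<le> inverse (sqrt K) * speed Q X s + exp (- s)" for s
  proof -
    have "?q s * inverse K + exp (- s) * exp (- s) = (inverse (sqrt K) * speed Q X s)\<^sup>2 + (exp (- s))\<^sup>2"
      unfolding speed_def using q0[of s] K by (simp add: power_mult_distrib power_inverse power2_eq_square[of "exp (-s)"])
    then show ?thesis unfolding W_def
      using sqrt_sum_squares_le_sum[of "inverse (sqrt K) * speed Q X s" "exp (- s)"] gQ.speed_nonneg[of X s] XU K by simp
  qed
  \<comment> \<open>A primitive of \<open>W\<close>: bounded above by the finite length of \<open>X\<close>, tending to \<open>-\<infinity>\<close> at \<open>-\<infinity>\<close>.\<close>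
  obtain A where A: "\<And>s. (A has_vector_derivative W s) (at s)"
    using einterval_antiderivative[of "-\<infinity>" \<infinity> W] smooth_on_continuous[OF sW] by (auto simp: continuous_on_eq_continuous_at)
  have Ad: "(A has_real_derivative W s) (at s)" for s using A[of s] by (simp add: has_real_derivative_iff_has_vector_derivative)
  have sA: "smooth_on UNIV A" by (rule smooth_onI_vector_derivative[OF open_UNIV A sW])
  have Amono: "A s \<le> A t" if "s \<le> t" for s t
    using DERIV_nonneg_imp_nondecreasing[OF that, of A] Ad Wpos less_imp_le by blast
  have Abot: "A s \<le> A 0 + s" if "s \<le> 0" for s
  proof -
    have "(\<lambda>s. A s - s) s \<le> (\<lambda>s. A s - s) 0"
    proof (rule DERIV_nonneg_imp_nondecreasing[OF that])
      fix x :: real assume "s \<le> x" "x \<le> 0"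
      then have "1 \<le> W x" using We[of x] by (smt (verit) one_le_exp_iff)
      then show "\<exists>y. ((\<lambda>s. A s - s) has_real_derivative y) (at x) \<and> 0 \<le> y"
        by (intro exI[of _ "W x - 1"]) (auto intro!: derivative_eq_intros Ad)
    qed
    then show ?thesis by simp
  qed
  define A1 where "A1 = A 0 + (inverse (sqrt K) * 2 + 1)"
  have Atop: "A s \<le> A1" for s
  proof -
    obtain n :: nat where n: "s \<le> real n" using real_arch_simple by blast
    have cs: "continuous_on {0..real n} (speed Q X)"
      by (rule gQ.continuous_on_speed[OF open_UNIV X(1)]) (use XU in auto)
    have "(W has_integral (A (real n) - A 0)) {0..real n}"
      by (rule fundamental_theorem_of_calculus) (auto intro: has_vector_derivative_at_within A)
    moreover have "((\<lambda>s. exp (- s)) has_integral ((- exp (- real n)) - (- exp (- 0)))) {0..real n}"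
      by (rule fundamental_theorem_of_calculus)
        (auto intro!: derivative_eq_intros simp: has_real_derivative_iff_has_vector_derivative[symmetric])
    then have "((\<lambda>s. inverse (sqrt K) * speed Q X s + exp (- s)) has_integral
        (inverse (sqrt K) * integral {0..real n} (speed Q X) + ((- exp (- real n)) - (- exp (- 0))))) {0..real n}"
      by (intro has_integral_add has_integral_mult_right integrable_integral integrable_continuous_interval cs)
    ultimately have "A (real n) - A 0 \<le> inverse (sqrt K) * integral {0..real n} (speed Q X) + ((- exp (- real n)) - (- exp (- 0)))"
      using has_integral_le Wle by blast
    moreover have "inverse (sqrt K) * integral {0..real n} (speed Q X) \<le> inverse (sqrt K) * 2"
      using X(4)[of n] K by (intro mult_left_mono) auto
    moreover have "(- exp (- real n)) - (- exp (- 0)) \<le> (1::real)" by simp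
    ultimately have "A (real n) \<le> A1" unfolding A1_def by linarith
    then show ?thesis using Amono[OF n] by simp
  qed
  \<comment> \<open>Every height function that changes at least at the rate \<open>W\<close> meets the graph of \<open>f\<close> exactly once.\<close>
  have once: "\<exists>!s. T s = f s"
    if T: "smooth_on UNIV T" "\<And>s. (T has_real_derivative T' s) (at s)" and big: "\<And>s. W s \<le> \<bar>T' s\<bar>"
      and bot: "filterlim T at_infinity at_bot" for T T'
  proof -
    have "?q s < K * (T' s)\<^sup>2" for s
    proof -
      have "(W s)\<^sup>2 \<le> \<bar>T' s\<bar>\<^sup>2" using big[of s] Wpos[of s] by (intro power_mono) auto
      then have "K * (W s)\<^sup>2 \<le> K * (T' s)\<^sup>2" using K by simp
      then show ?thesis using Wq[of s] by linarith
    qed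
    from hit[OF warped_curve_inextendible[where G = G and K = K, OF K tl X(1,2) T this bot]] X(5)
    have "\<exists>!s. exp (T s) *\<^sub>R X s \<in> S" by blast
    then show ?thesis using f by metis
  qed
  have fB: "filterlim (\<lambda>s. a + B s) at_bot at_bot" if B: "\<And>s. s \<le> 0 \<Longrightarrow> B s \<le> b + s" for a b :: real and B :: "real \<Rightarrow> real"
    unfolding filterlim_at_bot eventually_at_bot_linorder
  proof
    fix Z
    have "a + B s \<le> Z" if "s \<le> min 0 (Z - a - b)" for s using B[of s] that by linarith
    then show "\<exists>N. \<forall>s\<le>N. a + B s \<le> Z" by blast
  qed
  have lip: "\<epsilon> * (f s2 - f s1) < A s2 - A s1" if s: "s1 < s2" and \<epsilon>: "\<epsilon> = 1 \<or> \<epsilon> = -1" for s1 s2 \<epsilon>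
  proof (rule ccontr)
    assume "\<not> \<epsilon> * (f s2 - f s1) < A s2 - A s1"
    then have ge: "\<epsilon> * (f s2 - f s1) - (A s2 - A s1) \<ge> 0" by simp
    \<comment> \<open>Otherwise the extra slope \<open>\<delta>\<close> makes a timelike curve pass through both points of \<open>S\<close>.\<close>
    define \<delta> where "\<delta> = (\<epsilon> * (f s2 - f s1) - (A s2 - A s1)) / (s2 - s1)"
    have \<delta>: "\<delta> \<ge> 0" "\<delta> * (s2 - s1) = \<epsilon> * (f s2 - f s1) - (A s2 - A s1)" using ge s by (auto simp: \<delta>_def)
    define B where "B = (\<lambda>s. A s - A s1 + \<delta> * (s - s1))"
    define T where "T = (\<lambda>s. f s1 + \<epsilon> * B s)"
    have Bbot: "B s \<le> (A 0 - A s1 - \<delta> * s1) + s" if "s \<le> 0" for s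
      using Abot[OF that] \<delta>(1) mult_nonneg_nonpos[OF \<delta>(1) that] unfolding B_def by (simp add: right_diff_distrib)
    have bd: "filterlim (\<lambda>s. a + B s) at_bot at_bot" for a by (rule fB[OF Bbot])
    have "\<exists>!s. T s = f s"
    proof (rule once)
      show "smooth_on UNIV T" unfolding T_def B_def
        by (intro smooth_on_add smooth_on_mult smooth_on_diff smooth_on_const smooth_on_id sA open_UNIV)
      show "(T has_real_derivative \<epsilon> * (W s + \<delta>)) (at s)" for s
        unfolding T_def B_def by (auto intro!: derivative_eq_intros Ad)
      show "W s \<le> \<bar>\<epsilon> * (W s + \<delta>)\<bar>" for s using \<epsilon> \<delta>(1) Wpos[of s] by auto
      show "filterlim T at_infinity at_bot"
      proof (cases "\<epsilon> = 1")
        case True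
        then show ?thesis unfolding T_def using inf2[OF bd[of "f s1"]] by simp
      next
        case False
        then have "T = (\<lambda>s. - (- f s1 + B s))" using \<epsilon> unfolding T_def by auto
        then show ?thesis using inf1 bd[of "- f s1"] by (simp only: filterlim_uminus_at_top minus_minus)
      qed
    qed
    moreover have "T s1 = f s1" unfolding T_def B_def by simp
    moreover have "T s2 = f s2" unfolding T_def B_def \<delta>(2) using \<epsilon> by auto
    ultimately show False using s by (metis less_irrefl)
  qed
  define D where "D = (\<lambda>s. f s - A s)"
  have Ddec: "D t < D s" if "s < t" for s t using lip[OF that, of 1] unfolding D_def by simp
  have Dlow: "min (D 0) (f 0 + A 0 - 2 * A1) \<le> D s" for s
  proof (cases "s \<le> 0")
    case True
    then show ?thesis using Ddec[of s 0] by (cases "s = 0") auto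
  next
    case False
    then show ?thesis using lip[of 0 s "-1"] Atop[of s] unfolding D_def by simp
  qed
  define m where "m = Inf (range D)"
  have mD: "m \<le> D s" for s
    unfolding m_def by (rule cInf_lower) (use Dlow in \<open>auto intro!: bdd_belowI\<close>)
  have "\<exists>!s. (\<lambda>s. m + A s) s = f s"
  proof (rule once)
    show "smooth_on UNIV (\<lambda>s. m + A s)" by (intro smooth_on_add smooth_on_const sA open_UNIV)
    show "((\<lambda>s. m + A s) has_real_derivative W s) (at s)" for s by (auto intro!: derivative_eq_intros Ad)
    show "W s \<le> \<bar>W s\<bar>" for s by simp
    show "filterlim (\<lambda>s. m + A s) at_infinity at_bot" by (rule inf2, rule fB[OF Abot])
  qed
  then obtain s where "m + A s = f s" by blast
  then show False using mD[of "s + 1"] Ddec[of s "s + 1"] unfolding D_def by simp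
qed

end

section \<open>The radial function of a centroaffine hypersurface is smooth\<close>

text \<open>If \<open>e \<bullet> D\<phi>(p)\<close> vanished on \<open>p\<close>, pulling back a straight line in the slice with direction
  \<open>D\<phi>(p) p\<close> would give a curve in \<open>H\<close> with velocity \<open>p\<close>, against centroaffinity.\<close>

lemma hypersurface_transversal:
  fixes \<phi> \<psi> :: "'a::euclidean_space \<Rightarrow> 'a"
  assumes V: "open V" "open W" "homeomorphism V W \<phi> \<psi>" "smooth_on V \<phi>" "smooth_on W \<psi>"
    and im: "\<phi> ` (V \<inter> H) = W \<inter> {y. e \<bullet> y = 0}"
    and ca: "centroaffine H" and p: "p \<in> V" "p \<in> H"
  shows "e \<bullet> frechet_derivative \<phi> (at p) p \<noteq> 0"
proof
  assume z: "e \<bullet> frechet_derivative \<phi> (at p) p = 0"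
  define w where "w = frechet_derivative \<phi> (at p) p"
  have fp: "\<phi> p \<in> W" "e \<bullet> \<phi> p = 0" using im p by auto
  define \<gamma> where "\<gamma> = (\<lambda>s::real. \<psi> (\<phi> p + s *\<^sub>R w))"
  let ?L = "\<lambda>s::real. \<phi> p + s *\<^sub>R w"
  have "open (?L -` W)" using V(2) by (intro open_vimage continuous_intros)
  moreover have "0 \<in> ?L -` W" using fp by simp
  ultimately obtain d where d: "d > 0" "ball 0 d \<subseteq> ?L -` W" using open_contains_ball by blast
  have inW: "?L s \<in> W" if "s \<in> {-d<..<d}" for s using d(2) that by (auto simp: subset_iff dist_real_def)
  have sL: "smooth_on {-d<..<d} ?L" by (intro smooth_on_add smooth_on_scaleR smooth_on_const smooth_on_id) auto
  have "smooth_on {-d<..<d} \<gamma>" unfolding \<gamma>_def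
    by (rule smooth_on_compose[OF _ V(2) sL V(5)]) (use inW in auto)
  moreover have "\<gamma> ` {-d<..<d} \<subseteq> H"
  proof safe
    fix s assume "s \<in> {-d<..<d}"
    then have "?L s \<in> W \<inter> {y. e \<bullet> y = 0}" using inW fp z by (simp add: inner_add_right w_def)
    then obtain q where q: "q \<in> V \<inter> H" "?L s = \<phi> q" using im by (metis imageE)
    then show "\<gamma> s \<in> H" unfolding \<gamma>_def using V(3) by (simp add: homeomorphism_def)
  qed
  moreover have "\<gamma> 0 = p" unfolding \<gamma>_def using V(3) p by (simp add: homeomorphism_def)
  moreover have "(\<gamma> has_vector_derivative p) (at 0)"
  proof -
    have D: "(\<psi> has_derivative frechet_derivative \<psi> (at (\<phi> p))) (at (\<phi> p))" by (rule smooth_onD[OF V(5) fp(1)])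
    have "((\<lambda>q. \<psi> (\<phi> q)) has_derivative (\<lambda>v. frechet_derivative \<psi> (at (\<phi> p)) (frechet_derivative \<phi> (at p) v))) (at p)"
      by (rule has_derivative_compose[OF smooth_onD[OF V(4) p(1)] D])
    moreover have "((\<lambda>q. \<psi> (\<phi> q)) has_derivative (\<lambda>v. v)) (at p)"
      by (rule has_derivative_transform_within_open[OF has_derivative_ident V(1) p(1)])
         (use V(3) in \<open>auto simp: homeomorphism_def\<close>)
    ultimately have "(\<lambda>v. frechet_derivative \<psi> (at (\<phi> p)) (frechet_derivative \<phi> (at p) v)) = (\<lambda>v. v)"
      by (rule has_derivative_unique)
    then have "frechet_derivative \<psi> (at (\<phi> p)) w = p" unfolding w_def by metis
    moreover have "((\<lambda>s. \<psi> (?L s)) has_vector_derivative frechet_derivative \<psi> (at (\<phi> p)) w) (at 0)"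
      by (rule curve_chain_rule[OF _ line_has_vector_derivative]) (use D in simp)
    ultimately show ?thesis unfolding \<gamma>_def by simp
  qed
  ultimately have "p \<in> tangent_space H p" unfolding tangent_space_def using d(1) by blast
  then show False using ca p unfolding centroaffine_def by blast
qed

text \<open>The inverse function theorem for \<open>(q, s) \<mapsto> (q, u (s q))\<close> provides a differentiable solution \<open>s\<close>
  of \<open>u (s(q) q) = 0\<close>.  Its derivative is a smooth expression in \<open>s\<close> itself and the
  derivatives of \<open>u\<close>, so differentiability bootstraps to all orders.\<close>

lemma radial_implicit_function:
  fixes u :: "'a::euclidean_space \<Rightarrow> real"
  assumes V: "open V" "smooth_on V u" and p: "p \<in> V" "u p = 0"
    and tr: "\<And>q. q \<in> V \<Longrightarrow> u q = 0 \<Longrightarrow> frechet_derivative u (at q) q \<noteq> 0"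
  obtains N s where "open N" "p \<in> N" "smooth_on N s"
    "\<And>q. q \<in> N \<Longrightarrow> s q > 0 \<and> s q *\<^sub>R q \<in> V \<and> u (s q *\<^sub>R q) = 0"
proof -
  let ?du = "\<lambda>y. frechet_derivative u (at y)"
  have du: "(u has_derivative ?du y) (at y)" if "y \<in> V" for y using smooth_onD[OF V(2) that] .
  define \<Omega> where "\<Omega> = (\<lambda>z::'a \<times> real. snd z *\<^sub>R fst z) -` V"
  have o\<Omega>: "open \<Omega>" unfolding \<Omega>_def using V(1) by (intro open_vimage continuous_intros)
  define F where "F = (\<lambda>z::'a \<times> real. (fst z, u (snd z *\<^sub>R fst z)))"
  define F' where "F' = (\<lambda>z d. (fst d, ?du (snd z *\<^sub>R fst z) (snd z *\<^sub>R fst d + snd d *\<^sub>R fst z)) :: 'a \<times> real)"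
  have FD: "(F has_derivative F' z) (at z)" if "z \<in> \<Omega>" for z
  proof -
    have "snd z *\<^sub>R fst z \<in> V" using that unfolding \<Omega>_def by simp
    note d = du[OF this]
    have "((\<lambda>z. snd z *\<^sub>R fst z) has_derivative (\<lambda>d. snd z *\<^sub>R fst d + snd d *\<^sub>R fst z)) (at z)"
      by (auto intro!: derivative_eq_intros)
    from has_derivative_compose[OF this d]
    have "((\<lambda>z. u (snd z *\<^sub>R fst z)) has_derivative (\<lambda>d. ?du (snd z *\<^sub>R fst z) (snd z *\<^sub>R fst d + snd d *\<^sub>R fst z))) (at z)" .
    then show ?thesis unfolding F_def F'_def by (intro derivative_intros)
  qed
  define B where "B = (\<lambda>z. Blinfun (F' z))"
  have BF: "blinfun_apply (B z) = F' z" if "z \<in> \<Omega>" for z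
    unfolding B_def by (rule bounded_linear_Blinfun_apply[OF has_derivative_bounded_linear[OF FD[OF that]]])
  have cB: "continuous_on \<Omega> B"
  proof (rule continuous_on_blinfun_componentwise)
    fix i :: "'a \<times> real"
    have "continuous_on \<Omega> (\<lambda>z. F' z i)" unfolding F'_def
    proof (intro continuous_intros)
      have "continuous_on \<Omega> (\<lambda>z. (snd z *\<^sub>R fst z, snd z *\<^sub>R fst i + snd i *\<^sub>R fst z))"
        by (intro continuous_intros)
      from continuous_on_compose2[OF continuous_on_frechet[OF V(2)] this]
      show "continuous_on \<Omega> (\<lambda>z. ?du (snd z *\<^sub>R fst z) (snd z *\<^sub>R fst i + snd i *\<^sub>R fst z))"
        unfolding \<Omega>_def by auto
    qed
    then show "continuous_on \<Omega> (\<lambda>z. blinfun_apply (B z) i)"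
      by (rule continuous_on_cong[THEN iffD1, rotated -1]) (auto simp: BF)
  qed
  have p1: "(p, 1) \<in> \<Omega>" unfolding \<Omega>_def using p by simp
  define \<alpha> where "\<alpha> = ?du p p"
  have \<alpha>: "\<alpha> \<noteq> 0" using tr p unfolding \<alpha>_def by auto
  \<comment> \<open>The inverse of the derivative of \<open>F\<close> at \<open>(p, 1)\<close>.\<close>
  define J where "J = (\<lambda>d::'a \<times> real. (fst d, (snd d - ?du p (fst d)) * inverse \<alpha>))"
  have blp: "bounded_linear (?du p)" by (rule has_derivative_bounded_linear[OF du[OF p(1)]])
  have blJ: "bounded_linear J" unfolding J_def
    by (intro bounded_linear_intros bounded_linear_compose[OF blp])
  have inv: "Blinfun J o\<^sub>L B (p, 1) = id_blinfun"
  proof (rule blinfun_eqI)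
    fix d :: "'a \<times> real"
    show "blinfun_apply (Blinfun J o\<^sub>L B (p, 1)) d = blinfun_apply id_blinfun d"
      unfolding blinfun_apply_blinfun_compose bounded_linear_Blinfun_apply[OF blJ] BF[OF p1]
      using \<alpha> bounded_linear.linear[OF blp]
      by (simp add: F'_def J_def linear_add linear_scale \<alpha>_def[symmetric] prod_eq_iff)
  qed
  obtain U' V' g g' where ift: "open U'" "U' \<subseteq> \<Omega>" "(p, 1) \<in> U'" "open V'" "F (p, 1) \<in> V'" "homeomorphism U' V' F g"
    "\<And>y. y \<in> V' \<Longrightarrow> (g has_derivative g' y) (at y)"
    using inverse_function_theorem[OF o\<Omega> _ cB p1 inv, of F] FD BF by metis
  define s where "s = (\<lambda>q. snd (g (q, 0)))"
  define N0 where "N0 = (\<lambda>q::'a. (q, 0::real)) -` V'"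
  have oN0: "open N0" unfolding N0_def using ift(4) by (intro open_vimage continuous_intros)
  have gs: "g (q, 0) = (q, s q)" "s q *\<^sub>R q \<in> V" "u (s q *\<^sub>R q) = 0" if "q \<in> N0" for q
  proof -
    have "(q, 0) \<in> V'" using that unfolding N0_def by simp
    then have "g (q, 0) \<in> U'" "F (g (q, 0)) = (q, 0)" using ift(6) unfolding homeomorphism_def by auto
    then have "fst (g (q, 0)) = q" "u (snd (g (q, 0)) *\<^sub>R fst (g (q, 0))) = 0" "snd (g (q, 0)) *\<^sub>R fst (g (q, 0)) \<in> V"
      using ift(2) unfolding F_def \<Omega>_def by auto
    then show "g (q, 0) = (q, s q)" "s q *\<^sub>R q \<in> V" "u (s q *\<^sub>R q) = 0" unfolding s_def by (auto simp: prod_eq_iff)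
  qed
  have sd: "\<exists>s'. (s has_derivative s') (at q)" if "q \<in> N0" for q
  proof -
    have "(q, 0) \<in> V'" using that unfolding N0_def by simp
    have "((\<lambda>q. (q, 0::real)) has_derivative (\<lambda>v. (v, 0))) (at q)" by (auto intro!: derivative_eq_intros)
    from has_derivative_compose[OF this ift(7)[OF \<open>(q, 0) \<in> V'\<close>]]
    have "((\<lambda>q. g (q, 0)) has_derivative (\<lambda>v. g' (q, 0) (v, 0))) (at q)" .
    then show ?thesis unfolding s_def using has_derivative_snd by blast
  qed
  have cs: "continuous_on N0 s"
  proof (rule continuous_at_imp_continuous_on, rule ballI)
    fix q assume "q \<in> N0"
    then show "isCont s q" using sd has_derivative_continuous by blast
  qed
  define N where "N = N0 \<inter> s -` {0<..}"
  have oN: "open N" unfolding N_def by (rule continuous_open_preimage[OF cs oN0]) simp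
  have Fp: "F (p, 1) = (p, 0)" using p by (simp add: F_def)
  have pN0: "p \<in> N0" using ift(5) unfolding Fp N0_def by simp
  have "g (F (p, 1)) = (p, 1)" using ift(3,6) unfolding homeomorphism_def by auto
  then have "s p = 1" unfolding Fp s_def by simp
  then have pN: "p \<in> N" using pN0 unfolding N_def by simp
  have NN: "q \<in> N0" "s q > 0" if "q \<in> N" for q using that unfolding N_def by auto
  have ne: "?du (s q *\<^sub>R q) q \<noteq> 0" if "q \<in> N" for q
  proof -
    note q0 = NN(1)[OF that]
    have "?du (s q *\<^sub>R q) (s q *\<^sub>R q) \<noteq> 0" using tr gs(2,3)[OF q0] by auto
    then show ?thesis using linear_scale[OF has_derivative_linear[OF du[OF gs(2)[OF q0]]], of "s q" q] by auto
  qed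
  have sD: "(s has_derivative (\<lambda>v. - (s q * ?du (s q *\<^sub>R q) v) * inverse (?du (s q *\<^sub>R q) q))) (at q)" if qN: "q \<in> N" for q
  proof -
    note q0 = NN(1)[OF qN]
    obtain s' where s': "(s has_derivative s') (at q)" using sd[OF q0] by blast
    note l = has_derivative_linear[OF du[OF gs(2)[OF q0]]]
    have "((\<lambda>q. s q *\<^sub>R q) has_derivative (\<lambda>v. s q *\<^sub>R v + s' v *\<^sub>R q)) (at q)"
      by (auto intro!: derivative_eq_intros s')
    from has_derivative_compose[OF this du[OF gs(2)[OF q0]]]
    have 1: "((\<lambda>q. u (s q *\<^sub>R q)) has_derivative (\<lambda>v. ?du (s q *\<^sub>R q) (s q *\<^sub>R v + s' v *\<^sub>R q))) (at q)" .
    have 2: "((\<lambda>q. u (s q *\<^sub>R q)) has_derivative (\<lambda>v. 0)) (at q)"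
      by (rule has_derivative_transform_within_open[OF has_derivative_const oN0 q0]) (use gs(3) in auto)
    have "?du (s q *\<^sub>R q) (s q *\<^sub>R v + s' v *\<^sub>R q) = 0" for v
      using has_derivative_unique[OF 1 2] by metis
    then have "s q * ?du (s q *\<^sub>R q) v + s' v * ?du (s q *\<^sub>R q) q = 0" for v
      by (simp add: linear_add[OF l] linear_scale[OF l])
    then have "s' v = - (s q * ?du (s q *\<^sub>R q) v) * inverse (?du (s q *\<^sub>R q) q)" for v
      using ne[OF qN] by (simp add: field_simps eq_neg_iff_add_eq_0)
    then have "s' = (\<lambda>v. - (s q * ?du (s q *\<^sub>R q) v) * inverse (?du (s q *\<^sub>R q) q))" by (rule ext)
    then show ?thesis using s' by simp
  qed
  have "Ck_on N s m" for m
  proof (induction m)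
    case 0
    then show ?case using cs continuous_on_subset[of N0 s N] unfolding N_def by auto
  next
    case (Suc m)
    show ?case
    proof (rule Ck_on_SucI[OF oN sD])
      fix v
      have y: "Ck_on N (\<lambda>q. s q *\<^sub>R q) m"
        using Ck_on_bounded_bilinear[OF bounded_bilinear_scaleR oN Suc smooth_on_id[OF oN, unfolded smooth_on_def, rule_format]] .
      have yV: "(\<lambda>q. s q *\<^sub>R q) ` N \<subseteq> V" using gs(2) NN(1) by auto
      have D: "Ck_on N (\<lambda>q. ?du (s q *\<^sub>R q) w) m" for w
        by (rule Ck_on_compose[OF oN V(1) y smooth_on_frechet[OF V(2), unfolded smooth_on_def, rule_format] yV])
      have "Ck_on N (\<lambda>q. \<Sum>b\<in>Basis. (q \<bullet> b) * ?du (s q *\<^sub>R q) b) m"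
        by (intro Ck_on_sum oN Ck_on_bounded_bilinear[OF bounded_bilinear_mult oN _ D]
            Ck_on_bounded_linear[OF oN bounded_linear_inner_left])
      then have Dq: "Ck_on N (\<lambda>q. ?du (s q *\<^sub>R q) q) m"
      proof (rule Ck_on_cong[OF oN, rotated])
        fix q assume "q \<in> N"
        then have l: "linear (?du (s q *\<^sub>R q))" using has_derivative_linear[OF du[OF gs(2)]] NN by blast
        show "(\<Sum>b\<in>Basis. (q \<bullet> b) * ?du (s q *\<^sub>R q) b) = ?du (s q *\<^sub>R q) q"
          using linear_basis_expansion[OF l, of q] by simp
      qed
      have "smooth_on (- {0::real}) (\<lambda>x. inverse x)"
        by (rule smooth_on_inverse_ne0) (auto intro: smooth_on_id)
      then have ci: "Ck_on (- {0::real}) (\<lambda>x. inverse x) m" unfolding smooth_on_def by blast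
      have Di: "Ck_on N (\<lambda>q. inverse (?du (s q *\<^sub>R q) q)) m"
        by (rule Ck_on_compose[OF oN _ Dq ci]) (use ne in auto)
      have "Ck_on N (\<lambda>q. (-1) * ((s q * ?du (s q *\<^sub>R q) v) * inverse (?du (s q *\<^sub>R q) q))) m"
        by (intro Ck_on_bounded_bilinear[OF bounded_bilinear_mult oN] Ck_on_const oN Suc D Di)
      then show "Ck_on N (\<lambda>q. - (s q * ?du (s q *\<^sub>R q) v) * inverse (?du (s q *\<^sub>R q) q)) m" by simp
    qed
  qed
  then have "smooth_on N s" unfolding smooth_on_def by blast
  then show ?thesis using that[OF oN pN] gs(2,3) NN by blast
qed

lemma hypersurface_radial:
  fixes H :: "'a::euclidean_space set"
  assumes sh: "smooth_hypersurface H" and ca: "centroaffine H" and p: "p \<in> H"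
  obtains N s where "open N" "p \<in> N" "smooth_on N s" "\<And>q. q \<in> N \<Longrightarrow> s q > 0 \<and> s q *\<^sub>R q \<in> H"
proof -
  obtain V W :: "'a set" and \<phi> \<psi> :: "'a \<Rightarrow> 'a" and e :: 'a where "open V \<and> p \<in> V \<and> open W \<and> homeomorphism V W \<phi> \<psi> \<and> smooth_on V \<phi> \<and> smooth_on W \<psi> \<and>
    e \<noteq> 0 \<and> \<phi> ` (V \<inter> H) = W \<inter> {y. e \<bullet> y = 0}"
    using bspec[OF sh[unfolded smooth_hypersurface_def] p] by (elim exE) (rule that, assumption)
  then have c: "open V" "p \<in> V" "open W" "homeomorphism V W \<phi> \<psi>" "smooth_on V \<phi>" "smooth_on W \<psi>"
    "\<phi> ` (V \<inter> H) = W \<inter> {y. e \<bullet> y = 0}" by simp_all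
  define u where "u = (\<lambda>q. e \<bullet> \<phi> q)"
  have su: "smooth_on V u" unfolding u_def by (intro smooth_on_inner smooth_on_const c)
  have uH: "u q = 0 \<longleftrightarrow> q \<in> H" if q: "q \<in> V" for q
  proof
    assume "q \<in> H" then show "u q = 0" using c(7) q unfolding u_def by auto
  next
    assume "u q = 0"
    then have "\<phi> q \<in> W \<inter> {y. e \<bullet> y = 0}" using q c(4) unfolding u_def homeomorphism_def by auto
    then obtain q' where q': "q' \<in> V \<inter> H" "\<phi> q = \<phi> q'" using c(7) by (metis imageE)
    then have "q = q'" using q c(4) unfolding homeomorphism_def by (metis IntD1)
    then show "q \<in> H" using q' by auto
  qed
  have tr: "frechet_derivative u (at q) q \<noteq> 0" if q: "q \<in> V" "u q = 0" for q
  proof -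
    have "(u has_derivative (\<lambda>v. e \<bullet> frechet_derivative \<phi> (at q) v)) (at q)"
      unfolding u_def by (auto intro!: derivative_eq_intros smooth_onD[OF c(5) q(1)])
    then have "frechet_derivative u (at q) = (\<lambda>v. e \<bullet> frechet_derivative \<phi> (at q) v)"
      using frechet_derivative_at by metis
    then show ?thesis using hypersurface_transversal[OF c(1,3,4,5,6,7) ca q(1)] uH[OF q(1)] q(2) by simp
  qed
  have "u p = 0" using uH[OF c(2)] p by simp
  from radial_implicit_function[OF c(1) su c(2) this tr]
  obtain N s where N: "open N" "p \<in> N" "smooth_on N s" "\<And>q. q \<in> N \<Longrightarrow> s q > 0 \<and> s q *\<^sub>R q \<in> V \<and> u (s q *\<^sub>R q) = 0"
    by blast
  then show ?thesis using that[OF N(1-3)] uH by blast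
qed

section \<open>The Lorentzian metric\<close>

text \<open>Gram--Schmidt for a form that is positive definite on \<open>W\<close> only.\<close>

lemma orthonormal_family:
  fixes B :: "'a::euclidean_space \<Rightarrow> 'a \<Rightarrow> real"
  assumes B: "bilinear B" "\<And>u v. B u v = B v u" and W: "subspace W"
    and pos: "\<And>v. v \<in> W \<Longrightarrow> v \<noteq> 0 \<Longrightarrow> B v v > 0"
  shows "m \<le> dim W \<Longrightarrow> \<exists>c::nat \<Rightarrow> 'a. (\<forall>i<m. c i \<in> W) \<and> (\<forall>i<m. \<forall>j<m. B (c i) (c j) = (if i = j then 1 else 0))"
proof (induction m)
  case (Suc m)
  then obtain c where c: "\<And>i. i < m \<Longrightarrow> c i \<in> W" "\<And>i j. i < m \<Longrightarrow> j < m \<Longrightarrow> B (c i) (c j) = (if i = j then 1 else 0)"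
    by auto
  have "\<not> W \<subseteq> span (c ` {..<m})"
  proof
    assume "W \<subseteq> span (c ` {..<m})"
    then have "dim W \<le> card (c ` {..<m})" by (intro dim_le_card) auto
    also have "\<dots> \<le> m" using card_image_le[of "{..<m}" c] by simp
    finally show False using Suc.prems by simp
  qed
  then obtain w where w: "w \<in> W" "w \<notin> span (c ` {..<m})" by blast
  \<comment> \<open>The component of \<open>w\<close> orthogonal to the family found so far.\<close>
  define z where "z = w - (\<Sum>i<m. B w (c i) *\<^sub>R c i)"
  have zW: "z \<in> W" unfolding z_def
    by (intro subspace_diff[OF W] w subspace_sum[OF W] subspace_scale[OF W] c(1)) auto
  have "(\<Sum>i<m. B w (c i) *\<^sub>R c i) \<in> span (c ` {..<m})"
    by (intro span_sum span_scale span_base) auto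
  then have z0: "z \<noteq> 0" using w(2) unfolding z_def by auto
  have lin: "linear (\<lambda>u. B u v)" for v using B(1) unfolding bilinear_def by blast
  have zc: "B z (c j) = 0" if "j < m" for j
  proof -
    have "B z (c j) = B w (c j) - (\<Sum>i<m. B w (c i) * B (c i) (c j))"
      unfolding z_def using linear_sum[OF lin[of "c j"], of "\<lambda>i. B w (c i) *\<^sub>R c i" "{..<m}"]
      by (simp add: linear_diff[OF lin] linear_scale[OF lin])
    also have "(\<Sum>i<m. B w (c i) * B (c i) (c j)) = (\<Sum>i<m. if i = j then B w (c j) else 0)"
      using c(2) that by (intro sum.cong) auto
    finally show ?thesis using that by simp
  qed
  define a where "a = inverse (sqrt (B z z))"
  have Bz: "B z z > 0" by (rule pos[OF zW z0])
  have a: "a * (a * B z z) = 1"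
    using Bz unfolding a_def by (simp flip: real_sqrt_inverse) (simp add: field_simps flip: real_sqrt_mult)
  define d where "d = c(m := a *\<^sub>R z)"
  have "\<forall>i<Suc m. d i \<in> W" using c(1) subspace_scale[OF W zW] by (auto simp: d_def less_Suc_eq)
  moreover have "B (d i) (d j) = (if i = j then 1 else 0)" if ij: "i < Suc m" "j < Suc m" for i j
  proof -
    consider "i < m" "j < m" | "i = m" "j < m" | "i < m" "j = m" | "i = m" "j = m" using ij by linarith
    then show ?thesis
    proof cases
      case 1 then show ?thesis using c(2) by (simp add: d_def)
    next
      case 2 then show ?thesis using zc by (simp add: d_def bilinear_lmul[OF B(1)])
    next
      case 3 then show ?thesis using zc B(2)[of "c i" z] by (simp add: d_def bilinear_rmul[OF B(1)])
    next
      case 4 then show ?thesis using a by (simp add: d_def bilinear_lmul[OF B(1)] bilinear_rmul[OF B(1)])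
    qed
  qed
  ultimately show ?case by blast
qed simp

context hyperbolic_radial
begin

text \<open>The position vector is timelike and orthogonal to the hyperplane \<open>ker dlam\<close>, on which the form
  is positive definite; an orthonormal basis of the hyperplane completes it to a frame.\<close>

lemma lorentz_frame:
  fixes B :: "'a \<Rightarrow> 'a \<Rightarrow> real"
  assumes q: "q \<in> U" and B: "bilinear B" "\<And>u v. B u v = B v u"
    and pos: "\<And>v. dlam q v = 0 \<Longrightarrow> v \<noteq> 0 \<Longrightarrow> B v v > 0"
    and neg: "B q q < 0" and orth: "\<And>v. dlam q v = 0 \<Longrightarrow> B q v = 0"
  shows "\<exists>b. \<exists>i\<^sub>0\<in>Basis. \<forall>i\<in>Basis. \<forall>j\<in>Basis.
           B (b i) (b j) = (if i \<noteq> j then 0 else if i = (i\<^sub>0::'a) then -1 else 1)"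
proof -
  note l = dlam_linear[OF q]
  define a where "a = (\<Sum>b\<in>Basis. dlam q b *\<^sub>R b)"
  have da: "dlam q v = a \<bullet> v" for v
    using linear_basis_expansion[OF l, of v] by (simp add: a_def inner_sum_left inner_commute[of v] mult.commute)
  have "a \<noteq> 0" using dlam_self[OF q] lam_pos[OF q] da[of q] by auto
  then have dimW: "dim {v. dlam q v = 0} = DIM('a) - 1" unfolding da by (rule dim_hyperplane)
  have W: "subspace {v. dlam q v = 0}"
    by (auto simp: subspace_def linear_0[OF l] linear_add[OF l] linear_scale[OF l])
  have "\<exists>c::nat \<Rightarrow> 'a. (\<forall>i<DIM('a) - 1. c i \<in> {v. dlam q v = 0}) \<and>
      (\<forall>i<DIM('a) - 1. \<forall>j<DIM('a) - 1. B (c i) (c j) = (if i = j then 1 else 0))"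
    by (rule orthonormal_family[OF B W]) (use pos dimW in auto)
  then obtain c where c: "\<And>i. i < DIM('a) - 1 \<Longrightarrow> dlam q (c i) = 0"
    "\<And>i j. i < DIM('a) - 1 \<Longrightarrow> j < DIM('a) - 1 \<Longrightarrow> B (c i) (c j) = (if i = j then 1 else 0)" by auto
  obtain i0 :: 'a where i0: "i0 \<in> Basis" using nonempty_Basis by blast
  obtain f where "bij_betw f (Basis - {i0}) {0..<card (Basis - {i0})}"
    using ex_bij_betw_finite_nat[of "Basis - {i0}"] by auto
  moreover have "card (Basis - {i0}) = DIM('a) - 1" using i0 by simp
  ultimately have f: "inj_on f (Basis - {i0})" "\<And>i. i \<in> Basis \<Longrightarrow> i \<noteq> i0 \<Longrightarrow> f i < DIM('a) - 1"
    unfolding bij_betw_def by auto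
  define t where "t = inverse (sqrt (- B q q))"
  have t: "t * (t * B q q) = -1"
  proof -
    have "t * t = inverse (- B q q)" unfolding t_def using neg by (simp flip: inverse_mult_distrib)
    then have "(t * t) * B q q = -1" using neg by simp
    then show ?thesis by (simp add: mult.assoc)
  qed
  define b where "b = (\<lambda>i. if i = i0 then t *\<^sub>R q else c (f i))"
  have "B (b i) (b j) = (if i \<noteq> j then 0 else if i = i0 then -1 else 1)" if "i \<in> Basis" "j \<in> Basis" for i j
  proof -
    have *: "B q (c (f i)) = 0" "B (c (f i)) q = 0" if "i \<in> Basis" "i \<noteq> i0" for i
    proof -
      show "B q (c (f i)) = 0" by (rule orth[OF c(1)[OF f(2)[OF that]]])
      then show "B (c (f i)) q = 0" using B(2)[of q "c (f i)"] by simp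
    qed
    have **: "f i = f j \<longleftrightarrow> i = j" if "i \<in> Basis" "i \<noteq> i0" "j \<in> Basis" "j \<noteq> i0" for i j
      using f(1) that unfolding inj_on_def by auto
    show ?thesis using that * ** t c(2) f(2)
      by (auto simp: b_def bilinear_lmul[OF B(1)] bilinear_rmul[OF B(1)])
  qed
  then show ?thesis using i0 by blast
qed

lemma power_hessian:
  assumes k: "k > 1" and h: "\<And>q. q \<in> U \<Longrightarrow> h q = lam q powr k"
  shows "smooth_on U h"
    "\<And>q u v. q \<in> U \<Longrightarrow> - (1 / k) * hessian h q u v
       = lam q powr (k - 1) * Q q u v - (k - 1) * lam q powr (k - 2) * (dlam q u * dlam q v)"
proof -
  show sh: "smooth_on U h"
    by (rule smooth_on_cong[OF openU _ smooth_on_powr[OF openU smooth_lam lam_pos, of k]]) (use h in auto)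
  have pd: "((\<lambda>q. lam q powr a) has_derivative (\<lambda>v. (a * lam q powr (a - 1)) * dlam q v)) (at q)" if q: "q \<in> U" for q a
  proof -
    have "((\<lambda>x. x powr a) has_derivative (\<lambda>v. (a * lam q powr (a - 1)) * v)) (at (lam q))"
      using has_real_derivative_powr[OF lam_pos[OF q], of a] unfolding has_field_derivative_def by simp
    from has_derivative_compose[OF dlam[OF q] this] show ?thesis .
  qed
  have hd: "frechet_derivative h (at q) v = (k * lam q powr (k - 1)) * dlam q v" if q: "q \<in> U" for q v
  proof -
    have "(h has_derivative (\<lambda>v. (k * lam q powr (k - 1)) * dlam q v)) (at q)"
      by (rule has_derivative_transform_within_open[OF pd[OF q] openU q]) (use h in auto)
    then show ?thesis using frechet_derivative_at by metis
  qed
  fix q u v assume q: "q \<in> U"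
  have d2: "((\<lambda>q. dlam q v) has_derivative (\<lambda>u. hessian lam q u v)) (at q)"
    unfolding hessian_def by (rule smooth_onD[OF smooth_on_frechet[OF smooth_lam] q])
  have "((\<lambda>q. (k * lam q powr (k - 1)) * dlam q v) has_derivative
      (\<lambda>u. (k * lam q powr (k - 1)) * hessian lam q u v + (k * (((k - 1) * lam q powr (k - 1 - 1)) * dlam q u)) * dlam q v)) (at q)"
    by (rule has_derivative_mult[OF has_derivative_mult_right[OF pd[OF q]] d2])
  then have "((\<lambda>q. frechet_derivative h (at q) v) has_derivative
      (\<lambda>u. (k * lam q powr (k - 1)) * hessian lam q u v + (k * (((k - 1) * lam q powr (k - 1 - 1)) * dlam q u)) * dlam q v)) (at q)"
    by (rule has_derivative_transform_within_open[OF _ openU q]) (use hd in auto)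
  from fun_cong[OF frechet_derivative_at[OF this], of u]
  have "hessian h q u v = (k * lam q powr (k - 1)) * hessian lam q u v + (k * (((k - 1) * lam q powr (k - 1 - 1)) * dlam q u)) * dlam q v"
    unfolding hessian_def[of h] by (rule sym)
  then show "- (1 / k) * hessian h q u v
       = lam q powr (k - 1) * Q q u v - (k - 1) * lam q powr (k - 2) * (dlam q u * dlam q v)"
    using k unfolding Q_def by (simp add: field_simps)
qed

lemma power_metric_lorentzian:
  assumes k: "k > 1" and h: "\<And>q. q \<in> U \<Longrightarrow> h q = lam q powr k"
  shows "lorentzian_metric_on U (\<lambda>p u v. - (1 / k) * hessian h p u v)"
  unfolding lorentzian_metric_on_def
proof (intro conjI allI ballI)
  have ph1: "smooth_on U h" by (rule power_hessian(1)[OF k h])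
  have ph2: "- (1 / k) * hessian h q u v
       = lam q powr (k - 1) * Q q u v - (k - 1) * lam q powr (k - 2) * (dlam q u * dlam q v)" if "q \<in> U" for q u v
    by (rule power_hessian(2)[OF k h]) (use that in auto)
  show "smooth_on U (\<lambda>p. - (1 / k) * hessian h p u v)" for u v
    unfolding hessian_def by (intro smooth_on_mult smooth_on_const smooth_on_frechet ph1 openU)
  fix q assume q: "q \<in> U"
  let ?B = "\<lambda>u v. - (1 / k) * hessian h q u v"
  have bh: "bilinear (hessian h q)" by (rule hessian_bilinear[OF openU ph1 q])
  have "linear (\<lambda>x. - (1 / k) * f x)" if "linear f" for f :: "'a \<Rightarrow> real"
    using linear_compose_scale_right[OF that, of "- (1 / k)"] by (simp only: real_scaleR_def)
  then show bil: "bilinear ?B" using bh unfolding bilinear_def by blast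
  show sym: "?B u v = ?B v u" for u v using hessian_sym[OF openU ph1 q, of u v] by simp
  have lp: "lam q powr a > 0" for a using lam_pos[OF q] by simp
  show "\<exists>b. \<exists>i\<^sub>0\<in>Basis. \<forall>i\<in>Basis. \<forall>j\<in>Basis.
           ?B (b i) (b j) = (if i \<noteq> j then 0 else if i = (i\<^sub>0::'a) then -1 else 1)"
  proof (rule lorentz_frame[OF q bil sym])
    show "?B v v > 0" if "dlam q v = 0" "v \<noteq> 0" for v
      unfolding ph2[OF q] using Q_pos_U[OF q that] lp that(1) by simp
    show "?B q q < 0"
      unfolding ph2[OF q] using Q_radial[OF q, of q] lp lam_pos[OF q] k by (simp add: dlam_self[OF q])
    show "?B q v = 0" if "dlam q v = 0" for v
      unfolding ph2[OF q] using Q_radial[OF q] that by simp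
  qed
qed

text \<open>Up to the positive factor \<open>lam\<^sup>k\<^sup>-\<^sup>2\<close> the metric is \<open>lam Q - (k - 1) dlam\<^sup>2\<close>.\<close>

lemma power_metric_timelike:
  assumes k: "k > 1" and h: "\<And>q. q \<in> U \<Longrightarrow> h q = lam q powr k" and q: "q \<in> U"
  shows "- (1 / k) * hessian h q v v < 0 \<longleftrightarrow> lam q * Q q v v < (k - 1) * (dlam q v)\<^sup>2"
proof -
  have "lam q powr (k - 1) = lam q powr ((k - 2) + 1)" by simp
  also have "\<dots> = lam q powr (k - 2) * lam q powr 1" by (rule powr_add)
  also have "\<dots> = lam q powr (k - 2) * lam q" using lam_pos[OF q] by simp
  finally have p: "lam q powr (k - 1) = lam q powr (k - 2) * lam q" .
  have "- (1 / k) * hessian h q v v = lam q powr (k - 1) * Q q v v - (k - 1) * lam q powr (k - 2) * (dlam q v * dlam q v)"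
    by (rule power_hessian(2)[OF k h]) (use q in auto)
  then have "- (1 / k) * hessian h q v v = lam q powr (k - 2) * (lam q * Q q v v - (k - 1) * (dlam q v)\<^sup>2)"
    unfolding p by (simp add: algebra_simps power2_eq_square)
  then show ?thesis using lam_pos[OF q] by (simp add: mult_less_0_iff)
qed

end

section \<open>Global hyperbolicity and completeness\<close>

theorem proposition1p16:
  fixes n :: nat
    and H U :: "(real ^ 'n) set"
    and k :: real
    and h :: "real ^ 'n \<Rightarrow> real"
    and g\<^sub>L :: "real ^ 'n \<Rightarrow> real ^ 'n \<Rightarrow> real ^ 'n \<Rightarrow> real"
  assumes "n \<ge> 1" and "CARD('n) = n + 1"
    and "smooth_hypersurface H" and "connected H"
    and "centroaffine H" and "hyperbolic H" and "euclidean_complete H"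
    and "k > 1"
    and "U = {l *\<^sub>R x | l x. l > 0 \<and> x \<in> H}"
    and "\<And>l x. l > 0 \<Longrightarrow> x \<in> H \<Longrightarrow> h (l *\<^sub>R x) = l powr k"
    and "g\<^sub>L = (\<lambda>p u v. - (1 / k) * hessian h p u v)"
  shows "open U \<and> convex U \<and> lorentzian_metric_on U g\<^sub>L \<and>
         (globally_hyperbolic U g\<^sub>L \<longleftrightarrow> riemannian_complete H (centroaffine_metric H))"
proof -
  note U = assms(9) and hk = assms(10) and k = \<open>k > 1\<close>
  define lam where "lam = (\<lambda>q. h q powr (1 / k))"
  have lamlx: "lam (l *\<^sub>R x) = l" if "l > 0" "x \<in> H" for l x
    using hk[OF that] that k by (simp add: lam_def powr_powr)
  have hlam: "h q = lam q powr k" if "q \<in> U" for q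
    using that hk lamlx unfolding U by auto
  have H_subset: "x \<in> U" if "x \<in> H" for x
    unfolding U using that by (intro CollectI exI[of _ 1] exI[of _ x]) auto
  have nbhd: "\<exists>T. open T \<and> q \<in> T \<and> T \<subseteq> U \<and> smooth_on T lam" if qU: "q \<in> U" for q
  proof -
    obtain l x where lx: "q = l *\<^sub>R x" "l > 0" "x \<in> H" using qU unfolding U by blast
    obtain N s where N: "open N" "x \<in> N" "smooth_on N s" "\<And>q. q \<in> N \<Longrightarrow> s q > 0 \<and> s q *\<^sub>R q \<in> H"
      using hypersurface_radial[OF assms(3,5) lx(3)] by blast
    \<comment> \<open>The solution near the point \<open>x\<close> of \<open>H\<close> is transported along the ray by homogeneity.\<close>
    let ?c = "\<lambda>q. inverse l *\<^sub>R q"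
    let ?T = "?c -` N"
    have oT: "open ?T" using N(1) by (intro open_vimage continuous_intros)
    have eq: "q' = (l * inverse (s (?c q'))) *\<^sub>R (s (?c q') *\<^sub>R ?c q')" "l * inverse (s (?c q')) > 0"
      "s (?c q') *\<^sub>R ?c q' \<in> H" if "q' \<in> ?T" for q'
    proof -
      have a: "s (?c q') > 0" "s (?c q') *\<^sub>R ?c q' \<in> H" using N(4)[of "?c q'"] that by auto
      show "l * inverse (s (?c q')) > 0" "s (?c q') *\<^sub>R ?c q' \<in> H" using a lx(2) by auto
      have "(l * inverse (s (?c q'))) * (s (?c q') * inverse l) = 1" using a(1) lx(2) by (simp add: field_simps)
      then have "((l * inverse (s (?c q'))) * (s (?c q') * inverse l)) *\<^sub>R q' = q'" by (simp only: scaleR_one)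
      then show "q' = (l * inverse (s (?c q'))) *\<^sub>R (s (?c q') *\<^sub>R ?c q')" by (simp only: scaleR_scaleR)
    qed
    have "?T \<subseteq> U"
    proof
      fix q' assume "q' \<in> ?T"
      from eq[OF this] show "q' \<in> U" unfolding U by blast
    qed
    moreover have "smooth_on ?T lam"
    proof (rule smooth_on_cong[OF oT])
      have "smooth_on ?T (\<lambda>q. s (?c q))"
        by (rule smooth_on_compose[OF oT N(1) _ N(3)])
           (auto intro!: smooth_on_scaleR smooth_on_const smooth_on_id oT)
      then show "smooth_on ?T (\<lambda>q. l * inverse (s (?c q)))"
        by (intro smooth_on_mult smooth_on_inverse smooth_on_const oT) (use N(4) in auto)
      show "l * inverse (s (?c q')) = lam q'" if "q' \<in> ?T" for q'
        using lamlx[OF eq(2,3)[OF that]] eq(1)[OF that] by simp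
    qed
    moreover have "q \<in> ?T" using lx N(2) by simp
    ultimately show ?thesis using oT by blast
  qed
  have openU: "open U" using nbhd by (meson openI open_subopen)
  interpret R: radial H U lam
  proof
    show "open U" by (rule openU)
    show "smooth_on U lam" using nbhd by (intro smooth_on_local) blast
    show "lam q > 0" if "q \<in> U" for q using that lamlx unfolding U by auto
    show "l *\<^sub>R q \<in> U" if "l > 0" "q \<in> U" for l q
    proof -
      obtain m x where "q = m *\<^sub>R x" "m > 0" "x \<in> H" using \<open>q \<in> U\<close> unfolding U by blast
      then show ?thesis unfolding U using that(1) by (intro CollectI exI[of _ "l * m"] exI[of _ x]) auto
    qed
    show "lam (l *\<^sub>R q) = l * lam q" if "l > 0" "q \<in> U" for l q
    proof -
      obtain m x where mx: "q = m *\<^sub>R x" "m > 0" "x \<in> H" using \<open>q \<in> U\<close> unfolding U by blast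
      then show ?thesis using lamlx[of "l * m" x] lamlx[of m x] that(1) by simp
    qed
    show "H = {q \<in> U. lam q = 1}"
    proof (intro set_eqI iffI)
      fix x assume "x \<in> H" then show "x \<in> {q \<in> U. lam q = 1}" using lamlx[of 1 x] H_subset by simp
    next
      fix q assume q: "q \<in> {q \<in> U. lam q = 1}"
      then obtain l x where "q = l *\<^sub>R x" "l > 0" "x \<in> H" unfolding U by blast
      then show "q \<in> H" using lamlx[of l x] q by simp
    qed
  qed
  interpret R: hyperbolic_radial H U lam
  proof
    fix p v assume p: "p \<in> H" and v: "frechet_derivative lam (at p) v = 0" "v \<noteq> 0"
    then have t: "v \<in> tangent_space H p" using R.tangent_H by auto
    then have "centroaffine_metric H p v v > 0" using \<open>hyperbolic H\<close> p v(2) unfolding hyperbolic_def by blast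
    then show "R.Q p v v > 0" using R.centroaffine_metric_Q[OF p t t] by simp
  qed
  have "connected ((\<lambda>z. fst z *\<^sub>R snd z) ` ({0::real<..} \<times> H))"
    by (intro connected_continuous_image connected_Times continuous_intros \<open>connected H\<close>) simp
  also have "(\<lambda>z. fst z *\<^sub>R snd z) ` ({0::real<..} \<times> H) = U" unfolding U by force
  finally have "convex U" by (intro R.convex_U \<open>euclidean_complete H\<close>)
  moreover have "lorentzian_metric_on U g\<^sub>L"
    unfolding assms(11) by (rule R.power_metric_lorentzian[OF k hlam])
  moreover have "globally_hyperbolic U g\<^sub>L \<longleftrightarrow> riemannian_complete H (centroaffine_metric H)"
  proof -
    have tl: "g\<^sub>L q v v < 0 \<longleftrightarrow> lam q * R.Q q v v < (k - 1) * (frechet_derivative lam (at q) v)\<^sup>2" if "q \<in> U" for q v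
      unfolding assms(11) by (rule R.power_metric_timelike[OF k hlam]) (use that in auto)
    have k1: "k - 1 > 0" using k by simp
    show ?thesis unfolding globally_hyperbolic_def R.complete_centroaffine
    proof
      assume "\<exists>S. cauchy_hypersurface U g\<^sub>L S"
      then obtain S where S: "cauchy_hypersurface U g\<^sub>L S" by blast
      show "riemannian_complete H R.Q" by (rule R.cauchy_imp_complete[where G = g\<^sub>L, OF k1 tl S])
    next
      assume c: "riemannian_complete H R.Q"
      have "cauchy_hypersurface U g\<^sub>L H" by (rule R.complete_imp_cauchy[where G = g\<^sub>L, OF c k1 tl])
      then show "\<exists>S. cauchy_hypersurface U g\<^sub>L S" by blast
    qed
  qed
  ultimately show ?thesis using openU by blast
qed

end
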